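(* Let $\mathbb D$ be a finite set of elementary $B$-diagrams, and let $c^{\mathbb D}=(c^{\mathbb D}_n)_{n\ge 1}$, where $c^{\mathbb D}_n$ is the number of connected $B$-diagrams with $n$ vertices in $\mathbb B_{\mathbb D}$. Then the algebras $\mathrm{C\Pi QSym}(c^{\mathbb D})$ and $\mathcal B_{\mathbb D}^*$ are isomorphic.
   Context: All vector spaces are over $\mathbb C$; $\llbracket a,b\rrbracket=\{a,a+1,\dots,b\}$. **$B$-diagrams.** For a vector $\lambda=[\lambda_1,\dots,\lambda_n]$ of positive integers put $|\lambda|=\lambda_1+\cdots+\lambda_n$; for $k\in\llbracket 1,|\lambda|\rrbracket$, $\mathrm{block}_\lambda(k)$ is the unique $i$ with $\lambda_1+\cdots+\lambda_{i-1}<k\le\lambda_1+\cdots+\lambda_i$. A $B$-diagram is a 5-tuple $G=(n,\lambda,\varphi,F^\uparrow,F_\downarrow)$ where $n\ge 0$ is an integer, $\lambda=[\lambda_1,\dots,\lambda_n]$ with all $\lambda_i\ge1$, $\varphi:E^\uparrow(G)\to E_\downarrow(G)$ is a bijection between two subsets of $\llbracket 1,|\lambda|\rrbracket$ with $\mathrm{block}_\lambda(a)<\mathrm{block}_\lambda(\varphi(a))$ for all $a\in E^\uparrow(G)$, $F^\uparrow\subset\llbracket1,|\lambda|\rrbracket\setminus E^\uparrow(G)$ and $F_\downarrow\subset\llbracket1,|\lambda|\rrbracket\setminus E_\downarrow(G)$. Write $|G|=n$ (number of vertices), $\omega(G)=|\lambda|$ (weight), $F^\uparrow(G)=F^\uparrow$,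 $F_\downarrow(G)=F_\downarrow$; the edges of $G$ are the pairs $(a,\varphi(a))$, $a\in E^\uparrow(G)$. Such an edge joins the vertices $\mathrm{block}_\lambda(a)$ and $\mathrm{block}_\lambda(\varphi(a))$ in $\llbracket 1,n\rrbracket$. $G$ is connected if $n\geq 1$ and the resulting graph on the vertex set $\llbracket 1,n\rrbracket$ is connected. The empty $B$-diagram ($n=0$) is denoted $\varepsilon$. A $B$-diagram is elementary if $|G|=1$. **Composition.** Let $G=(n,\lambda,\varphi,F^\uparrow,F_\downarrow)$ and $G'=(n',\lambda',\varphi',F'^\uparrow,F'_\downarrow)$ be $B$-diagrams. For $k\ge0$, $a_1<\dots<a_k$ in $F^\uparrow$ and distinct $b_1,\dots,b_k\in F'_\downarrow$, the composition of $G$ and $G'$ along $(a_i),(b_i)$ is the $B$-diagram $(n+n',[\lambda_1,\dots,\lambda_n,\lambda'_1,\dots,\lambda'_{n'}],\varphi'',F''^\uparrow,F''_\downarrow)$ whose edges are the edges of $G$, the edges of $G'$ with both entries shifted by $\omega(G)$, and the edges $(a_i,b_i+\omega(G))$ for $1\le i\le k$, with $F''^\uparrow=(F^\uparrow\setminus\{a_1,\dots,a_k\})\cup\{i+\omega(G)\mid i\in F'^\uparrow\}$ and $F''_\downarrow=F_\downarrow\cup\{i+\omega(G)\mid i\in F'_\downarrow\setminus\{b_1,\dots,b_k\}\}$. The case $k=0$ is the juxtaposition $G|G'$. $G\circledast G'$ denotes the set of all compositions of $G$ and $G'$ (all $k\ge0$ and all admissible $(a_i),(b_i)$); extended to sets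 of diagrams this operation is associative. **$\mathbb B_{\mathbb D}$.** This is the set of $B$-diagrams constructed using only elements of $\mathbb D$, i.e. $\varepsilon$ together with all $G$ belonging to $V_1\circledast V_2\circledast\cdots\circledast V_n$ for some $n\ge1$ and $V_1,\dots,V_n\in\mathbb D$. **Permuting vertices.** For $\sigma\in\mathfrak S_n$ put $\lambda^\sigma=[\lambda_{\sigma(1)},\dots,\lambda_{\sigma(n)}]$ and let $\sigma[\lambda]\in\mathfrak S_{|\lambda|}$ be the permutation whose word is obtained by listing, successively for $i=1,\dots,n$, the elements of $\{k\mid\mathrm{block}_\lambda(k)=\sigma(i)\}$ in increasing order. Define $G^\sigma=(n,\lambda^\sigma,\widetilde\varphi,\widetilde F^\uparrow,\widetilde F_\downarrow)$ by: $i\in\widetilde F^\uparrow\iff\sigma[\lambda](i)\in F^\uparrow$; $i\in\widetilde F_\downarrow\iff\sigma[\lambda](i)\in F_\downarrow$; $\widetilde\varphi(i)=j\iff\varphi(\sigma[\lambda](i))=\sigma[\lambda](j)$. The set $1\cdots n\,\text{ш}\,(n+1)\cdots(n+n')$ (shuffles) consists of the permutations $\sigma\in\mathfrak S_{n+n'}$ in whose word $\sigma(1)\cdots\sigma(n+n')$ the letters $1,\dots,n$ appear in increasing order and the letters $n+1,\dots,n+n'$ appear in increasing order. **The algebra $\mathcal B_{\mathbb D}^*$.** It has basis $\{D_G\mid G\in\mathbb B_{\mathbb D}\}$ (dual to the basis $\mathbb B_{\mathbb D}$ of the algebra $\mathcal B_{\mathbb D}$ spanned by $\mathbb B_{\mathbb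 D}$) and product $$D_G\Cup D_{G'}=\sum_{\sigma\in 1\cdots n\,\text{ш}\,(n+1)\cdots(n+n')}D_{(G|G')^\sigma},\qquad n=|G|,\ n'=|G'|$$ (each $(G|G')^\sigma$ again lies in $\mathbb B_{\mathbb D}$). **The algebra $\mathrm{C\Pi QSym}(a)$.** Let $a=(a_m)_{m\ge1}$ be a sequence of nonnegative integers. A colored set partition of size $n$ (associated with $a$) is a set $\Pi=\{[\pi_1,i_1],\dots,[\pi_k,i_k]\}$ where $\{\pi_1,\dots,\pi_k\}$ is a set partition of $\llbracket1,n\rrbracket$ and $i_\ell\in\llbracket1,a_{\#\pi_\ell}\rrbracket$ for each $\ell$. For a set $\hat\Pi$ of colored blocks with pairwise disjoint supports, $\mathrm{std}(\hat\Pi)$ is obtained by replacing the $i$th smallest integer occurring in the blocks by $i$, keeping the colors. $\alpha^{\Pi}_{\Pi',\Pi''}$ is the number of ordered pairs $(\hat\Pi',\hat\Pi'')$ of disjoint subsets of $\Pi$ with $\hat\Pi'\cup\hat\Pi''=\Pi$, $\mathrm{std}(\hat\Pi')=\Pi'$ and $\mathrm{std}(\hat\Pi'')=\Pi''$. $\mathrm{C\Pi QSym}(a)$ is the vector space with basis $\Psi_\Pi$ indexed by the colored set partitions associated with $a$, with product $\Psi_{\Pi'}\Psi_{\Pi''}=\sum_{\Pi}\alpha^{\Pi}_{\Pi',\Pi''}\Psi_\Pi$. *)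

theory Defs
  imports
    Complex_Main
    "HOL-Library.Poly_Mapping"
    "HOL-Library.Disjoint_Sets"
    "HOL-Combinatorics.Permutations"
    "HOL-Algebra.Module"
    "HOL-Algebra.QuotRing"
begin

section \<open>B-diagrams\<close>

text \<open>
  A diagram \<open>(n, \<lambda>, \<phi>, F\<up>, F\<down>)\<close> is represented without the redundant entry \<open>n\<close>, which is the
  length of \<open>\<lambda>\<close>. The bijection \<open>\<phi>\<close> between \<open>E\<up>\<close> and \<open>E\<down>\<close> is an injective partial map with domain
  \<open>E\<up>\<close> and range \<open>E\<down>\<close>. All indices (vertices and half-edges) start at 1.
\<close>

record bdiagram =
  lam :: "nat list"
  phi :: "nat \<rightharpoonup> nat"
  Fup :: "nat set"
  Fdown :: "nat set"

definition block :: "nat list \<Rightarrow> nat \<Rightarrow> nat" where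
  "block ls k = (THE i. i \<in> {1..length ls} \<and>
     sum_list (take (i - 1) ls) < k \<and> k \<le> sum_list (take i ls))"

definition nverts :: "bdiagram \<Rightarrow> nat" where
  "nverts G = length (lam G)"

definition weight :: "bdiagram \<Rightarrow> nat" where
  "weight G = sum_list (lam G)"

definition is_bdiagram :: "bdiagram \<Rightarrow> bool" where
  "is_bdiagram G \<longleftrightarrow>
     (\<forall>l \<in> set (lam G). 1 \<le> l) \<and>
     dom (phi G) \<subseteq> {1..weight G} \<and>
     ran (phi G) \<subseteq> {1..weight G} \<and>
     inj_on (phi G) (dom (phi G)) \<and>
     (\<forall>a b. phi G a = Some b \<longrightarrow> block (lam G) a < block (lam G) b) \<and>
     Fup G \<subseteq> {1..weight G} - dom (phi G) \<and>
     Fdown G \<subseteq> {1..weight G} - ran (phi G)"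

definition elementary :: "bdiagram \<Rightarrow> bool" where
  "elementary G \<longleftrightarrow> is_bdiagram G \<and> nverts G = 1"

definition vertex_adj :: "bdiagram \<Rightarrow> (nat \<times> nat) set" where
  "vertex_adj G = {(block (lam G) a, block (lam G) b) | a b. phi G a = Some b}"

definition connected_bdiagram :: "bdiagram \<Rightarrow> bool" where
  "connected_bdiagram G \<longleftrightarrow> nverts G \<ge> 1 \<and>
     (\<forall>u \<in> {1..nverts G}. \<forall>v \<in> {1..nverts G}. (u, v) \<in> (vertex_adj G \<union> (vertex_adj G)\<inverse>)\<^sup>*)"

definition empty_bdiagram :: bdiagram where
  "empty_bdiagram = \<lparr>lam = [], phi = Map.empty, Fup = {}, Fdown = {}\<rparr>"


section \<open>Composition and the diagrams generated by a set\<close>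

definition shift_map :: "nat \<Rightarrow> (nat \<rightharpoonup> nat) \<Rightarrow> (nat \<rightharpoonup> nat)" where
  "shift_map w f = (\<lambda>x. if w < x then map_option (\<lambda>y. y + w) (f (x - w)) else None)"

definition compose_along :: "bdiagram \<Rightarrow> bdiagram \<Rightarrow> nat list \<Rightarrow> nat list \<Rightarrow> bdiagram" where
  "compose_along G G' as bs =
     \<lparr>lam = lam G @ lam G',
      phi = phi G ++ shift_map (weight G) (phi G')
              ++ map_of (zip as (map (\<lambda>b. b + weight G) bs)),
      Fup = (Fup G - set as) \<union> (\<lambda>i. i + weight G) ` Fup G',
      Fdown = Fdown G \<union> (\<lambda>i. i + weight G) ` (Fdown G' - set bs)\<rparr>"

definition juxtapose :: "bdiagram \<Rightarrow> bdiagram \<Rightarrow> bdiagram" where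
  "juxtapose G G' = compose_along G G' [] []"

definition compositions :: "bdiagram \<Rightarrow> bdiagram \<Rightarrow> bdiagram set" where
  "compositions G G' = {compose_along G G' as bs | as bs.
     length as = length bs \<and> sorted_wrt (<) as \<and> set as \<subseteq> Fup G \<and>
     distinct bs \<and> set bs \<subseteq> Fdown G'}"

definition compositions_set :: "bdiagram set \<Rightarrow> bdiagram set \<Rightarrow> bdiagram set" where
  "compositions_set \<G> \<H> = (\<Union>G \<in> \<G>. \<Union>H \<in> \<H>. compositions G H)"

text \<open>The iterated composition is bracketed to the left; the operation is associative.\<close>

definition generated :: "bdiagram set \<Rightarrow> bdiagram set" where
  "generated \<D> = {empty_bdiagram} \<union>
     {G. \<exists>V Vs. set (V # Vs) \<subseteq> \<D> \<and> G \<in> foldl (\<lambda>\<G> W. compositions_set \<G> {W}) {V} Vs}"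

definition num_connected :: "bdiagram set \<Rightarrow> nat \<Rightarrow> nat" where
  "num_connected \<D> n = card {G \<in> generated \<D>. connected_bdiagram G \<and> nverts G = n}"


section \<open>Permuting vertices\<close>

definition block_perm_word :: "(nat \<Rightarrow> nat) \<Rightarrow> nat list \<Rightarrow> nat list" where
  "block_perm_word \<sigma> ls =
     concat (map (\<lambda>i. filter (\<lambda>k. block ls k = \<sigma> i) [1..<sum_list ls + 1]) [1..<length ls + 1])"

text \<open>The permutation \<open>\<sigma>[\<lambda>]\<close>, extended by the identity outside \<open>{1..|\<lambda>|}\<close>.\<close>

definition block_perm :: "(nat \<Rightarrow> nat) \<Rightarrow> nat list \<Rightarrow> nat \<Rightarrow> nat" where
  "block_perm \<sigma> ls i = (if i \<in> {1..sum_list ls} then block_perm_word \<sigma> ls ! (i - 1) else i)"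

text \<open>
  Since \<open>\<sigma>[\<lambda>]\<close> is a bijection, the new edge map sends \<open>i\<close> to \<open>j\<close> iff \<open>\<phi>\<close> sends \<open>\<sigma>[\<lambda>](i)\<close> to
  \<open>\<sigma>[\<lambda>](j)\<close>. The inverse is written \<open>inv_into UNIV\<close> because \<open>inv\<close> is also group-inverse syntax here.
\<close>

definition permute_vertices :: "bdiagram \<Rightarrow> (nat \<Rightarrow> nat) \<Rightarrow> bdiagram" where
  "permute_vertices G \<sigma> = (let \<tau> = block_perm \<sigma> (lam G) in
     \<lparr>lam = map (\<lambda>i. lam G ! (\<sigma> i - 1)) [1..<nverts G + 1],
      phi = (\<lambda>i. map_option (inv_into UNIV \<tau>) (phi G (\<tau> i))),
      Fup = {i. \<tau> i \<in> Fup G},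
      Fdown = {i. \<tau> i \<in> Fdown G}\<rparr>)"

definition shuffle_perms :: "nat \<Rightarrow> nat \<Rightarrow> (nat \<Rightarrow> nat) set" where
  "shuffle_perms n n' = {\<sigma>. \<sigma> permutes {1..n + n'} \<and>
     strict_mono_on {p \<in> {1..n + n'}. \<sigma> p \<in> {1..n}} \<sigma> \<and>
     strict_mono_on {p \<in> {1..n + n'}. \<sigma> p \<in> {n + 1..n + n'}} \<sigma>}"


section \<open>Algebras given by a basis and a multiplication table\<close>

text \<open>
  The complex vector space with basis \<open>B\<close> consists of the finitely supported functions with support
  in \<open>B\<close>; the basis vector of \<open>b\<close> is \<open>Poly_Mapping.single b 1\<close>. The product is the bilinear
  extension of \<open>m\<close>, where \<open>m b b'\<close> is the product of the basis vectors of \<open>b\<close> and \<open>b'\<close>, and the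
  basis vector of \<open>e\<close> is the unit.
\<close>

definition scale :: "complex \<Rightarrow> ('b \<Rightarrow>\<^sub>0 complex) \<Rightarrow> ('b \<Rightarrow>\<^sub>0 complex)" where
  "scale c x = Poly_Mapping.map (\<lambda>z. c * z) x"

definition based_algebra ::
    "'b set \<Rightarrow> 'b \<Rightarrow> ('b \<Rightarrow> 'b \<Rightarrow> ('b \<Rightarrow>\<^sub>0 complex)) \<Rightarrow> (complex, 'b \<Rightarrow>\<^sub>0 complex) module" where
  "based_algebra B e m =
     \<lparr>carrier = {x. Poly_Mapping.keys x \<subseteq> B},
      monoid.mult = (\<lambda>x y. \<Sum>b \<in> Poly_Mapping.keys x. \<Sum>b' \<in> Poly_Mapping.keys y.
         scale (Poly_Mapping.lookup x b * Poly_Mapping.lookup y b') (m b b')),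
      one = Poly_Mapping.single e 1,
      ring.zero = 0,
      ring.add = (+),
      smult = scale\<rparr>"

definition algebra_isomorphic ::
    "('k, 'a, 'm) module_scheme \<Rightarrow> ('k, 'b, 'n) module_scheme \<Rightarrow> bool" where
  "algebra_isomorphic A A' \<longleftrightarrow>
     (\<exists>h \<in> ring_iso A A'. \<forall>c. \<forall>x \<in> carrier A. h (c \<odot>\<^bsub>A\<^esub> x) = c \<odot>\<^bsub>A'\<^esub> h x)"


section \<open>The two algebras\<close>

definition diagram_product :: "bdiagram \<Rightarrow> bdiagram \<Rightarrow> (bdiagram \<Rightarrow>\<^sub>0 complex)" where
  "diagram_product G G' = (\<Sum>\<sigma> \<in> shuffle_perms (nverts G) (nverts G').
     Poly_Mapping.single (permute_vertices (juxtapose G G') \<sigma>) 1)"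

definition dual_diagram_algebra :: "bdiagram set \<Rightarrow> (complex, bdiagram \<Rightarrow>\<^sub>0 complex) module" where
  "dual_diagram_algebra \<D> = based_algebra (generated \<D>) empty_bdiagram diagram_product"

text \<open>
  A coloured set partition is a set of pairs (block, colour); the injectivity of \<open>fst\<close> says that
  each block carries exactly one colour. The value \<open>a 0\<close> is irrelevant as blocks are nonempty.
\<close>

type_synonym cpartition = "(nat set \<times> nat) set"

definition cpartition_of :: "(nat \<Rightarrow> nat) \<Rightarrow> nat \<Rightarrow> cpartition \<Rightarrow> bool" where
  "cpartition_of a n Q \<longleftrightarrow> partition_on {1..n} (fst ` Q) \<and> inj_on fst Q \<and>
     (\<forall>(p, i) \<in> Q. i \<in> {1..a (card p)})"

definition cpartitions :: "(nat \<Rightarrow> nat) \<Rightarrow> cpartition set" where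
  "cpartitions a = {Q. \<exists>n. cpartition_of a n Q}"

text \<open>The \<open>i\<close>th smallest element \<open>x\<close> of a finite set \<open>S\<close> satisfies \<open>i = card {y \<in> S. y \<le> x}\<close>.\<close>

definition standardize :: "cpartition \<Rightarrow> cpartition" where
  "standardize P = (let S = \<Union>(fst ` P) in
     (\<lambda>(p, i). ((\<lambda>x. card {y \<in> S. y \<le> x}) ` p, i)) ` P)"

definition alpha :: "cpartition \<Rightarrow> cpartition \<Rightarrow> cpartition \<Rightarrow> nat" where
  "alpha Q Q' Q'' = card {(P', P''). P' \<inter> P'' = {} \<and> P' \<union> P'' = Q \<and>
     standardize P' = Q' \<and> standardize P'' = Q''}"

text \<open>
  The sum ranges only over the nonzero terms, which are finitely many: \<open>alpha Q Q' Q'' \<noteq> 0\<close> forces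
  the size of \<open>Q\<close> to be the sum of the sizes of \<open>Q'\<close> and \<open>Q''\<close>.
\<close>

definition cpartition_product ::
    "(nat \<Rightarrow> nat) \<Rightarrow> cpartition \<Rightarrow> cpartition \<Rightarrow> (cpartition \<Rightarrow>\<^sub>0 complex)" where
  "cpartition_product a Q' Q'' = (\<Sum>Q \<in> {Q \<in> cpartitions a. alpha Q Q' Q'' \<noteq> 0}.
     Poly_Mapping.single Q (of_nat (alpha Q Q' Q'')))"

definition CPiQSym :: "(nat \<Rightarrow> nat) \<Rightarrow> (complex, cpartition \<Rightarrow>\<^sub>0 complex) module" where
  "CPiQSym a = based_algebra (cpartitions a) {} (cpartition_product a)"

end

theory Submission
  imports Defs
begin

text \<open>
  A diagram with \<open>n\<close> vertices is the same thing as a colouring of its connected components: relabel each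
  component increasingly by \<open>1, \<dots>, m\<close> and record which of the \<open>c\<^sub>m\<close> connected diagrams arises. This
  gives a bijection between coloured set partitions and \<open>generated \<D>\<close>, and the bijection of bases is
  already multiplicative. A shuffle amounts to the choice of the set \<open>S\<close> of positions taken by the first
  factor, and both products are the sum, over all \<open>S\<close>, of the union of the first factor relabelled
  increasingly by \<open>S\<close> and the second one relabelled increasingly by the complement of \<open>S\<close>.

  To make unions and relabellings of diagrams literal, a diagram is encoded as a set of atoms: one atom per
  vertex, carrying its elementary diagram, and one atom per edge, where a half-edge is addressed by its
  vertex and its position within the block of that vertex.
\<close>


section \<open>Algebras with matching bases\<close>

text \<open>Products of diagrams renumber half-edges globally: permuting vertices acts through
  \<open>block_perm\<close>, and composing shifts by \<open>weight\<close>. With half-edges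
  addressed inside their vertices, only vertex labels move. Composition also turns free half-edges
  into used ones, which would change the diagram seen at a vertex; a vertex atom therefore records
  the half-edges that are free or used, and this record never changes. As the elements of
  \<open>\<D>\<close> are elementary, membership in \<open>generated \<D>\<close> becomes a local
  condition: every vertex carries an element of \<open>\<D>\<close>, edges run from an upper
  half-edge to a lower half-edge of a later vertex, and no upper and no lower half-edge is used
  twice. Such a condition passes to connected components, to disjoint unions and to increasing
  relabellings; they must be increasing because edges follow the order of the vertices. That the
  condition characterises the generated diagrams is seen by removing the last vertex. Finiteness of
  \<open>\<D>\<close> makes \<open>num_connected \<D> m\<close> a true count, so colours can number
  the connected diagrams in an arbitrary order, and the isomorphism depends on that choice.\<close>

lemma lookup_scale [simp]: "Poly_Mapping.lookup (scale c x) b = c * Poly_Mapping.lookup x b"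
  unfolding scale_def by (simp add: Poly_Mapping.map.rep_eq when_def)

lemma scale_single: "scale c (Poly_Mapping.single b d) = Poly_Mapping.single b (c * d)"
  by (rule poly_mapping_eqI) (simp add: lookup_single when_def)

lemma scale_sum: "scale c (\<Sum>i\<in>I. x i) = (\<Sum>i\<in>I. scale c (x i))"
  by (rule poly_mapping_eqI) (simp add: lookup_sum sum_distrib_left)

text \<open>The linear extension of a map between bases. Coefficients of basis elements with the
  same image add up.\<close>

definition pushforward :: "('b \<Rightarrow> 'c) \<Rightarrow> ('b \<Rightarrow>\<^sub>0 complex) \<Rightarrow> ('c \<Rightarrow>\<^sub>0 complex)" where
  "pushforward f x = (\<Sum>b\<in>Poly_Mapping.keys x. Poly_Mapping.single (f b) (Poly_Mapping.lookup x b))"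

text \<open>Indices outside the support contribute zero. Vectors with different supports can thus be
  summed over one common index set, which is how additivity becomes a termwise statement.\<close>

lemma pushforward_superset:
  assumes "finite K" "Poly_Mapping.keys x \<subseteq> K"
  shows "pushforward f x = (\<Sum>b\<in>K. Poly_Mapping.single (f b) (Poly_Mapping.lookup x b))"
  unfolding pushforward_def
  by (rule sum.mono_neutral_left) (use assms in \<open>auto simp: in_keys_iff\<close>)

lemma pushforward_single: "pushforward f (Poly_Mapping.single b c) = Poly_Mapping.single (f b) c"
  by (subst pushforward_superset[of "{b}"]) auto

lemma pushforward_add: "pushforward f (x + y) = pushforward f x + pushforward f y"
proof -
  let ?K = "Poly_Mapping.keys x \<union> Poly_Mapping.keys y"
  have "Poly_Mapping.keys (x + y) \<subseteq> ?K" by (rule Poly_Mapping.keys_add)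
  then show ?thesis
    by (simp add: pushforward_superset[of ?K] lookup_add single_add sum.distrib)
qed

lemma pushforward_sum: "pushforward f (\<Sum>i\<in>I. x i) = (\<Sum>i\<in>I. pushforward f (x i))"
proof -
  have "pushforward f 0 = 0" by (simp add: pushforward_def)
  then show ?thesis
    by (induction I rule: infinite_finite_induct) (simp_all add: pushforward_add)
qed

lemma pushforward_scale: "pushforward f (scale c x) = scale c (pushforward f x)"
proof -
  have "Poly_Mapping.keys (scale c x) \<subseteq> Poly_Mapping.keys x" by (auto simp: in_keys_iff)
  then have "pushforward f (scale c x) =
      (\<Sum>b\<in>Poly_Mapping.keys x. Poly_Mapping.single (f b) (Poly_Mapping.lookup (scale c x) b))"
    by (intro pushforward_superset) auto
  then show ?thesis
    by (simp add: pushforward_def scale_sum scale_single)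
qed

text \<open>Injectivity has to include \<open>b\<close> itself: for \<open>b\<close> outside the
  support, a collision with a support element would replace the coefficient 0.\<close>

lemma lookup_pushforward:
  assumes "inj_on f (insert b (Poly_Mapping.keys x))"
  shows "Poly_Mapping.lookup (pushforward f x) (f b) = Poly_Mapping.lookup x b"
proof -
  have "Poly_Mapping.lookup (pushforward f x) (f b) =
      (\<Sum>a\<in>insert b (Poly_Mapping.keys x). if f a = f b then Poly_Mapping.lookup x a else 0)"
    by (subst pushforward_superset[of "insert b (Poly_Mapping.keys x)"])
      (auto simp: lookup_sum lookup_single when_def)
  also have "\<dots> = (\<Sum>a\<in>insert b (Poly_Mapping.keys x). if a = b then Poly_Mapping.lookup x a else 0)"
    using inj_onD[OF assms] by (intro sum.cong) auto
  also have "\<dots> = Poly_Mapping.lookup x b" by (simp add: sum.delta)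
  finally show ?thesis .
qed

lemma keys_pushforward:
  assumes "inj_on f (Poly_Mapping.keys x)"
  shows "Poly_Mapping.keys (pushforward f x) = f ` Poly_Mapping.keys x"
proof
  show "Poly_Mapping.keys (pushforward f x) \<subseteq> f ` Poly_Mapping.keys x"
    unfolding pushforward_def by (rule order.trans[OF keys_sum]) auto
  show "f ` Poly_Mapping.keys x \<subseteq> Poly_Mapping.keys (pushforward f x)"
    using assms by (auto simp: in_keys_iff insert_absorb lookup_pushforward)
qed

lemma pushforward_inverse:
  assumes "\<And>b. b \<in> Poly_Mapping.keys x \<Longrightarrow> g (f b) = b"
  shows "pushforward g (pushforward f x) = x"
proof -
  have "pushforward g (pushforward f x) =
      (\<Sum>b\<in>Poly_Mapping.keys x. Poly_Mapping.single b (Poly_Mapping.lookup x b))"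
    using assms by (simp add: pushforward_def[of f] pushforward_sum pushforward_single)
  also have "\<dots> = x"
    by (rule poly_mapping_eqI) (simp add: lookup_sum lookup_single when_def in_keys_iff)
  finally show ?thesis .
qed

text \<open>Both products are bilinear extensions of tables on the bases, so everything is decided
  on basis vectors. The inverse of the linear extension is the linear extension of the inverse
  bijection.\<close>

lemma based_algebra_isomorphicI:
  assumes bij: "bij_betw f B B'"
    and e: "f e = e'"
    and closed: "\<And>b c. b \<in> B \<Longrightarrow> c \<in> B \<Longrightarrow> Poly_Mapping.keys (m b c) \<subseteq> B"
    and mult: "\<And>b c. b \<in> B \<Longrightarrow> c \<in> B \<Longrightarrow> m' (f b) (f c) = pushforward f (m b c)"
  shows "algebra_isomorphic (based_algebra B e m) (based_algebra B' e' m')"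
proof -
  let ?A = "based_algebra B e m" and ?A' = "based_algebra B' e' m'"
  let ?h = "pushforward f" and ?g = "inv_into B f"
  have inj: "inj_on f X" if "X \<subseteq> B" for X
    using bij that by (meson bij_betw_def inj_on_subset)
  have to: "f ` X \<subseteq> B'" if "X \<subseteq> B" for X
    using bij that by (auto simp: bij_betw_def)
  have from_B': "?g ` X \<subseteq> B" if "X \<subseteq> B'" for X
    using bij_betw_inv_into[OF bij] that by (auto simp: bij_betw_def)
  have inj': "inj_on ?g X" if "X \<subseteq> B'" for X
    using bij_betw_inv_into[OF bij] that by (meson bij_betw_def inj_on_subset)
  have "bij_betw ?h (carrier ?A) (carrier ?A')"
  proof (rule bij_betw_byWitness[where f' = "pushforward ?g"])
    show "\<forall>x\<in>carrier ?A. pushforward ?g (?h x) = x"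
      using bij_betw_inv_into_left[OF bij]
      by (auto simp: based_algebra_def intro!: pushforward_inverse)
    show "\<forall>x\<in>carrier ?A'. ?h (pushforward ?g x) = x"
      using bij_betw_inv_into_right[OF bij]
      by (auto simp: based_algebra_def intro!: pushforward_inverse)
    show "?h ` carrier ?A \<subseteq> carrier ?A'"
      using to by (simp add: based_algebra_def keys_pushforward inj image_subset_iff)
    show "pushforward ?g ` carrier ?A' \<subseteq> carrier ?A"
      using from_B' by (simp add: based_algebra_def keys_pushforward inj' image_subset_iff)
  qed
  moreover have "?h (x \<otimes>\<^bsub>?A\<^esub> y) = ?h x \<otimes>\<^bsub>?A'\<^esub> ?h y" if "x \<in> carrier ?A" "y \<in> carrier ?A" for x y
  proof -
    have sub: "Poly_Mapping.keys x \<subseteq> B" "Poly_Mapping.keys y \<subseteq> B"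
      using that by (auto simp: based_algebra_def)
    have lx: "Poly_Mapping.lookup (?h z) (f b) = Poly_Mapping.lookup z b"
      if "Poly_Mapping.keys z \<subseteq> B" "b \<in> Poly_Mapping.keys z" for b z
      using that by (intro lookup_pushforward inj) auto
    have "?h (x \<otimes>\<^bsub>?A\<^esub> y) = (\<Sum>b\<in>Poly_Mapping.keys x. \<Sum>c\<in>Poly_Mapping.keys y.
        scale (Poly_Mapping.lookup x b * Poly_Mapping.lookup y c) (?h (m b c)))"
      by (simp add: based_algebra_def pushforward_sum pushforward_scale)
    also have "\<dots> = (\<Sum>b\<in>Poly_Mapping.keys x. \<Sum>c\<in>Poly_Mapping.keys y.
        scale (Poly_Mapping.lookup (?h x) (f b) * Poly_Mapping.lookup (?h y) (f c)) (m' (f b) (f c)))"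
      using sub by (intro sum.cong refl) (auto simp: lx mult subset_iff)
    \<comment> \<open>The supports of \<open>?h x\<close> and \<open>?h y\<close> are the injective
      images of those of \<open>x\<close> and \<open>y\<close>, so the double sum can be
      reindexed.\<close>
    also have "\<dots> = ?h x \<otimes>\<^bsub>?A'\<^esub> ?h y"
      by (simp add: based_algebra_def keys_pushforward inj sub sum.reindex)
    finally show ?thesis .
  qed
  moreover have "?h (\<one>\<^bsub>?A\<^esub>) = \<one>\<^bsub>?A'\<^esub>"
    by (simp add: based_algebra_def pushforward_single e)
  moreover have "?h (x \<oplus>\<^bsub>?A\<^esub> y) = ?h x \<oplus>\<^bsub>?A'\<^esub> ?h y" for x y
    by (simp add: based_algebra_def pushforward_add)
  ultimately have "?h \<in> ring_iso ?A ?A'"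
    unfolding ring_iso_def by (auto intro!: ring_hom_memI simp: bij_betw_def)
  moreover have "?h (c \<odot>\<^bsub>?A\<^esub> x) = c \<odot>\<^bsub>?A'\<^esub> ?h x" for c x
    by (simp add: based_algebra_def pushforward_scale)
  ultimately show ?thesis unfolding algebra_isomorphic_def by blast
qed

section \<open>Shuffles and subsets of positions\<close>

text \<open>The counting formula is the one inside \<open>standardize\<close>, which thereby becomes
  a relabelling by \<open>rank\<close>.\<close>

definition rank :: "nat set \<Rightarrow> nat \<Rightarrow> nat" where
  "rank S x = card {y \<in> S. y \<le> x}"

text \<open>The increasing enumeration of a finite \<open>S\<close>, starting at 1; only its values
  on \<open>{1..card S}\<close> carry meaning.\<close>

definition nth_of :: "nat set \<Rightarrow> nat \<Rightarrow> nat" where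
  "nth_of S = inv_into S (rank S)"

lemma strict_mono_on_rank:
  assumes "finite S"
  shows "strict_mono_on S (rank S)"
proof (rule strict_mono_onI)
  fix x y assume "x \<in> S" "y \<in> S" "x < y"
  then have "{z \<in> S. z \<le> x} \<subseteq> {z \<in> S. z \<le> y}" "y \<in> {z \<in> S. z \<le> y}" "y \<notin> {z \<in> S. z \<le> x}"
    by auto
  then have "{z \<in> S. z \<le> x} \<subset> {z \<in> S. z \<le> y}" by blast
  then show "rank S x < rank S y"
    unfolding rank_def using assms by (intro psubset_card_mono) auto
qed

lemma bij_betw_rank:
  assumes "finite S"
  shows "bij_betw (rank S) S {1..card S}"
proof -
  have inj: "inj_on (rank S) S"
    using strict_mono_on_rank[OF assms] by (rule strict_mono_on_imp_inj_on)
  have sub: "rank S ` S \<subseteq> {1..card S}"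
  proof clarsimp
    fix x assume "x \<in> S"
    then have "rank S x \<le> card S" "0 < rank S x"
      unfolding rank_def using assms by (auto intro: card_mono simp: card_gt_0_iff)
    then show "Suc 0 \<le> rank S x \<and> rank S x \<le> card S" by simp
  qed
  have "rank S ` S = {1..card S}"
    by (rule card_subset_eq) (use sub inj in \<open>auto simp: card_image\<close>)
  with inj show ?thesis by (simp add: bij_betw_def)
qed

lemma bij_betw_nth_of: "finite S \<Longrightarrow> bij_betw (nth_of S) {1..card S} S"
  unfolding nth_of_def by (intro bij_betw_inv_into bij_betw_rank)

lemma nth_of_rank: "finite S \<Longrightarrow> x \<in> S \<Longrightarrow> nth_of S (rank S x) = x"
  unfolding nth_of_def by (meson bij_betw_inv_into_left bij_betw_rank)

lemma rank_nth_of: "finite S \<Longrightarrow> k \<in> {1..card S} \<Longrightarrow> rank S (nth_of S k) = k"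
  unfolding nth_of_def by (meson bij_betw_inv_into_right bij_betw_rank)

lemma nth_of_mem: "finite S \<Longrightarrow> k \<in> {1..card S} \<Longrightarrow> nth_of S k \<in> S"
  using bij_betw_nth_of[of S] by (auto simp: bij_betw_def)

lemma nth_of_image: "finite S \<Longrightarrow> nth_of S ` {1..card S} = S"
  using bij_betw_nth_of[of S] by (auto simp: bij_betw_def)

lemma rank_image: "finite S \<Longrightarrow> rank S ` S = {1..card S}"
  using bij_betw_rank[of S] by (auto simp: bij_betw_def)

lemma strict_mono_on_nth_of:
  assumes "finite S"
  shows "strict_mono_on {1..card S} (nth_of S)"
proof (rule strict_mono_onI, rule ccontr)
  fix k l assume kl: "k \<in> {1..card S}" "l \<in> {1..card S}" "k < l" "\<not> nth_of S k < nth_of S l"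
  then have "rank S (nth_of S l) \<le> rank S (nth_of S k)"
    unfolding rank_def using assms by (intro card_mono) auto
  then show False using kl assms by (simp add: rank_nth_of)
qed

lemma rank_strict_mono_image:
  assumes "strict_mono_on S f" "x \<in> S"
  shows "rank (f ` S) (f x) = rank S x"
proof -
  have "{y \<in> f ` S. y \<le> f x} = f ` {y \<in> S. y \<le> x}"
    using assms(2) by (auto simp: strict_mono_on_less_eq[OF assms(1)])
  moreover have "inj_on f {y \<in> S. y \<le> x}"
    using strict_mono_on_imp_inj_on[OF assms(1)] by (rule inj_on_subset) auto
  ultimately show ?thesis unfolding rank_def by (simp add: card_image)
qed

text \<open>Increasing maps preserve ranks and hence increasing enumerations. Through this fact a
  component keeps its colour when it is moved by an increasing map, see
  \<open>piece_relabel\<close>.\<close>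

lemma nth_of_strict_mono_image:
  assumes "finite S" "strict_mono_on S f" "k \<in> {1..card S}"
  shows "nth_of (f ` S) k = f (nth_of S k)"
proof -
  have "nth_of (f ` S) (rank (f ` S) (f (nth_of S k))) = f (nth_of S k)"
    using assms by (intro nth_of_rank) (auto simp: nth_of_mem)
  then show ?thesis
    using assms by (simp add: rank_strict_mono_image nth_of_mem rank_nth_of)
qed

lemma nth_of_interval:
  assumes "k \<in> {1..n}"
  shows "nth_of {1..n} k = k"
proof -
  have "rank {1..n} k = k"
  proof -
    have "{y \<in> {1..n}. y \<le> k} = {1..k}" using assms by auto
    then show ?thesis by (simp add: rank_def)
  qed
  then show ?thesis using nth_of_rank[of "{1..n}" k] assms by simp
qed

lemma nth_of_unique:
  assumes "strict_mono_on {1..n} f" "k \<in> {1..n}"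
  shows "nth_of (f ` {1..n}) k = f k"
proof -
  have "nth_of (f ` {1..n}) k = f (nth_of {1..n} k)"
    using assms by (intro nth_of_strict_mono_image) auto
  then show ?thesis by (simp only: nth_of_interval[OF assms(2)])
qed

section \<open>Choices of positions and the shuffles belonging to them\<close>

definition splittings :: "nat \<Rightarrow> nat \<Rightarrow> nat set set" where
  "splittings n n' = {S. S \<subseteq> {1..n + n'} \<and> card S = n}"

lemma finite_splittings [simp]: "finite (splittings n n')"
  unfolding splittings_def by auto

lemma splittings_complement:
  assumes "S \<in> splittings n n'"
  shows "finite S" "card S = n" "card ({1..n + n'} - S) = n'"
proof -
  show fin: "finite S" using assms finite_subset[of S "{1..n + n'}"] by (auto simp: splittings_def)
  show "card S = n" using assms by (auto simp: splittings_def)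
  then show "card ({1..n + n'} - S) = n'"
    using assms fin by (auto simp: card_Diff_subset splittings_def)
qed

text \<open>The inverse of the shuffle that puts the letters \<open>1, \<dots>, n\<close> at the positions in \<open>S\<close>.\<close>

definition unshuffle :: "nat \<Rightarrow> nat \<Rightarrow> nat set \<Rightarrow> nat \<Rightarrow> nat" where
  "unshuffle n n' S k = (if k \<in> {1..n} then nth_of S k
     else if k \<in> {n + 1..n + n'} then nth_of ({1..n + n'} - S) (k - n) else k)"

lemma unshuffle_permutes:
  assumes "S \<in> splittings n n'"
  shows "unshuffle n n' S permutes {1..n + n'}"
proof -
  let ?T = "{1..n + n'} - S"
  note S = splittings_complement[OF assms]
  have T: "card ?T = n'" "finite ?T" by (rule S(3)) simp
  have "bij_betw (unshuffle n n' S) {1..n} S"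
  proof -
    have "bij_betw (unshuffle n n' S) {1..n} S \<longleftrightarrow> bij_betw (nth_of S) {1..n} S"
      by (rule bij_betw_cong) (simp add: unshuffle_def)
    then show ?thesis using bij_betw_nth_of[OF S(1)] by (simp only: S(2))
  qed
  moreover have "bij_betw (unshuffle n n' S) {n + 1..n + n'} ?T"
  proof -
    have "bij_betw (\<lambda>k. k - n) {n + 1..n + n'} {1..n'}"
      by (rule bij_betw_byWitness[where f' = "\<lambda>k. k + n"]) auto
    moreover have "bij_betw (nth_of ?T) {1..n'} ?T"
      using bij_betw_nth_of[OF T(2)] T(1) by simp
    ultimately have "bij_betw (nth_of ?T \<circ> (\<lambda>k. k - n)) {n + 1..n + n'} ?T"
      by (rule bij_betw_trans)
    moreover have "bij_betw (unshuffle n n' S) {n + 1..n + n'} ?T \<longleftrightarrow>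
        bij_betw (nth_of ?T \<circ> (\<lambda>k. k - n)) {n + 1..n + n'} ?T"
      by (rule bij_betw_cong) (simp add: unshuffle_def)
    ultimately show ?thesis by blast
  qed
  ultimately have "bij_betw (unshuffle n n' S) ({1..n} \<union> {n + 1..n + n'}) (S \<union> ?T)"
    by (rule bij_betw_combine) auto
  moreover have "{1..n} \<union> {n + 1..n + n'} = {1..n + n'}" by auto
  moreover have "S \<union> ?T = {1..n + n'}" using assms by (auto simp: splittings_def)
  ultimately have "bij_betw (unshuffle n n' S) {1..n + n'} {1..n + n'}" by simp
  then show ?thesis
    by (rule bij_imp_permutes) (auto simp: unshuffle_def)
qed

text \<open>\<open>shuffle_perms\<close> states monotonicity on a set of positions, that is, on a
  preimage. Passing to the inverse turns it into monotonicity on the letters, which form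
  intervals.\<close>

lemma inv_strict_mono_on:
  assumes "\<sigma> permutes (X :: nat set)" "strict_mono_on {p \<in> X. \<sigma> p \<in> Y} \<sigma>" "Y \<subseteq> X"
  shows "strict_mono_on Y (inv_into UNIV \<sigma>)"
proof (rule strict_mono_onI, rule ccontr)
  fix k l assume kl: "k \<in> Y" "l \<in> Y" "k < l" "\<not> inv_into UNIV \<sigma> k < inv_into UNIV \<sigma> l"
  let ?i = "inv_into UNIV \<sigma>"
  have in_X: "?i k \<in> X" "?i l \<in> X"
    using kl assms permutes_in_image[OF permutes_inv[OF assms(1)]] by auto
  have eq: "\<sigma> (?i k) = k" "\<sigma> (?i l) = l" using permutes_inverses[OF assms(1)] by auto
  have "?i k \<noteq> ?i l" using arg_cong[of "?i k" "?i l" \<sigma>] eq kl(3) by auto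
  with kl have "?i l < ?i k" by simp
  then have "\<sigma> (?i l) < \<sigma> (?i k)"
    using in_X eq kl by (intro strict_mono_onD[OF assms(2)]) auto
  with eq kl show False by simp
qed

text \<open>A shuffle is determined by the positions of the letters \<open>1\<close> to
  \<open>n\<close>, which form the image of \<open>{1..n}\<close> under its inverse: monotonicity
  forces the inverse to enumerate this set and its complement increasingly.\<close>

lemma unshuffle_bij_shuffle_perms:
  "bij_betw (\<lambda>S. inv_into UNIV (unshuffle n n' S)) (splittings n n') (shuffle_perms n n')"
proof (rule bij_betw_byWitness[where f' = "\<lambda>\<sigma>. inv_into UNIV \<sigma> ` {1..n}"])
  have image: "unshuffle n n' S ` {1..n} = S" if "S \<in> splittings n n'" for S
    using nth_of_image[of S] splittings_complement[OF that] by (auto simp: unshuffle_def)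
  then show "\<forall>S\<in>splittings n n'. inv_into UNIV (inv_into UNIV (unshuffle n n' S)) ` {1..n} = S"
    by (metis permutes_inv_inv unshuffle_permutes)
  show "(\<lambda>S. inv_into UNIV (unshuffle n n' S)) ` splittings n n' \<subseteq> shuffle_perms n n'"
  proof clarify
    fix S assume S: "S \<in> splittings n n'"
    let ?u = "unshuffle n n' S" and ?T = "{1..n + n'} - S"
    note fin = splittings_complement[OF S]
    have perm: "?u permutes {1..n + n'}" using S by (rule unshuffle_permutes)
    have mono: "strict_mono_on {1..n} ?u"
      using strict_mono_on_nth_of[OF fin(1)] fin(2)
      by (auto simp: unshuffle_def strict_mono_on_def)
    have mono': "strict_mono_on {n + 1..n + n'} ?u"
    proof (rule strict_mono_onI)
      fix k l assume "k \<in> {n + 1..n + n'}" "l \<in> {n + 1..n + n'}" "k < l"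
      then show "?u k < ?u l"
        using strict_mono_onD[OF strict_mono_on_nth_of[of ?T], of "k - n" "l - n"] fin(3)
        by (auto simp: unshuffle_def)
    qed
    \<comment> \<open>Here \<open>Y\<close> is one of the two intervals of letters.
      \<open>?u\<close> sends it onto the positions at which the word of the shuffle has a letter
      from \<open>Y\<close>.\<close>
    have aux: "strict_mono_on {p \<in> {1..n + n'}. inv_into UNIV ?u p \<in> Y} (inv_into UNIV ?u)"
      if "strict_mono_on Y ?u" "Y \<subseteq> {1..n + n'}" for Y
    proof -
      have "{p \<in> {1..n + n'}. inv_into UNIV ?u p \<in> Y} = ?u ` Y"
      proof (intro equalityI subsetI)
        fix p assume "p \<in> {p \<in> {1..n + n'}. inv_into UNIV ?u p \<in> Y}"
        then have "?u (inv_into UNIV ?u p) \<in> ?u ` Y" by blast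
        then show "p \<in> ?u ` Y" by (simp add: permutes_inverses[OF perm])
      next
        fix p assume "p \<in> ?u ` Y"
        then obtain q where "q \<in> Y" "p = ?u q" by blast
        then show "p \<in> {p \<in> {1..n + n'}. inv_into UNIV ?u p \<in> Y}"
          using that(2) permutes_in_image[OF perm, of q] by (auto simp: permutes_inverses[OF perm])
      qed
      moreover have "strict_mono_on (?u ` Y) (inv_into UNIV ?u)"
      proof (rule inv_strict_mono_on[OF perm])
        have "{p \<in> {1..n + n'}. ?u p \<in> ?u ` Y} = Y"
          using that(2) by (auto simp: inj_image_mem_iff[OF permutes_inj[OF perm]])
        then show "strict_mono_on {p \<in> {1..n + n'}. ?u p \<in> ?u ` Y} ?u" using that(1) by simp
        show "?u ` Y \<subseteq> {1..n + n'}" using image_mono[OF that(2), of ?u] permutes_image[OF perm] by simp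
      qed
      ultimately show ?thesis by simp
    qed
    show "inv_into UNIV ?u \<in> shuffle_perms n n'"
      unfolding shuffle_perms_def using aux[OF mono] aux[OF mono'] permutes_inv[OF perm] by auto
  qed
  have sub: "inv_into UNIV \<sigma> ` {1..n} \<in> splittings n n'" if "\<sigma> permutes {1..n + n'}" for \<sigma>
  proof -
    have "inv_into UNIV \<sigma> permutes {1..n + n'}" using that by (rule permutes_inv)
    from permutes_image[OF this] permutes_inj_on[OF this]
    have "inv_into UNIV \<sigma> ` {1..n} \<subseteq> {1..n + n'}" "card (inv_into UNIV \<sigma> ` {1..n}) = card {1..n}"
      using image_mono[of "{1..n}" "{1..n + n'}" "inv_into UNIV \<sigma>"] by (auto simp: card_image)
    then show ?thesis by (simp add: splittings_def)
  qed
  then show "(\<lambda>\<sigma>. inv_into UNIV \<sigma> ` {1..n}) ` shuffle_perms n n' \<subseteq> splittings n n'"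
    by (auto simp: shuffle_perms_def)
  show "\<forall>\<sigma>\<in>shuffle_perms n n'.
      inv_into UNIV (unshuffle n n' (inv_into UNIV \<sigma> ` {1..n})) = \<sigma>"
  proof
    fix \<sigma> assume \<sigma>: "\<sigma> \<in> shuffle_perms n n'"
    let ?i = "inv_into UNIV \<sigma>"
    have perm: "\<sigma> permutes {1..n + n'}" using \<sigma> by (simp add: shuffle_perms_def)
    have iperm: "?i permutes {1..n + n'}" using perm by (rule permutes_inv)
    have mono: "strict_mono_on {1..n} ?i" "strict_mono_on {n + 1..n + n'} ?i"
      using \<sigma> by (auto simp: shuffle_perms_def intro!: inv_strict_mono_on)
    have "{1..n + n'} - ?i ` {1..n} = ?i ` ({1..n + n'} - {1..n})"
      using permutes_image[OF iperm] permutes_inj[OF iperm] by (simp add: image_set_diff)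
    also have "{1..n + n'} - {1..n} = (\<lambda>k. k + n) ` {1..n'}"
    proof (intro equalityI subsetI)
      fix k assume "k \<in> {1..n + n'} - {1..n}"
      then have "k = (k - n) + n" "k - n \<in> {1..n'}" by auto
      then show "k \<in> (\<lambda>k. k + n) ` {1..n'}" by (rule image_eqI)
    qed auto
    finally have compl: "{1..n + n'} - ?i ` {1..n} = (\<lambda>k. ?i (k + n)) ` {1..n'}"
      by (simp only: image_image)
    \<comment> \<open>Together with \<open>compl\<close> this exhibits
      \<open>k \<mapsto> ?i (k + n)\<close> as the increasing enumeration of the complement.\<close>
    have mono': "strict_mono_on {1..n'} (\<lambda>k. ?i (k + n))"
      by (rule strict_mono_onI, rule strict_mono_onD[OF mono(2)]) auto
    have "unshuffle n n' (?i ` {1..n}) = ?i"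
    proof
      fix k
      consider "k \<in> {1..n}" | "k \<in> {n + 1..n + n'}" | "k \<notin> {1..n + n'}" by force
      then show "unshuffle n n' (?i ` {1..n}) k = ?i k"
      proof cases
        case 1
        then show ?thesis using nth_of_unique[OF mono(1) 1] by (simp add: unshuffle_def)
      next
        case 2
        then have "k - n \<in> {1..n'}" "k \<notin> {1..n}" "k - n + n = k" by auto
        then show ?thesis
          using nth_of_unique[OF mono', of "k - n"] 2 unfolding unshuffle_def compl by (simp only: if_True if_False)
      next
        case 3
        then have "k \<notin> {1..n}" "k \<notin> {n + 1..n + n'}" by auto
        then show ?thesis using permutes_not_in[OF iperm 3] by (simp only: unshuffle_def if_False)
      qed
    qed
    then show "inv_into UNIV (unshuffle n n' (?i ` {1..n})) = \<sigma>"
      by (simp only: permutes_inv_inv[OF perm])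
  qed
qed

section \<open>Diagrams as sets of atoms\<close>

text \<open>The parameter \<open>'v\<close> stands for vertices only, so the generated
  \<open>map_atom\<close> and \<open>set_atom\<close> are the relabelling and the vertex set of an
  atom, while positions of half-edges and the diagrams at the vertices stay fixed.\<close>

datatype 'v atom = Vertex 'v bdiagram | Edge 'v nat 'v nat

definition relabel :: "('v \<Rightarrow> 'w) \<Rightarrow> 'v atom set \<Rightarrow> 'w atom set" where
  "relabel f A = map_atom f ` A"

definition restrict_atoms :: "'v set \<Rightarrow> 'v atom set \<Rightarrow> 'v atom set" where
  "restrict_atoms T A = {x \<in> A. set_atom x \<subseteq> T}"

text \<open>The sets of atoms that arise from \<open>generated \<D>\<close>, with an arbitrary vertex set instead of \<open>{1..n}\<close>.\<close>

definition diagram_on :: "bdiagram set \<Rightarrow> nat set \<Rightarrow> nat atom set \<Rightarrow> bool" where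
  "diagram_on D S A \<longleftrightarrow>
     (\<forall>i V. Vertex i V \<in> A \<longrightarrow> i \<in> S \<and> V \<in> D) \<and>
     (\<forall>i \<in> S. \<exists>!V. Vertex i V \<in> A) \<and>
     (\<forall>i p j q. Edge i p j q \<in> A \<longrightarrow> i < j \<and>
        (\<exists>V. Vertex i V \<in> A \<and> p \<in> Fup V) \<and> (\<exists>W. Vertex j W \<in> A \<and> q \<in> Fdown W)) \<and>
     (\<forall>i p j q j' q'. Edge i p j q \<in> A \<longrightarrow> Edge i p j' q' \<in> A \<longrightarrow> j = j' \<and> q = q') \<and>
     (\<forall>i p j q i' p'. Edge i p j q \<in> A \<longrightarrow> Edge i' p' j q \<in> A \<longrightarrow> i = i' \<and> p = p')"

lemma diagram_onI:
  assumes "\<And>i V. Vertex i V \<in> A \<Longrightarrow> i \<in> S \<and> V \<in> D"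
    and "\<And>i. i \<in> S \<Longrightarrow> \<exists>V. Vertex i V \<in> A"
    and "\<And>i V W. Vertex i V \<in> A \<Longrightarrow> Vertex i W \<in> A \<Longrightarrow> V = W"
    and "\<And>i p j q. Edge i p j q \<in> A \<Longrightarrow> i < j"
    and "\<And>i p j q. Edge i p j q \<in> A \<Longrightarrow> \<exists>V. Vertex i V \<in> A \<and> p \<in> Fup V"
    and "\<And>i p j q. Edge i p j q \<in> A \<Longrightarrow> \<exists>W. Vertex j W \<in> A \<and> q \<in> Fdown W"
    and "\<And>i p j q j' q'. Edge i p j q \<in> A \<Longrightarrow> Edge i p j' q' \<in> A \<Longrightarrow> j = j' \<and> q = q'"
    and "\<And>i p j q i' p'. Edge i p j q \<in> A \<Longrightarrow> Edge i' p' j q \<in> A \<Longrightarrow> i = i' \<and> p = p'"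
  shows "diagram_on D S A"
  unfolding diagram_on_def
proof (intro conjI allI ballI impI)
  show "\<exists>!V. Vertex i V \<in> A" if "i \<in> S" for i
    using assms(2)[OF that] assms(3) by (auto intro!: ex_ex1I)
qed (use assms in auto)

lemma diagram_onD:
  assumes "diagram_on D S A"
  shows "Vertex i V \<in> A \<Longrightarrow> i \<in> S"
    and "Vertex i V \<in> A \<Longrightarrow> V \<in> D"
    and "i \<in> S \<Longrightarrow> \<exists>V. Vertex i V \<in> A"
    and "Vertex i V \<in> A \<Longrightarrow> Vertex i W \<in> A \<Longrightarrow> V = W"
    and "Edge i p j q \<in> A \<Longrightarrow> i < j"
    and "Edge i p j q \<in> A \<Longrightarrow> \<exists>V. Vertex i V \<in> A \<and> p \<in> Fup V"
    and "Edge i p j q \<in> A \<Longrightarrow> \<exists>W. Vertex j W \<in> A \<and> q \<in> Fdown W"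
    and "Edge i p j q \<in> A \<Longrightarrow> Edge i p j' q' \<in> A \<Longrightarrow> j = j' \<and> q = q'"
    and "Edge i p j q \<in> A \<Longrightarrow> Edge i' p' j q \<in> A \<Longrightarrow> i = i' \<and> p = p'"
proof -
  note d1 = assms[unfolded diagram_on_def, THEN conjunct1]
  note d2 = assms[unfolded diagram_on_def, THEN conjunct2, THEN conjunct1]
  note d3 = assms[unfolded diagram_on_def, THEN conjunct2, THEN conjunct2, THEN conjunct1]
  note d4 = assms[unfolded diagram_on_def, THEN conjunct2, THEN conjunct2, THEN conjunct2]
  show v: "i \<in> S" if "Vertex i V \<in> A" for i V using d1 that by blast
  show "V \<in> D" if "Vertex i V \<in> A" using d1 that by blast
  show "V = W" if "Vertex i V \<in> A" "Vertex i W \<in> A" using d2 v[OF that(1)] that by blast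
  show "\<exists>V. Vertex i V \<in> A" if "i \<in> S" using d2 that by blast
  show "i < j" if "Edge i p j q \<in> A" using d3 that by blast
  show "\<exists>V. Vertex i V \<in> A \<and> p \<in> Fup V" if "Edge i p j q \<in> A" using d3 that by blast
  show "\<exists>W. Vertex j W \<in> A \<and> q \<in> Fdown W" if "Edge i p j q \<in> A" using d3 that by blast
  show "j = j' \<and> q = q'" if "Edge i p j q \<in> A" "Edge i p j' q' \<in> A" using d4 that by blast
  show "i = i' \<and> p = p'" if "Edge i p j q \<in> A" "Edge i' p' j q \<in> A" using d4 that by blast
qed

lemma set_atom_nonempty: "set_atom x \<noteq> {}"
  by (cases x) auto

lemma diagram_on_support:
  assumes "diagram_on D S A" "x \<in> A"
  shows "set_atom x \<subseteq> S"
  using assms by (cases x) (auto dest: diagram_onD)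

lemma Vertex_relabel: "Vertex i V \<in> relabel f A \<longleftrightarrow> (\<exists>k. i = f k \<and> Vertex k V \<in> A)"
proof
  assume "Vertex i V \<in> relabel f A"
  then obtain x where "x \<in> A" "map_atom f x = Vertex i V" by (auto simp: relabel_def)
  then show "\<exists>k. i = f k \<and> Vertex k V \<in> A" by (cases x) auto
qed (force simp: relabel_def)

lemma Edge_relabel:
  "Edge i p j q \<in> relabel f A \<longleftrightarrow> (\<exists>k l. i = f k \<and> j = f l \<and> Edge k p l q \<in> A)"
proof
  assume "Edge i p j q \<in> relabel f A"
  then obtain x where "x \<in> A" "map_atom f x = Edge i p j q" by (auto simp: relabel_def)
  then show "\<exists>k l. i = f k \<and> j = f l \<and> Edge k p l q \<in> A" by (cases x) auto
qed (force simp: relabel_def)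

lemma relabel_relabel: "relabel g (relabel f A) = relabel (g \<circ> f) A"
  by (simp add: relabel_def image_image atom.map_comp)

lemma relabel_Un: "relabel f (A \<union> B) = relabel f A \<union> relabel f B"
  by (simp add: relabel_def image_Un)

lemma relabel_UN: "relabel f (\<Union>i\<in>I. A i) = (\<Union>i\<in>I. relabel f (A i))"
  by (simp add: relabel_def image_UN)

lemma relabel_cong:
  assumes "\<And>x. x \<in> A \<Longrightarrow> set_atom x \<subseteq> S" "\<And>k. k \<in> S \<Longrightarrow> f k = g k"
  shows "relabel f A = relabel g A"
  unfolding relabel_def
  by (intro image_cong refl atom.map_cong0) (use assms in auto)

lemma relabel_ident:
  assumes "\<And>x. x \<in> A \<Longrightarrow> set_atom x \<subseteq> S" "\<And>k. k \<in> S \<Longrightarrow> f k = k"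
  shows "relabel f A = A"
proof -
  have "relabel f A = relabel (\<lambda>k. k) A" using assms by (rule relabel_cong)
  then show ?thesis by (simp add: relabel_def atom.map_ident)
qed

text \<open>Injectivity keeps vertices and half-edges apart; monotonicity is what keeps every edge
  directed from a smaller to a larger vertex.\<close>

lemma diagram_on_relabel:
  assumes d: "diagram_on D S A" and mono: "strict_mono_on S f"
  shows "diagram_on D (f ` S) (relabel f A)"
proof -
  have inj: "k = l" if "f k = f l" "k \<in> S" "l \<in> S" for k l
    using strict_mono_on_imp_inj_on[OF mono] that by (auto dest: inj_onD)
  have e: "k \<in> S" "l \<in> S" if "Edge k p l q \<in> A" for k p l q
    using diagram_on_support[OF d that] by auto
  note v = diagram_onD(1)[OF d]
  show ?thesis
  proof (rule diagram_onI)
    show "\<exists>V. Vertex i V \<in> relabel f A" if "i \<in> f ` S" for i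
    proof -
      from that obtain k where "k \<in> S" "i = f k" by blast
      then show ?thesis using diagram_onD(3)[OF d, of k] unfolding Vertex_relabel by blast
    qed
    show "i < j" if "Edge i p j q \<in> relabel f A" for i p j q
    proof -
      from that obtain k l where "i = f k" "j = f l" "Edge k p l q \<in> A" unfolding Edge_relabel by blast
      then show ?thesis
        using e[of k p l q] diagram_onD(5)[OF d, of k p l q] strict_mono_onD[OF mono, of k l] by blast
    qed
    show "V = W" if "Vertex i V \<in> relabel f A" "Vertex i W \<in> relabel f A" for i V W
    proof -
      from that obtain k l where "i = f k" "i = f l" "Vertex k V \<in> A" "Vertex l W \<in> A"
        unfolding Vertex_relabel by blast
      then show ?thesis using inj[of k l] v[of k V] v[of l W] diagram_onD(4)[OF d, of k V W] by simp
    qed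
    show "j = j' \<and> q = q'" if "Edge i p j q \<in> relabel f A" "Edge i p j' q' \<in> relabel f A"
      for i p j q j' q'
    proof -
      from that obtain k l k' l' where kl: "i = f k" "i = f k'" "j = f l" "j' = f l'"
        "Edge k p l q \<in> A" "Edge k' p l' q' \<in> A" unfolding Edge_relabel by blast
      then have "k = k'" using inj[of k k'] e by simp
      then show ?thesis using kl diagram_onD(8)[OF d, of k p l q l' q'] by simp
    qed
    show "i = i' \<and> p = p'" if "Edge i p j q \<in> relabel f A" "Edge i' p' j q \<in> relabel f A"
      for i p j q i' p'
    proof -
      from that obtain k l k' l' where kl: "i = f k" "i' = f k'" "j = f l" "j = f l'"
        "Edge k p l q \<in> A" "Edge k' p' l' q \<in> A" unfolding Edge_relabel by blast
      then have "l = l'" using inj[of l l'] e by simp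
      then show ?thesis using kl diagram_onD(9)[OF d, of k p l q k' p'] by simp
    qed
    show "i \<in> f ` S \<and> V \<in> D" if "Vertex i V \<in> relabel f A" for i V
      using that diagram_onD(1,2)[OF d] unfolding Vertex_relabel by blast
    show "\<exists>V. Vertex i V \<in> relabel f A \<and> p \<in> Fup V"
      "\<exists>V. Vertex j V \<in> relabel f A \<and> q \<in> Fdown V" if "Edge i p j q \<in> relabel f A" for i p j q
    proof -
      from that obtain k l where "i = f k" "j = f l" "Edge k p l q \<in> A" unfolding Edge_relabel by blast
      then show "\<exists>V. Vertex i V \<in> relabel f A \<and> p \<in> Fup V"
        "\<exists>V. Vertex j V \<in> relabel f A \<and> q \<in> Fdown V"
        using diagram_onD(6,7)[OF d, of k p l q] unfolding Vertex_relabel by blast+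
    qed
  qed
qed

text \<open>By \<open>disj\<close> two atoms with a common vertex come from the same index, so each
  uniqueness condition concerns only one of the parts.\<close>

lemma diagram_on_UN:
  assumes d: "\<And>k. k \<in> K \<Longrightarrow> diagram_on D (S k) (A k)"
    and disj: "\<And>k l. k \<in> K \<Longrightarrow> l \<in> K \<Longrightarrow> S k \<inter> S l \<noteq> {} \<Longrightarrow> k = l"
  shows "diagram_on D (\<Union>k\<in>K. S k) (\<Union>k\<in>K. A k)"
proof -
  have same: "k = l" if "k \<in> K" "l \<in> K" "x \<in> A k" "y \<in> A l" "set_atom x \<inter> set_atom y \<noteq> {}" for k l x y
    using disj[OF that(1,2)] diagram_on_support[OF d[OF that(1)] that(3)]
      diagram_on_support[OF d[OF that(2)] that(4)] that(5) by blast
  show ?thesis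
  proof (rule diagram_onI)
    show "V = W" if "Vertex i V \<in> (\<Union>k\<in>K. A k)" "Vertex i W \<in> (\<Union>k\<in>K. A k)" for i V W
    proof -
      from that obtain k l where kl: "k \<in> K" "Vertex i V \<in> A k" "l \<in> K" "Vertex i W \<in> A l" by blast
      then have "k = l" by (intro same) auto
      then show ?thesis using kl diagram_onD(4)[OF d, of k i V W] by blast
    qed
    show "j = j' \<and> q = q'" if e: "Edge i p j q \<in> (\<Union>k\<in>K. A k)" "Edge i p j' q' \<in> (\<Union>k\<in>K. A k)"
      for i p j q j' q'
    proof -
      from e obtain k l where kl: "k \<in> K" "Edge i p j q \<in> A k" "l \<in> K" "Edge i p j' q' \<in> A l" by blast
      then have "k = l" by (intro same) auto
      then show ?thesis using kl diagram_onD(8)[OF d, of k i p j q j' q'] by blast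
    qed
    show "i = i' \<and> p = p'" if e: "Edge i p j q \<in> (\<Union>k\<in>K. A k)" "Edge i' p' j q \<in> (\<Union>k\<in>K. A k)"
      for i p j q i' p'
    proof -
      from e obtain k l where kl: "k \<in> K" "Edge i p j q \<in> A k" "l \<in> K" "Edge i' p' j q \<in> A l" by blast
      then have "k = l" by (intro same) auto
      then show ?thesis using kl diagram_onD(9)[OF d, of k i p j q i' p'] by blast
    qed
    show "i \<in> (\<Union>k\<in>K. S k) \<and> V \<in> D" if "Vertex i V \<in> (\<Union>k\<in>K. A k)" for i V
      using that diagram_onD(1,2)[OF d] by blast
    show "\<exists>V. Vertex i V \<in> (\<Union>k\<in>K. A k)" if "i \<in> (\<Union>k\<in>K. S k)" for i
      using that diagram_onD(3)[OF d] by blast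
    show "i < j" "\<exists>V. Vertex i V \<in> (\<Union>k\<in>K. A k) \<and> p \<in> Fup V"
      "\<exists>V. Vertex j V \<in> (\<Union>k\<in>K. A k) \<and> q \<in> Fdown V"
      if "Edge i p j q \<in> (\<Union>k\<in>K. A k)" for i p j q
    proof -
      from that obtain k where "k \<in> K" "Edge i p j q \<in> A k" by blast
      then show "i < j" "\<exists>V. Vertex i V \<in> (\<Union>k\<in>K. A k) \<and> p \<in> Fup V"
        "\<exists>V. Vertex j V \<in> (\<Union>k\<in>K. A k) \<and> q \<in> Fdown V"
        using diagram_onD(5-7)[OF d, of k i p j q] by blast+
    qed
  qed
qed

lemma diagram_on_restrict_atoms:
  assumes d: "diagram_on D S A" and "T \<subseteq> S"
  shows "diagram_on D T (restrict_atoms T A)"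
proof (rule diagram_onI)
  show "\<exists>V. Vertex i V \<in> restrict_atoms T A" if "i \<in> T" for i
    using that assms(2) diagram_onD(3)[OF d, of i] by (auto simp: restrict_atoms_def)
  show "i \<in> T \<and> V \<in> D" if "Vertex i V \<in> restrict_atoms T A" for i V
    using that diagram_onD(2)[OF d] by (auto simp: restrict_atoms_def)
  show "V = W" if "Vertex i V \<in> restrict_atoms T A" "Vertex i W \<in> restrict_atoms T A" for i V W
    using that diagram_onD(4)[OF d, of i V W] by (simp add: restrict_atoms_def)
  show "i < j" if "Edge i p j q \<in> restrict_atoms T A" for i p j q
    using that diagram_onD(5)[OF d, of i p j q] by (simp add: restrict_atoms_def)
  show "\<exists>V. Vertex i V \<in> restrict_atoms T A \<and> p \<in> Fup V"
    if "Edge i p j q \<in> restrict_atoms T A" for i p j q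
    using that diagram_onD(6)[OF d, of i p j q] by (simp add: restrict_atoms_def)
  show "\<exists>V. Vertex j V \<in> restrict_atoms T A \<and> q \<in> Fdown V"
    if "Edge i p j q \<in> restrict_atoms T A" for i p j q
    using that diagram_onD(7)[OF d, of i p j q] by (simp add: restrict_atoms_def)
  show "j = j' \<and> q = q'" if "Edge i p j q \<in> restrict_atoms T A" "Edge i p j' q' \<in> restrict_atoms T A"
    for i p j q j' q'
    using that diagram_onD(8)[OF d, of i p j q j' q'] by (simp add: restrict_atoms_def)
  show "i = i' \<and> p = p'" if "Edge i p j q \<in> restrict_atoms T A" "Edge i' p' j q \<in> restrict_atoms T A"
    for i p j q i' p'
    using that diagram_onD(9)[OF d, of i p j q i' p'] by (simp add: restrict_atoms_def)
qed

section \<open>Connectivity of sets of atoms\<close>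

definition adj :: "'v atom set \<Rightarrow> ('v \<times> 'v) set" where
  "adj A = {(i, j). \<exists>p q. Edge i p j q \<in> A}"

definition link :: "'v atom set \<Rightarrow> ('v \<times> 'v) set" where
  "link A = (adj A \<union> (adj A)\<inverse>)\<^sup>*"

definition connected_on :: "'v set \<Rightarrow> 'v atom set \<Rightarrow> bool" where
  "connected_on S A \<longleftrightarrow> S \<noteq> {} \<and> (\<forall>u \<in> S. \<forall>v \<in> S. (u, v) \<in> link A)"

lemma link_refl: "(u, u) \<in> link A"
  by (simp add: link_def)

lemma link_sym: "(u, v) \<in> link A \<Longrightarrow> (v, u) \<in> link A"
  unfolding link_def by (rule symD[OF sym_rtrancl[OF sym_Un_converse]])

lemma link_trans: "(u, v) \<in> link A \<Longrightarrow> (v, w) \<in> link A \<Longrightarrow> (u, w) \<in> link A"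
  unfolding link_def by (rule rtrancl_trans)

lemma link_mono: "A \<subseteq> B \<Longrightarrow> link A \<subseteq> link B"
  unfolding link_def adj_def by (intro rtrancl_mono) blast

lemma Edge_link: "Edge i p j q \<in> A \<Longrightarrow> (i, j) \<in> link A"
  unfolding link_def adj_def by blast

lemma link_relabel:
  assumes "(u, v) \<in> link A"
  shows "(f u, f v) \<in> link (relabel f A)"
  using assms unfolding link_def
proof (induction rule: rtrancl_induct)
  case (step v w)
  have "(f v, f w) \<in> adj (relabel f A) \<union> (adj (relabel f A))\<inverse>"
    using step(2) by (auto simp: adj_def Edge_relabel)
  then show ?case using step.IH by (rule rtrancl.rtrancl_into_rtrancl[rotated])
qed simp

lemma connected_on_relabel: "connected_on S A \<Longrightarrow> connected_on (f ` S) (relabel f A)"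
  by (auto simp: connected_on_def link_relabel)

text \<open>These are the unions of connected components: no edge crosses the border of
  \<open>T\<close>.\<close>

definition closed_in :: "'v set \<Rightarrow> 'v atom set \<Rightarrow> bool" where
  "closed_in T A \<longleftrightarrow> (\<forall>x \<in> A. set_atom x \<inter> T \<noteq> {} \<longrightarrow> set_atom x \<subseteq> T)"

text \<open>A path that starts in \<open>T\<close> never finds an edge leading out, and each edge it
  takes survives the restriction. Linked vertices of a component thus remain linked when all other
  atoms are dropped.\<close>

lemma link_closed_in:
  assumes "closed_in T A" "(u, v) \<in> link A" "u \<in> T"
  shows "v \<in> T \<and> (u, v) \<in> link (restrict_atoms T A)"
  using assms(2) unfolding link_def
proof (induction rule: rtrancl_induct)
  case base
  then show ?case using assms(3) by simp
next
  case (step v w)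
  from step(2) obtain p q where "Edge v p w q \<in> A \<or> Edge w p v q \<in> A" by (auto simp: adj_def)
  then obtain x where x: "x \<in> A" "set_atom x = {v, w}" "x = Edge v p w q \<or> x = Edge w p v q" by fastforce
  then have "x \<in> restrict_atoms T A" "w \<in> T"
    using assms(1) step.IH by (auto simp: closed_in_def restrict_atoms_def)
  with x(3) have "(v, w) \<in> adj (restrict_atoms T A) \<union> (adj (restrict_atoms T A))\<inverse>"
    by (auto simp: adj_def)
  with step.IH \<open>w \<in> T\<close> show ?case by (meson rtrancl.rtrancl_into_rtrancl)
qed

lemma closed_in_link_class: "closed_in (link A `` {u}) A"
proof -
  have "set_atom x \<subseteq> link A `` {u}" if "x \<in> A" "set_atom x \<inter> link A `` {u} \<noteq> {}" for x
  proof (cases x)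
    case (Edge i p j q)
    then have "(i, j) \<in> link A" using that(1) by (auto intro: Edge_link)
    moreover have "(u, i) \<in> link A \<or> (u, j) \<in> link A" using that(2) Edge by auto
    ultimately have "(u, i) \<in> link A" "(u, j) \<in> link A" by (metis link_sym link_trans)+
    then show ?thesis using Edge by simp
  qed (use that in auto)
  then show ?thesis by (auto simp: closed_in_def)
qed

section \<open>Decomposition into connected components\<close>

text \<open>The colours are kept and the blocks are transported by \<open>f\<close>; this is the
  counterpart of \<open>relabel\<close> for coloured partitions.\<close>

definition recolour :: "(nat \<Rightarrow> nat) \<Rightarrow> cpartition \<Rightarrow> cpartition" where
  "recolour f Q = (\<lambda>(p, i). (f ` p, i)) ` Q"

text \<open>\<open>con m\<close> is an arbitrary numbering of the connected diagrams on
  \<open>{1..m}\<close> by colours. For \<open>m = 0\<close> there are none, because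
  \<open>connected_on\<close> asks for a vertex, and so \<open>c 0 = 0\<close>.\<close>

locale connected_colouring =
  fixes D :: "bdiagram set" and c :: "nat \<Rightarrow> nat" and con :: "nat \<Rightarrow> nat \<Rightarrow> nat atom set"
  assumes con_bij: "bij_betw (con m) {1..c m} {A. diagram_on D {1..m} A \<and> connected_on {1..m} A}"
begin

definition piece :: "nat set \<Rightarrow> nat \<Rightarrow> nat atom set" where
  "piece p i = relabel (nth_of p) (con (card p) i)"

definition fill :: "cpartition \<Rightarrow> nat atom set" where
  "fill Q = (\<Union>(p, i)\<in>Q. piece p i)"

definition coloured :: "nat set \<Rightarrow> cpartition \<Rightarrow> bool" where
  "coloured S Q \<longleftrightarrow> partition_on S (fst ` Q) \<and> inj_on fst Q \<and> (\<forall>(p, i) \<in> Q. i \<in> {1..c (card p)})"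

text \<open>The blocks are the classes of linked vertices. The colour is described by a relation
  instead of a choice: it exists by \<open>piece_surj\<close> and is unique by
  \<open>piece_inj\<close>.\<close>

definition unfill :: "nat set \<Rightarrow> nat atom set \<Rightarrow> cpartition" where
  "unfill S A = {(p, i). p \<in> (\<lambda>u. link A `` {u}) ` S \<and> i \<in> {1..c (card p)} \<and> piece p i = restrict_atoms p A}"

lemma con_diagram:
  assumes "i \<in> {1..c m}"
  shows "diagram_on D {1..m} (con m i)" "connected_on {1..m} (con m i)"
  using con_bij[of m] assms by (auto simp: bij_betw_def)

lemma piece_diagram:
  assumes "finite p" "i \<in> {1..c (card p)}"
  shows "diagram_on D p (piece p i)" "connected_on p (piece p i)"
  using diagram_on_relabel[OF con_diagram(1)[OF assms(2)] strict_mono_on_nth_of[OF assms(1)]]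
    connected_on_relabel[OF con_diagram(2)[OF assms(2)], of "nth_of p"]
  by (simp_all only: piece_def nth_of_image[OF assms(1)])

lemma piece_relabel:
  assumes "finite p" "i \<in> {1..c (card p)}" "strict_mono_on p f"
  shows "piece (f ` p) i = relabel f (piece p i)"
proof -
  have card: "card (f ` p) = card p"
    using strict_mono_on_imp_inj_on[OF assms(3)] by (rule card_image)
  have "relabel (nth_of (f ` p)) (con (card p) i) = relabel (f \<circ> nth_of p) (con (card p) i)"
    by (rule relabel_cong[OF diagram_on_support[OF con_diagram(1)[OF assms(2)]]])
      (simp_all add: nth_of_strict_mono_image[OF assms(1,3)])
  then show ?thesis by (simp add: piece_def card relabel_relabel)
qed

lemma piece_inj:
  assumes "finite p" "i \<in> {1..c (card p)}" "j \<in> {1..c (card p)}" "piece p i = piece p j"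
  shows "i = j"
proof -
  have "relabel (rank p) (piece p k) = con (card p) k" if "k \<in> {1..c (card p)}" for k
    unfolding piece_def relabel_relabel
    by (rule relabel_ident[OF diagram_on_support[OF con_diagram(1)[OF that]]])
      (simp_all add: rank_nth_of[OF assms(1)])
  with assms have "con (card p) i = con (card p) j" by metis
  then show ?thesis using con_bij[of "card p"] assms(2,3) by (auto simp: bij_betw_def dest: inj_onD)
qed

text \<open>Relabelling by \<open>rank\<close> produces a connected diagram on an initial interval,
  which has a colour by \<open>con_bij\<close>; \<open>nth_of\<close> undoes this
  relabelling.\<close>

lemma piece_surj:
  assumes "finite p" "diagram_on D p A" "connected_on p A"
  shows "\<exists>i \<in> {1..c (card p)}. piece p i = A"
proof -
  have "diagram_on D {1..card p} (relabel (rank p) A)" "connected_on {1..card p} (relabel (rank p) A)"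
    using diagram_on_relabel[OF assms(2) strict_mono_on_rank[OF assms(1)]]
      connected_on_relabel[OF assms(3), of "rank p"] by (simp_all only: rank_image[OF assms(1)])
  then have "relabel (rank p) A \<in> con (card p) ` {1..c (card p)}"
    using con_bij[of "card p"] by (simp add: bij_betw_def)
  then obtain i where i: "i \<in> {1..c (card p)}" "relabel (rank p) A = con (card p) i" by blast
  have "piece p i = A"
    unfolding piece_def i(2)[symmetric] relabel_relabel
    by (rule relabel_ident[OF diagram_on_support[OF assms(2)]]) (simp_all add: nth_of_rank[OF assms(1)])
  with i(1) show ?thesis by blast
qed

lemma colouredD:
  assumes "coloured S Q"
  shows "(p, i) \<in> Q \<Longrightarrow> p \<subseteq> S" "(p, i) \<in> Q \<Longrightarrow> p \<noteq> {}" "(p, i) \<in> Q \<Longrightarrow> i \<in> {1..c (card p)}"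
    "(p, i) \<in> Q \<Longrightarrow> (q, j) \<in> Q \<Longrightarrow> p \<inter> q \<noteq> {} \<Longrightarrow> p = q \<and> i = j"
    "(\<Union>(p, i)\<in>Q. p) = S"
proof -
  have part: "partition_on S (fst ` Q)" and inj: "inj_on fst Q"
    and col: "\<forall>(p, i) \<in> Q. i \<in> {1..c (card p)}"
    using assms by (auto simp: coloured_def)
  show un: "(\<Union>(p, i)\<in>Q. p) = S"
    using partition_onD1[OF part] by (auto simp: case_prod_unfold)
  show "p \<subseteq> S" if "(p, i) \<in> Q" using un that by blast
  show "p \<noteq> {}" if "(p, i) \<in> Q" using partition_onD3[OF part] that by force
  show "i \<in> {1..c (card p)}" if "(p, i) \<in> Q" using col that by blast
  show "p = q \<and> i = j" if "(p, i) \<in> Q" "(q, j) \<in> Q" "p \<inter> q \<noteq> {}"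
  proof -
    have "p \<in> fst ` Q" "q \<in> fst ` Q" using that by force+
    with that(3) have "p = q" using disjointD[OF partition_onD2[OF part]] by blast
    then show ?thesis using inj_onD[OF inj _ that(1,2)] by simp
  qed
qed

lemma coloured_piece:
  assumes "finite S" "coloured S Q" "(p, i) \<in> Q"
  shows "diagram_on D p (piece p i)" "connected_on p (piece p i)"
  using piece_diagram[OF finite_subset[OF colouredD(1)[OF assms(2,3)] assms(1)] colouredD(3)[OF assms(2,3)]]
  by simp_all

lemma diagram_on_fill:
  assumes "finite S" "coloured S Q"
  shows "diagram_on D S (fill Q)"
proof -
  have "diagram_on D (\<Union>x\<in>Q. fst x) (\<Union>x\<in>Q. piece (fst x) (snd x))"
  proof (rule diagram_on_UN)
    show "diagram_on D (fst x) (piece (fst x) (snd x))" if "x \<in> Q" for x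
      using coloured_piece(1)[OF assms, of "fst x" "snd x"] that by simp
    show "x = y" if "x \<in> Q" "y \<in> Q" "fst x \<inter> fst y \<noteq> {}" for x y
      using colouredD(4)[OF assms(2), of "fst x" "snd x" "fst y" "snd y"] that by (simp add: prod_eq_iff)
  qed
  then show ?thesis using colouredD(5)[OF assms(2)] by (simp add: fill_def case_prod_unfold)
qed

text \<open>The atoms of a piece have all their vertices in its block, and blocks are disjoint. An
  atom that touches \<open>p\<close> can therefore only come from the piece of \<open>p\<close>;
  since every atom has a vertex, this covers all atoms inside \<open>p\<close>.\<close>

lemma fill_piece:
  assumes "finite S" "coloured S Q" "(p, i) \<in> Q"
  shows "restrict_atoms p (fill Q) = piece p i" "closed_in p (fill Q)"
proof -
  have eq: "x \<in> piece p i" if "x \<in> fill Q" "set_atom x \<inter> p \<noteq> {}" for x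
  proof -
    from that(1) obtain q j where q: "(q, j) \<in> Q" "x \<in> piece q j" by (auto simp: fill_def)
    then have "set_atom x \<subseteq> q" using diagram_on_support[OF coloured_piece(1)[OF assms(1,2)]] by simp
    with that(2) have "p \<inter> q \<noteq> {}" by blast
    then show ?thesis using colouredD(4)[OF assms(2,3) q(1)] q(2) by simp
  qed
  have sub: "set_atom x \<subseteq> p" if "x \<in> piece p i" for x
    using diagram_on_support[OF coloured_piece(1)[OF assms] that] .
  show "closed_in p (fill Q)" unfolding closed_in_def using eq sub by blast
  have "piece p i \<subseteq> fill Q" using assms(3) by (auto simp: fill_def)
  then show "restrict_atoms p (fill Q) = piece p i"
  proof -
    have "x \<in> restrict_atoms p (fill Q) \<longleftrightarrow> x \<in> piece p i" for x
      using eq[of x] sub[of x] set_atom_nonempty[of x] \<open>piece p i \<subseteq> fill Q\<close>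
      unfolding restrict_atoms_def by blast
    then show ?thesis by blast
  qed
qed

text \<open>No atom leads out of a block, and the piece inside it is connected. The blocks, and with
  \<open>fill_piece\<close> also the colours, can thus be read off the atoms.\<close>

lemma fill_link_class:
  assumes "finite S" "coloured S Q" "(p, i) \<in> Q" "u \<in> p"
  shows "link (fill Q) `` {u} = p"
proof
  show "link (fill Q) `` {u} \<subseteq> p"
    using link_closed_in[OF fill_piece(2)[OF assms(1-3)] _ assms(4)] by blast
  have "piece p i \<subseteq> fill Q" using assms(3) by (auto simp: fill_def)
  then show "p \<subseteq> link (fill Q) `` {u}"
    using coloured_piece(2)[OF assms(1-3)] assms(4) link_mono[of "piece p i" "fill Q"]
    unfolding connected_on_def by blast
qed

lemma unfill_fill:
  assumes "finite S" "coloured S Q"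
  shows "unfill S (fill Q) = Q"
proof -
  have classes: "(\<lambda>u. link (fill Q) `` {u}) ` S = fst ` Q"
  proof (intro equalityI subsetI)
    fix p assume "p \<in> (\<lambda>u. link (fill Q) `` {u}) ` S"
    then obtain u where u: "u \<in> S" "p = link (fill Q) `` {u}" by blast
    then obtain q i where "(q, i) \<in> Q" "u \<in> q" using colouredD(5)[OF assms(2)] by blast
    then show "p \<in> fst ` Q" using fill_link_class[OF assms, of q i u] u by force
  next
    fix p assume "p \<in> fst ` Q"
    then obtain i where i: "(p, i) \<in> Q" by auto
    then obtain u where "u \<in> p" using colouredD(2)[OF assms(2)] by blast
    then show "p \<in> (\<lambda>u. link (fill Q) `` {u}) ` S"
      using fill_link_class[OF assms i] colouredD(1)[OF assms(2) i] by blast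
  qed
  have "(p, i) \<in> unfill S (fill Q) \<longleftrightarrow> (p, i) \<in> Q" for p i
  proof
    assume "(p, i) \<in> unfill S (fill Q)"
    then have pi: "p \<in> fst ` Q" "i \<in> {1..c (card p)}" "piece p i = restrict_atoms p (fill Q)"
      unfolding unfill_def classes by auto
    then obtain j where j: "(p, j) \<in> Q" by auto
    have "finite p" using colouredD(1)[OF assms(2) j] assms(1) by (rule finite_subset)
    moreover have "piece p i = piece p j" using pi(3) fill_piece(1)[OF assms j] by simp
    ultimately have "i = j" using piece_inj[OF _ pi(2) colouredD(3)[OF assms(2) j]] by simp
    with j show "(p, i) \<in> Q" by simp
  next
    assume i: "(p, i) \<in> Q"
    then have "p \<in> fst ` Q" by force
    then show "(p, i) \<in> unfill S (fill Q)"
      unfolding unfill_def classes using fill_piece(1)[OF assms i] colouredD(3)[OF assms(2) i] by simp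
  qed
  then show ?thesis by auto
qed

lemma link_subset:
  assumes "diagram_on D S A" "(u, v) \<in> link A" "u \<in> S"
  shows "v \<in> S"
proof -
  have "closed_in S A" using diagram_on_support[OF assms(1)] by (simp add: closed_in_def)
  then show ?thesis using link_closed_in[OF _ assms(2,3)] by simp
qed

text \<open>Classes that share a vertex coincide, so they partition \<open>S\<close>. The
  restriction of \<open>A\<close> to a class is connected because the class is closed, hence it is a
  piece. Nothing of \<open>A\<close> is lost, as an atom cannot meet two classes.\<close>

lemma fill_unfill:
  assumes "finite S" "diagram_on D S A"
  shows "coloured S (unfill S A)" "fill (unfill S A) = A"
proof -
  let ?C = "(\<lambda>u. link A `` {u}) ` S"
  have sub: "p \<subseteq> S" if "p \<in> ?C" for p
    using that link_subset[OF assms(2)] by auto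
  have same: "p = link A `` {v}" if "p \<in> ?C" "v \<in> p" for p v
  proof -
    from that obtain u where u: "p = link A `` {u}" "(u, v) \<in> link A" by blast
    have "(u, w) \<in> link A \<longleftrightarrow> (v, w) \<in> link A" for w
      using u(2) link_sym[of u v A] link_trans[of u v A w] link_trans[of v u A w] by blast
    then show ?thesis by (auto simp: u(1))
  qed
  have ex: "\<exists>i \<in> {1..c (card p)}. piece p i = restrict_atoms p A" if "p \<in> ?C" for p
  proof (rule piece_surj)
    show "finite p" using sub[OF that] assms(1) by (rule finite_subset)
    show "diagram_on D p (restrict_atoms p A)"
      using assms(2) sub[OF that] by (rule diagram_on_restrict_atoms)
    have "(u, v) \<in> link (restrict_atoms p A)" if uv: "u \<in> p" "v \<in> p" for u v
    proof -
      have p: "p = link A `` {u}" by (rule same) fact+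
      then have "(u, v) \<in> link A" using uv by blast
      then show ?thesis using link_closed_in[of p A u v] closed_in_link_class[of A u] uv p by simp
    qed
    moreover have "p \<noteq> {}" using that link_refl[of _ A] by blast
    ultimately show "connected_on p (restrict_atoms p A)" by (simp add: connected_on_def)
  qed
  have classes: "fst ` unfill S A = ?C"
  proof (intro equalityI subsetI)
    fix p assume "p \<in> fst ` unfill S A" then show "p \<in> ?C" by (auto simp: unfill_def)
  next
    fix p assume p: "p \<in> ?C"
    then obtain i where "i \<in> {1..c (card p)}" "piece p i = restrict_atoms p A" using ex by blast
    with p have "(p, i) \<in> unfill S A" by (simp add: unfill_def)
    then show "p \<in> fst ` unfill S A" by force
  qed
  show "coloured S (unfill S A)"
    unfolding coloured_def
  proof (intro conjI)
    show "partition_on S (fst ` unfill S A)"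
      unfolding classes
    proof (rule partition_onI)
      show "\<Union>?C = S" using sub link_refl[of _ A] by blast
      show "disjnt p q" if "p \<in> ?C" "q \<in> ?C" "p \<noteq> q" for p q
      proof -
        have False if "v \<in> p" "v \<in> q" for v
          using same[OF \<open>p \<in> ?C\<close> that(1)] same[OF \<open>q \<in> ?C\<close> that(2)] \<open>p \<noteq> q\<close> by simp
        then show ?thesis unfolding disjnt_iff by blast
      qed
      show "{} \<notin> ?C" using link_refl[of _ A] by blast
    qed
    show "inj_on fst (unfill S A)"
    proof (rule inj_onI)
      fix x y assume xy: "x \<in> unfill S A" "y \<in> unfill S A" "fst x = fst y"
      then have "fst x \<in> ?C" by (auto simp: unfill_def)
      then have "finite (fst x)" using sub assms(1) by (blast intro: finite_subset)
      then have "snd x = snd y" using xy by (intro piece_inj[of "fst x"]) (auto simp: unfill_def)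
      with xy(3) show "x = y" by (simp add: prod_eq_iff)
    qed
    show "\<forall>(p, i) \<in> unfill S A. i \<in> {1..c (card p)}" by (auto simp: unfill_def)
  qed
  show "fill (unfill S A) = A"
  proof (intro equalityI subsetI)
    fix x assume "x \<in> fill (unfill S A)"
    then show "x \<in> A" by (auto simp: fill_def unfill_def restrict_atoms_def)
  next
    fix x assume x: "x \<in> A"
    \<comment> \<open>Any vertex of the atom will do: the class of one of them contains all of
      them.\<close>
    obtain u where u: "u \<in> set_atom x" using set_atom_nonempty[of x] by blast
    let ?p = "link A `` {u}"
    have p: "?p \<in> ?C" using u diagram_on_support[OF assms(2) x] by blast
    have "set_atom x \<subseteq> ?p" using closed_in_link_class[of A u] x u link_refl[of u A]
      unfolding closed_in_def by blast
    then have "x \<in> restrict_atoms ?p A" using x by (simp add: restrict_atoms_def)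
    moreover obtain i where "(?p, i) \<in> unfill S A" using p unfolding classes[symmetric] by auto
    moreover have "piece ?p i = restrict_atoms ?p A"
      using \<open>(?p, i) \<in> unfill S A\<close> by (simp add: unfill_def)
    ultimately show "x \<in> fill (unfill S A)"
      unfolding fill_def by blast
  qed
qed

section \<open>Relabellings and unions of coloured partitions\<close>

lemma fill_recolour:
  assumes "finite S" "coloured S Q" "strict_mono_on S f"
  shows "fill (recolour f Q) = relabel f (fill Q)"
proof -
  have "piece (f ` p) i = relabel f (piece p i)" if "(p, i) \<in> Q" for p i
    using colouredD(1,3)[OF assms(2) that] assms(1,3)
    by (intro piece_relabel) (auto intro: finite_subset monotone_on_subset)
  then have "(\<Union>x\<in>Q. piece (f ` fst x) (snd x)) = (\<Union>x\<in>Q. relabel f (piece (fst x) (snd x)))"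
    by (intro SUP_cong) auto
  then show ?thesis by (simp add: fill_def recolour_def case_prod_unfold relabel_UN)
qed

lemma fill_Un: "fill (P \<union> Q) = fill P \<union> fill Q"
  by (simp add: fill_def)

lemma coloured_recolour:
  assumes "coloured S Q" "inj_on f S"
  shows "coloured (f ` S) (recolour f Q)"
proof -
  have fst: "fst ` recolour f Q = (`) f ` fst ` Q"
    by (simp add: recolour_def image_image case_prod_unfold)
  have inj: "inj_on f p" "card (f ` p) = card p" if "(p, i) \<in> Q" for p i
    using assms(2) colouredD(1)[OF assms(1) that] by (auto intro: inj_on_subset card_image)
  show ?thesis
    unfolding coloured_def
  proof (intro conjI)
    have part: "partition_on S (fst ` Q)" using assms(1) by (simp add: coloured_def)
    have "{} \<notin> (`) f ` fst ` Q" using partition_onD3[OF part] by auto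
    then show "partition_on (f ` S) (fst ` recolour f Q)"
      using partition_on_inj_image[OF part assms(2)] by (simp add: fst)
    show "inj_on fst (recolour f Q)"
    proof (rule inj_onI)
      fix x y assume "x \<in> recolour f Q" "y \<in> recolour f Q" "fst x = fst y"
      then obtain p i q j where pq: "(p, i) \<in> Q" "(q, j) \<in> Q" "x = (f ` p, i)" "y = (f ` q, j)" "f ` p = f ` q"
        by (auto simp: recolour_def)
      have "p = q" 
        using inj_on_image_eq_iff[OF assms(2) colouredD(1)[OF assms(1) pq(1)] colouredD(1)[OF assms(1) pq(2)]]
          pq(5) by simp
      then have "i = j" using colouredD(2)[OF assms(1) pq(1)] colouredD(4)[OF assms(1) pq(1,2)] by simp
      with \<open>p = q\<close> pq show "x = y" by simp
    qed
    show "\<forall>(p, i)\<in>recolour f Q. i \<in> {1..c (card p)}"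
      using colouredD(3)[OF assms(1)] inj by (auto simp: recolour_def)
  qed
qed

lemma coloured_Un:
  assumes "coloured S P" "coloured T Q" "S \<inter> T = {}"
  shows "coloured (S \<union> T) (P \<union> Q)" "P \<inter> Q = {}"
proof -
  \<comment> \<open>A block occurring in both would be a nonempty subset of both \<open>S\<close>
    and \<open>T\<close>.\<close>
  have no: False if "(p, i) \<in> P" "(p, j) \<in> Q" for p i j
    using colouredD(1,2)[OF assms(1) that(1)] colouredD(1)[OF assms(2) that(2)] assms(3) by blast
  then show "P \<inter> Q = {}" by auto
  have "partition_on (S \<union> T) (fst ` P \<union> fst ` Q)"
    using assms disjoint_union[of "fst ` P" "fst ` Q"] unfolding coloured_def partition_on_def by auto
  moreover have "inj_on fst (P \<union> Q)"
  proof (rule inj_onI)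
    fix x y assume "x \<in> P \<union> Q" "y \<in> P \<union> Q" "fst x = fst y"
    moreover have "inj_on fst P" "inj_on fst Q" using assms(1,2) by (simp_all add: coloured_def)
    ultimately show "x = y"
      using no[of "fst x" "snd x" "snd y"] no[of "fst x" "snd y" "snd x"]
        inj_onD[of fst P x y] inj_onD[of fst Q x y] by (cases x; cases y) auto
  qed
  ultimately show "coloured (S \<union> T) (P \<union> Q)"
    using assms(1,2) unfolding coloured_def by (auto simp: image_Un)
qed

end

section \<open>The product of coloured set partitions\<close>

lemma recolour_recolour: "recolour g (recolour f Q) = recolour (g \<circ> f) Q"
  by (simp add: recolour_def image_image case_prod_unfold image_comp)

lemma recolour_ident:
  assumes "\<And>k. k \<in> \<Union>(fst ` Q) \<Longrightarrow> f k = k"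
  shows "recolour f Q = Q"
proof -
  have "(f ` fst x, snd x) = x" if "x \<in> Q" for x
  proof -
    have "f ` fst x = fst x" using assms that by force
    then show ?thesis by simp
  qed
  then show ?thesis by (simp add: recolour_def case_prod_unfold)
qed

lemma support_recolour: "\<Union>(fst ` recolour f Q) = f ` \<Union>(fst ` Q)"
  by (simp add: recolour_def image_image case_prod_unfold image_UN)

lemma standardize_eq_recolour: "standardize P = recolour (rank (\<Union>(fst ` P))) P"
  unfolding standardize_def recolour_def rank_def Let_def by simp

lemma recolour_standardize:
  assumes "finite (\<Union>(fst ` P))"
  shows "recolour (nth_of (\<Union>(fst ` P))) (standardize P) = P"
  unfolding standardize_eq_recolour recolour_recolour
  by (rule recolour_ident) (simp only: o_apply nth_of_rank[OF assms])

lemma support_standardize: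
  assumes "finite (\<Union>(fst ` P))"
  shows "\<Union>(fst ` standardize P) = {1..card (\<Union>(fst ` P))}"
  unfolding standardize_eq_recolour support_recolour by (rule rank_image[OF assms])

lemma standardize_recolour:
  assumes "\<Union>(fst ` Q) = {1..card S}" "finite S"
  shows "standardize (recolour (nth_of S) Q) = Q"
  unfolding standardize_eq_recolour support_recolour recolour_recolour assms(1) nth_of_image[OF assms(2)]
  by (rule recolour_ident) (simp only: o_apply assms(1) rank_nth_of[OF assms(2)])

definition glue :: "nat \<Rightarrow> cpartition \<Rightarrow> cpartition \<Rightarrow> nat set \<Rightarrow> cpartition" where
  "glue N Q' Q'' S = recolour (nth_of S) Q' \<union> recolour (nth_of ({1..N} - S)) Q''"

lemma sum_single_const:
  "(\<Sum>x\<in>X. Poly_Mapping.single y (1::complex)) = Poly_Mapping.single y (of_nat (card X))"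
  by (induction X rule: infinite_finite_induct) (simp_all add: single_add[symmetric])

context connected_colouring
begin

lemma cpartition_of_eq: "cpartition_of c n Q \<longleftrightarrow> coloured {1..n} Q"
  by (simp add: cpartition_of_def coloured_def)

lemma coloured_support: "coloured S Q \<Longrightarrow> \<Union>(fst ` Q) = S"
  by (simp add: coloured_def partition_onD1[symmetric])

lemma coloured_nth_of:
  assumes "coloured {1..card S} Q" "finite S"
  shows "coloured S (recolour (nth_of S) Q)"
  using coloured_recolour[OF assms(1) strict_mono_on_imp_inj_on[OF strict_mono_on_nth_of[OF assms(2)]]]
  by (simp only: nth_of_image[OF assms(2)])

context
  fixes n n' Q' Q''
  assumes Q': "coloured {1..n} Q'" and Q'': "coloured {1..n'} Q''"
begin

lemma coloured_parts:
  assumes "S \<in> splittings n n'"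
  shows "coloured S (recolour (nth_of S) Q')"
    "coloured ({1..n + n'} - S) (recolour (nth_of ({1..n + n'} - S)) Q'')"
proof -
  note S = splittings_complement[OF assms]
  show "coloured S (recolour (nth_of S) Q')"
    using Q' S by (intro coloured_nth_of) (simp_all only:)
  show "coloured ({1..n + n'} - S) (recolour (nth_of ({1..n + n'} - S)) Q'')"
  proof (rule coloured_nth_of)
    show "coloured {1..card ({1..n + n'} - S)} Q''" unfolding S(3) by (rule Q'')
  qed simp
qed

lemma coloured_glue:
  assumes "S \<in> splittings n n'"
  shows "coloured {1..n + n'} (glue (n + n') Q' Q'' S)"
    "recolour (nth_of S) Q' \<inter> recolour (nth_of ({1..n + n'} - S)) Q'' = {}"
proof -
  have "S \<union> ({1..n + n'} - S) = {1..n + n'}" using assms by (auto simp: splittings_def)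
  then show "coloured {1..n + n'} (glue (n + n') Q' Q'' S)"
    using coloured_Un(1)[OF coloured_parts[OF assms]] by (simp add: glue_def)
  show "recolour (nth_of S) Q' \<inter> recolour (nth_of ({1..n + n'} - S)) Q'' = {}"
    using coloured_Un(2)[OF coloured_parts[OF assms]] by simp
qed

text \<open>\<open>fill\<close> commutes with unions and with increasing relabellings. The resulting
  form is the one that \<open>atoms_shuffle\<close> reaches from the side of the diagrams, and this
  is where the two products meet.\<close>

lemma fill_glue:
  assumes "S \<in> splittings n n'"
  shows "fill (glue (n + n') Q' Q'' S) =
    relabel (nth_of S) (fill Q') \<union> relabel (nth_of ({1..n + n'} - S)) (fill Q'')"
proof -
  note S = splittings_complement[OF assms]
  have "strict_mono_on {1..n} (nth_of S)"
    using strict_mono_on_nth_of[OF S(1)] by (simp only: S(2))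
  moreover have "strict_mono_on {1..n'} (nth_of ({1..n + n'} - S))"
    using strict_mono_on_nth_of[of "{1..n + n'} - S"] by (simp only: S(3) finite_Diff finite_atLeastAtMost)
  ultimately show ?thesis
    unfolding glue_def fill_Un
    by (simp add: fill_recolour[OF _ Q'] fill_recolour[OF _ Q''])
qed

text \<open>A pair counted by \<open>alpha\<close> is determined by the support of its first part,
  since the increasing enumerations of this support and of its complement undo the two
  standardisations. The size \<open>m\<close> is arbitrary at the outset; a pair can exist only if
  it equals \<open>n + n'\<close>.\<close>

lemma alpha_eq_card:
  assumes Q: "coloured {1..m} Q"
  shows "alpha Q Q' Q'' = card {S \<in> splittings n n'. glue (n + n') Q' Q'' S = Q}"
proof -
  let ?X = "{S \<in> splittings n n'. glue (n + n') Q' Q'' S = Q}"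
  let ?Y = "{(P', P''). P' \<inter> P'' = {} \<and> P' \<union> P'' = Q \<and> standardize P' = Q' \<and> standardize P'' = Q''}"
  let ?f = "\<lambda>S. (recolour (nth_of S) Q', recolour (nth_of ({1..n + n'} - S)) Q'')"
  let ?g = "\<lambda>(P', P''). \<Union>(fst ` P') :: nat set"
  have key: "?g x \<in> splittings n n' \<and> ?f (?g x) = x" if x: "x \<in> ?Y" for x
  proof -
    obtain P' P'' where P: "x = (P', P'')" "P' \<inter> P'' = {}" "P' \<union> P'' = Q"
      "standardize P' = Q'" "standardize P'' = Q''" using x by auto
    define S T where "S = \<Union>(fst ` P')" and "T = \<Union>(fst ` P'')"
    have ST: "S \<union> T = {1..m}" using coloured_support[OF Q] P(3) by (auto simp: S_def T_def)
    then have fin: "finite S" "finite T" by (metis finite_Un finite_atLeastAtMost)+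
    have disj: "S \<inter> T = {}"
    proof (rule ccontr)
      \<comment> \<open>The two parts are given as disjoint sets of coloured blocks; that their
        supports are disjoint as well comes from the disjointness of distinct blocks of
        \<open>Q\<close>.\<close>
      assume "S \<inter> T \<noteq> {}"
      then obtain p i q j where pq: "(p, i) \<in> P'" "(q, j) \<in> P''" "p \<inter> q \<noteq> {}"
        unfolding S_def T_def by fastforce
      then have "(p, i) \<in> Q" "(q, j) \<in> Q" using P(3) by blast+
      then have "(p, i) = (q, j)" using colouredD(4)[OF Q _ _ pq(3)] by blast
      then show False using pq(1,2) P(2) by blast
    qed
    have "\<Union>(fst ` standardize P') = {1..card S}"
      using support_standardize[of P'] fin(1) unfolding S_def by blast
    \<comment> \<open>Standardisation turns the support into an initial interval of the same
      cardinality, so comparing with the support of \<open>Q'\<close> fixes the size of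
      \<open>S\<close>.\<close>
    then have "{1..card S} = {1..n}" by (simp only: P(4) coloured_support[OF Q'])
    then have cS: "card S = n" by (metis card_atLeastAtMost diff_Suc_1)
    have "\<Union>(fst ` standardize P'') = {1..card T}"
      using support_standardize[of P''] fin(2) unfolding T_def by blast
    then have "{1..card T} = {1..n'}" by (simp only: P(5) coloured_support[OF Q''])
    then have cT: "card T = n'" by (metis card_atLeastAtMost diff_Suc_1)
    have "m = n + n'" using card_Un_disjoint[OF fin disj] ST cS cT by simp
    with ST have "S \<subseteq> {1..n + n'}" "T = {1..n + n'} - S" using disj by auto
    moreover have "recolour (nth_of S) Q' = P'" "recolour (nth_of T) Q'' = P''"
      using recolour_standardize[of P'] recolour_standardize[of P''] fin P(4,5) by (simp_all add: S_def T_def)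
    ultimately show ?thesis using cS by (simp add: P(1) S_def[symmetric] splittings_def)
  qed
  have "bij_betw ?f ?X ?Y"
  proof (rule bij_betw_byWitness[where f' = ?g])
    show "\<forall>S\<in>?X. ?g (?f S) = S"
      using coloured_support[OF coloured_parts(1)] by simp
    show "\<forall>x\<in>?Y. ?f (?g x) = x" using key by blast
    show "?f ` ?X \<subseteq> ?Y"
    proof clarify
      fix S assume S: "S \<in> splittings n n'" and eq: "Q = glue (n + n') Q' Q'' S"
      note c = splittings_complement[OF S]
      have "standardize (recolour (nth_of S) Q') = Q'"
        by (rule standardize_recolour) (simp_all only: coloured_support[OF Q'] c)
      moreover have "standardize (recolour (nth_of ({1..n + n'} - S)) Q'') = Q''"
        by (rule standardize_recolour) (simp_all only: coloured_support[OF Q''] c finite_Diff finite_atLeastAtMost)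
      ultimately show "recolour (nth_of S) Q' \<inter> recolour (nth_of ({1..n + n'} - S)) Q'' = {} \<and>
          recolour (nth_of S) Q' \<union> recolour (nth_of ({1..n + n'} - S)) Q'' = glue (n + n') Q' Q'' S \<and>
          standardize (recolour (nth_of S) Q') = Q' \<and>
          standardize (recolour (nth_of ({1..n + n'} - S)) Q'') = Q''"
        using coloured_glue(2)[OF S] by (simp add: glue_def)
    qed
    show "?g ` ?Y \<subseteq> ?X"
    proof
      fix S assume "S \<in> ?g ` ?Y"
      then obtain x where x: "x \<in> ?Y" "S = ?g x" by blast
      have "fst x \<union> snd x = Q" using x(1) by auto
      then have "glue (n + n') Q' Q'' S = Q"
        using key[OF x(1)] unfolding x(2) glue_def by (metis fst_conv snd_conv)
      with key[OF x(1)] show "S \<in> ?X" by (simp add: x(2))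
    qed
  qed
  then show ?thesis unfolding alpha_def by (simp add: bij_betw_same_card)
qed

text \<open>Different splittings may give the same partition, for instance when both factors are a
  single block of size 1 with the same colour. Grouping the splittings by their result produces the
  coefficients, as the fibre over \<open>Q\<close> has \<open>alpha Q Q' Q''\<close>
  elements.\<close>

lemma cpartition_product_eq:
  "cpartition_product c Q' Q'' =
     (\<Sum>S\<in>splittings n n'. Poly_Mapping.single (glue (n + n') Q' Q'' S) 1)"
proof -
  let ?glue = "glue (n + n') Q' Q''"
  have support: "{Q \<in> cpartitions c. alpha Q Q' Q'' \<noteq> 0} = ?glue ` splittings n n'"
  proof (intro equalityI subsetI)
    fix Q assume "Q \<in> {Q \<in> cpartitions c. alpha Q Q' Q'' \<noteq> 0}"
    then obtain m where "coloured {1..m} Q" "alpha Q Q' Q'' \<noteq> 0"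
      by (auto simp: cpartitions_def cpartition_of_eq)
    then have "{S \<in> splittings n n'. ?glue S = Q} \<noteq> {}"
      using alpha_eq_card by (metis card.empty)
    then show "Q \<in> ?glue ` splittings n n'" by auto
  next
    fix Q assume "Q \<in> ?glue ` splittings n n'"
    then obtain S where S: "S \<in> splittings n n'" "Q = ?glue S" by blast
    then have Q: "coloured {1..n + n'} Q" using coloured_glue(1) by simp
    have "S \<in> {S \<in> splittings n n'. ?glue S = Q}" using S by simp
    then have "alpha Q Q' Q'' \<noteq> 0" unfolding alpha_eq_card[OF Q] by (auto simp: card_eq_0_iff)
    with Q show "Q \<in> {Q \<in> cpartitions c. alpha Q Q' Q'' \<noteq> 0}"
      by (auto simp: cpartitions_def cpartition_of_eq)
  qed
  have "(\<Sum>S\<in>splittings n n'. Poly_Mapping.single (?glue S) (1::complex)) =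
      (\<Sum>Q\<in>?glue ` splittings n n'. \<Sum>S\<in>{S \<in> splittings n n'. ?glue S = Q}. Poly_Mapping.single (?glue S) 1)"
    by (rule sum.image_gen) simp
  also have "\<dots> = (\<Sum>Q\<in>?glue ` splittings n n'. Poly_Mapping.single Q (of_nat (alpha Q Q' Q'')))"
  proof (rule sum.cong)
    fix Q assume "Q \<in> ?glue ` splittings n n'"
    then have "coloured {1..n + n'} Q" using coloured_glue(1) by auto
    then show "(\<Sum>S\<in>{S \<in> splittings n n'. ?glue S = Q}. Poly_Mapping.single (?glue S) 1) =
        Poly_Mapping.single Q (of_nat (alpha Q Q' Q'') :: complex)"
      by (simp add: alpha_eq_card sum_single_const)
  qed simp
  finally show ?thesis by (simp only: cpartition_product_def support)
qed

end

end

section \<open>The atoms of a diagram\<close>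

text \<open>The global index of half-edge number \<open>p\<close> of vertex \<open>i\<close>, both
  counted from 1. On the valid addresses, the \<open>slots\<close>, it is inverted by
  \<open>block\<close> together with the offset inside the block.\<close>

definition pos :: "nat list \<Rightarrow> nat \<Rightarrow> nat \<Rightarrow> nat" where
  "pos ls i p = sum_list (take (i - 1) ls) + p"

definition slots :: "nat list \<Rightarrow> (nat \<times> nat) set" where
  "slots ls = {(i, p). i \<in> {1..length ls} \<and> p \<in> {1..ls ! (i - 1)}}"

lemma sum_list_take_le: "i \<le> j \<Longrightarrow> sum_list (take i ls) \<le> sum_list (take j (ls :: nat list))"
proof -
  assume "i \<le> j"
  then have "take j ls = take i ls @ take (j - i) (drop i ls)" by (metis le_add_diff_inverse take_add)
  then show ?thesis by simp
qed

lemma sum_list_take_Suc_pred: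
  assumes "i \<in> {1..length ls}"
  shows "sum_list (take i ls) = sum_list (take (i - 1) ls) + (ls ! (i - 1) :: nat)"
proof -
  have "take (Suc (i - 1)) ls = take (i - 1) ls @ [ls ! (i - 1)]"
    using assms by (intro take_Suc_conv_app_nth) auto
  then show ?thesis using assms by simp
qed

lemma pos_bounds:
  assumes "(i, p) \<in> slots ls"
  shows "i \<in> {1..length ls}" "sum_list (take (i - 1) ls) < pos ls i p" "pos ls i p \<le> sum_list (take i ls)"
  using assms sum_list_take_Suc_pred[of i ls] by (auto simp: slots_def pos_def)

lemma block_unique:
  fixes ls :: "nat list"
  assumes "sum_list (take (i - 1) ls) < k" "k \<le> sum_list (take i ls)"
    "sum_list (take (j - 1) ls) < k" "k \<le> sum_list (take j ls)"
  shows "i = j"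
proof -
  have "i \<le> j" if "sum_list (take (i - 1) ls) < k" "k \<le> sum_list (take j ls)" for i j
  proof (rule ccontr)
    assume "\<not> i \<le> j"
    then have "j \<le> i - 1" by simp
    from sum_list_take_le[OF this, of ls] that show False by simp
  qed
  from this[of i j] this[of j i] assms show ?thesis by simp
qed

lemma block_pos:
  assumes "(i, p) \<in> slots ls"
  shows "block ls (pos ls i p) = i"
  unfolding block_def
proof (rule the_equality)
  show "i \<in> {1..length ls} \<and> sum_list (take (i - 1) ls) < pos ls i p \<and> pos ls i p \<le> sum_list (take i ls)"
    using pos_bounds[OF assms] by simp
  show "j = i" if "j \<in> {1..length ls} \<and> sum_list (take (j - 1) ls) < pos ls i p \<and>
      pos ls i p \<le> sum_list (take j ls)" for j
    using block_unique[of j ls "pos ls i p" i] pos_bounds[OF assms] that by simp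
qed

lemma pos_inj:
  assumes "(i, p) \<in> slots ls" "(j, q) \<in> slots ls" "pos ls i p = pos ls j q"
  shows "i = j" "p = q"
proof -
  show "i = j" using block_pos[OF assms(1)] block_pos[OF assms(2)] assms(3) by simp
  then show "p = q" using assms(3) by (simp add: pos_def)
qed

lemma pos_range:
  assumes "(i, p) \<in> slots ls"
  shows "pos ls i p \<in> {1..sum_list ls}"
proof -
  have "sum_list (take i ls) \<le> sum_list (take (length ls) ls)"
    using pos_bounds(1)[OF assms] by (intro sum_list_take_le) simp
  then show ?thesis using pos_bounds[OF assms] by simp
qed

lemma pos_surj:
  assumes "k \<in> {1..sum_list ls}"
  obtains i p where "(i, p) \<in> slots ls" "k = pos ls i p"
proof -
  \<comment> \<open>The first block whose end reaches \<open>k\<close>; by minimality the end of the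
    preceding block lies strictly below \<open>k\<close>.\<close>
  define i where "i = (LEAST i. k \<le> sum_list (take i ls))"
  have ex: "k \<le> sum_list (take (length ls) ls)" using assms by simp
  have le: "k \<le> sum_list (take i ls)" unfolding i_def by (rule LeastI[of _ "length ls"]) (rule ex)
  have "i \<le> length ls" unfolding i_def by (rule Least_le) (rule ex)
  moreover have "i \<noteq> 0" using le assms by (intro notI) simp
  ultimately have i: "i \<in> {1..length ls}" by simp
  have "\<not> k \<le> sum_list (take (i - 1) ls)"
    using not_less_Least[of "i - 1" "\<lambda>i. k \<le> sum_list (take i ls)"] i unfolding i_def[symmetric] by simp
  then have "(i, k - sum_list (take (i - 1) ls)) \<in> slots ls" "k = pos ls i (k - sum_list (take (i - 1) ls))"
    using i le sum_list_take_Suc_pred[OF i] by (auto simp: slots_def pos_def)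
  then show ?thesis by (rule that)
qed

text \<open>Its use is the count \<open>card (slots ls) = sum_list ls\<close>, which yields the
  invariance of the weight under permutations in \<open>sum_lam_H\<close>.\<close>

lemma bij_betw_pos: "bij_betw (\<lambda>(i, p). pos ls i p) (slots ls) {1..sum_list ls}"
  unfolding bij_betw_def
proof (intro conjI inj_onI equalityI subsetI)
  fix x y assume xy: "x \<in> slots ls" "y \<in> slots ls" "(case x of (i, p) \<Rightarrow> pos ls i p) = (case y of (i, p) \<Rightarrow> pos ls i p)"
  obtain i p j q where "x = (i, p)" "y = (j, q)" by fastforce
  with xy show "x = y" using pos_inj[of i p ls j q] by simp
next
  fix k assume "k \<in> (\<lambda>(i, p). pos ls i p) ` slots ls"
  then show "k \<in> {1..sum_list ls}" using pos_range by auto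
next
  fix k assume "k \<in> {1..sum_list ls}"
  then obtain i p where "(i, p) \<in> slots ls" "k = pos ls i p" by (rule pos_surj)
  then show "k \<in> (\<lambda>(i, p). pos ls i p) ` slots ls" by (auto intro: rev_image_eqI)
qed

text \<open>The part of \<open>is_bdiagram\<close> that is preserved by every permutation of the vertices.\<close>

definition wf_bdiagram :: "bdiagram \<Rightarrow> bool" where
  "wf_bdiagram G \<longleftrightarrow> dom (phi G) \<subseteq> {1..weight G} \<and> ran (phi G) \<subseteq> {1..weight G} \<and>
     Fup G \<subseteq> {1..weight G} - dom (phi G) \<and> Fdown G \<subseteq> {1..weight G} - ran (phi G)"

lemma is_bdiagram_wf: "is_bdiagram G \<Longrightarrow> wf_bdiagram G"
  by (simp add: is_bdiagram_def wf_bdiagram_def)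

text \<open>The elementary diagram at a vertex: the half-edges used by edges are made free again.\<close>

definition local_diagram :: "bdiagram \<Rightarrow> nat \<Rightarrow> bdiagram" where
  "local_diagram G i =
     \<lparr>lam = [lam G ! (i - 1)], phi = Map.empty,
      Fup = {p \<in> {1..lam G ! (i - 1)}. pos (lam G) i p \<in> Fup G \<union> dom (phi G)},
      Fdown = {p \<in> {1..lam G ! (i - 1)}. pos (lam G) i p \<in> Fdown G \<union> ran (phi G)}\<rparr>"

definition atoms :: "bdiagram \<Rightarrow> nat atom set" where
  "atoms G = {Vertex i (local_diagram G i) | i. i \<in> {1..nverts G}} \<union>
     {Edge i p j q | i p j q. (i, p) \<in> slots (lam G) \<and> (j, q) \<in> slots (lam G) \<and>
        phi G (pos (lam G) i p) = Some (pos (lam G) j q)}"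

lemma Vertex_atoms: "Vertex i V \<in> atoms G \<longleftrightarrow> i \<in> {1..nverts G} \<and> V = local_diagram G i"
  by (auto simp: atoms_def)

lemma Edge_atoms: "Edge i p j q \<in> atoms G \<longleftrightarrow> (i, p) \<in> slots (lam G) \<and> (j, q) \<in> slots (lam G) \<and>
    phi G (pos (lam G) i p) = Some (pos (lam G) j q)"
  by (auto simp: atoms_def)

lemma atoms_support: "x \<in> atoms G \<Longrightarrow> set_atom x \<subseteq> {1..nverts G}"
  by (cases x) (auto simp: Vertex_atoms Edge_atoms slots_def nverts_def)

section \<open>Recovering a diagram from its atoms\<close>

lemma atoms_nverts: "{i. \<exists>V. Vertex i V \<in> atoms G} = {1..nverts G}"
  by (auto simp: Vertex_atoms)

lemma diagram_on_nverts:
  assumes "diagram_on D {1..n} (atoms G)"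
  shows "nverts G = n"
proof -
  have "{i. \<exists>V. Vertex i V \<in> atoms G} = {1..n}"
    using diagram_onD(1,3)[OF assms] by blast
  then have "card {1..nverts G} = card {1..n}" by (simp only: atoms_nverts)
  then show ?thesis by simp
qed

lemma Edge_of_phi:
  assumes "wf_bdiagram G" "phi G a = Some b"
  obtains i p j q where "(i, p) \<in> slots (lam G)" "(j, q) \<in> slots (lam G)" "a = pos (lam G) i p"
    "b = pos (lam G) j q" "Edge i p j q \<in> atoms G"
proof -
  have "a \<in> {1..sum_list (lam G)}" "b \<in> {1..sum_list (lam G)}"
    using assms by (auto simp: wf_bdiagram_def weight_def dom_def ran_def)
  then obtain i p j q where "(i, p) \<in> slots (lam G)" "(j, q) \<in> slots (lam G)" "a = pos (lam G) i p"
    "b = pos (lam G) j q" using pos_surj by metis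
  then show ?thesis using that assms(2) by (simp add: Edge_atoms)
qed

text \<open>The vertex atoms give the block sizes and the edge atoms give \<open>phi\<close>; the
  free half-edges are those recorded at the vertices minus those used by \<open>phi\<close>.
  Well-formedness excludes data beyond the weight, which the atoms cannot see.\<close>

lemma atoms_inj:
  assumes wf: "wf_bdiagram G" "wf_bdiagram H" and eq: "atoms G = atoms H"
  shows "G = H"
proof -
  have "card {1..nverts G} = card {1..nverts H}" using eq by (simp only: atoms_nverts[symmetric])
  then have n: "nverts G = nverts H" by simp
  have loc: "local_diagram G i = local_diagram H i" if "i \<in> {1..nverts G}" for i
    using that Vertex_atoms[of i "local_diagram G i"] eq by blast
  have lam: "lam G = lam H"
  proof (rule nth_equalityI)
    show "length (lam G) = length (lam H)" using n by (simp add: nverts_def)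
    show "lam G ! i = lam H ! i" if "i < length (lam G)" for i
      using loc[of "Suc i"] that by (simp add: nverts_def local_diagram_def)
  qed
  \<comment> \<open>Stated for arbitrary diagrams in order to serve in both directions; the same
    holds for \<open>sub\<close> and \<open>sub'\<close> below.\<close>
  have "phi H a = Some b" if *: "wf_bdiagram G" "phi G a = Some b" "atoms G = atoms H" "lam G = lam H" for G H a b
  proof -
    obtain i p j q where "(i, p) \<in> slots (lam G)" "(j, q) \<in> slots (lam G)" "a = pos (lam G) i p"
      "b = pos (lam G) j q" "Edge i p j q \<in> atoms G"
      by (rule Edge_of_phi[OF *(1,2)])
    then show ?thesis using *(3,4) by (simp add: Edge_atoms)
  qed
  from this[OF wf(1) _ eq lam] this[OF wf(2) _ eq[symmetric] lam[symmetric]]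
  have "phi G a = Some b \<longleftrightarrow> phi H a = Some b" for a b by blast
  then have phi: "phi G = phi H" by (auto simp: fun_eq_iff) (metis not_Some_eq)
  have sub: "a \<in> Fup H" if "a \<in> Fup G" "wf_bdiagram G" "lam G = lam H" "phi G = phi H"
    "\<And>i. i \<in> {1..nverts G} \<Longrightarrow> local_diagram G i = local_diagram H i" for G H a
  proof -
    have a: "a \<in> {1..sum_list (lam G)}" and "a \<notin> dom (phi H)"
      using that(1,2,4) by (auto simp: wf_bdiagram_def weight_def)
    obtain i p where ip: "(i, p) \<in> slots (lam G)" "a = pos (lam G) i p" by (rule pos_surj[OF a])
    then have "p \<in> Fup (local_diagram G i)" using that(1) by (simp add: local_diagram_def slots_def)
    moreover have "local_diagram G i = local_diagram H i" using ip that(5) by (simp add: slots_def nverts_def)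
    ultimately have "p \<in> Fup (local_diagram H i)" by simp
    then show ?thesis using ip \<open>a \<notin> dom (phi H)\<close> that(3) by (simp add: local_diagram_def)
  qed
  have sub': "a \<in> Fdown H" if "a \<in> Fdown G" "wf_bdiagram G" "lam G = lam H" "phi G = phi H"
    "\<And>i. i \<in> {1..nverts G} \<Longrightarrow> local_diagram G i = local_diagram H i" for G H a
  proof -
    have a: "a \<in> {1..sum_list (lam G)}" and "a \<notin> ran (phi H)"
      using that(1,2,4) by (auto simp: wf_bdiagram_def weight_def)
    obtain i p where ip: "(i, p) \<in> slots (lam G)" "a = pos (lam G) i p" by (rule pos_surj[OF a])
    then have "p \<in> Fdown (local_diagram G i)" using that(1) by (simp add: local_diagram_def slots_def)
    moreover have "local_diagram G i = local_diagram H i" using ip that(5) by (simp add: slots_def nverts_def)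
    ultimately have "p \<in> Fdown (local_diagram H i)" by simp
    then show ?thesis using ip \<open>a \<notin> ran (phi H)\<close> that(3) by (simp add: local_diagram_def)
  qed
  have loc': "local_diagram H i = local_diagram G i" if "i \<in> {1..nverts H}" for i
    using loc[of i] that n by simp
  have "Fup G = Fup H"
    using sub[OF _ wf(1) lam phi loc] sub[OF _ wf(2) lam[symmetric] phi[symmetric] loc'] by blast
  moreover have "Fdown G = Fdown H"
    using sub'[OF _ wf(1) lam phi loc] sub'[OF _ wf(2) lam[symmetric] phi[symmetric] loc'] by blast
  ultimately show ?thesis using lam phi by simp
qed

lemma connected_bdiagram_atoms:
  assumes "wf_bdiagram G"
  shows "connected_bdiagram G \<longleftrightarrow> connected_on {1..nverts G} (atoms G)"
proof -
  have "vertex_adj G = adj (atoms G)"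
  proof (intro equalityI subsetI)
    fix x assume "x \<in> vertex_adj G"
    then obtain a b where ab: "phi G a = Some b" "x = (block (lam G) a, block (lam G) b)"
      by (auto simp: vertex_adj_def)
    obtain i p j q where "(i, p) \<in> slots (lam G)" "(j, q) \<in> slots (lam G)" "a = pos (lam G) i p"
      "b = pos (lam G) j q" "Edge i p j q \<in> atoms G" by (rule Edge_of_phi[OF assms ab(1)])
    then show "x \<in> adj (atoms G)" using ab by (auto simp: adj_def block_pos)
  next
    fix x assume "x \<in> adj (atoms G)"
    then obtain i p j q where e: "x = (i, j)" "Edge i p j q \<in> atoms G" by (auto simp: adj_def)
    then have s: "(i, p) \<in> slots (lam G)" "(j, q) \<in> slots (lam G)"
      "phi G (pos (lam G) i p) = Some (pos (lam G) j q)" by (simp_all add: Edge_atoms)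
    then show "x \<in> vertex_adj G"
      unfolding vertex_adj_def e(1) using block_pos[OF s(1)] block_pos[OF s(2)] by force
  qed
  then show ?thesis by (auto simp: connected_bdiagram_def connected_on_def link_def)
qed

section \<open>Compositions\<close>

lemma pos_append_left: "i \<le> length ls \<Longrightarrow> pos (ls @ ls') i p = pos ls i p"
  by (simp add: pos_def)

lemma pos_append_right: "1 \<le> i \<Longrightarrow> pos (ls @ ls') (i + length ls) p = pos ls' i p + sum_list ls"
  by (simp add: pos_def)

lemma slots_append: "slots (ls @ ls') = slots ls \<union> (\<lambda>(i, p). (i + length ls, p)) ` slots ls'"
proof (intro equalityI subsetI)
  fix x assume "x \<in> slots (ls @ ls')"
  then obtain i p where x: "x = (i, p)" "i \<in> {1..length ls + length ls'}" "p \<in> {1..(ls @ ls') ! (i - 1)}"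
    by (auto simp: slots_def)
  show "x \<in> slots ls \<union> (\<lambda>(i, p). (i + length ls, p)) ` slots ls'"
  proof (cases "i \<le> length ls")
    case True
    then have "(ls @ ls') ! (i - 1) = ls ! (i - 1)" using x(2) by (auto simp: nth_append)
    then show ?thesis using x True by (simp add: slots_def)
  next
    case False
    then have "(ls @ ls') ! (i - 1) = ls' ! (i - length ls - 1)"
      by (auto simp: nth_append)
    then have "(i - length ls, p) \<in> slots ls'" using x False by (auto simp: slots_def)
    then show ?thesis using x(1) False by (auto intro!: rev_image_eqI)
  qed
next
  fix x assume "x \<in> slots ls \<union> (\<lambda>(i, p). (i + length ls, p)) ` slots ls'"
  then show "x \<in> slots (ls @ ls')"
  proof
    assume "x \<in> slots ls"
    then show ?thesis by (auto simp: slots_def nth_append)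
  next
    assume "x \<in> (\<lambda>(i, p). (i + length ls, p)) ` slots ls'"
    then obtain i p where x: "x = (i + length ls, p)" "i \<in> {1..length ls'}" "p \<in> {1..ls' ! (i - 1)}"
      by (auto simp: slots_def)
    then have "(ls @ ls') ! (i + length ls - 1) = ls' ! (i - 1)" by (auto simp: nth_append)
    then show ?thesis using x by (simp add: slots_def)
  qed
qed

text \<open>The bookkeeping for free half-edges of a composition, with \<open>f\<close> the shift by
  the weight of the first factor: \<open>wf_C\<close> applies it once to upper and once to lower
  half-edges.\<close>

lemma shifted_Un_subset:
  fixes f :: "'a \<Rightarrow> 'a"
  assumes "A \<subseteq> I - B" "B \<subseteq> I" "X \<subseteq> J - Y" "Y \<subseteq> J" "inj f" "I \<inter> f ` J = {}"
  shows "A \<union> f ` X \<subseteq> (I \<union> f ` J) - (B \<union> f ` Y)"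
proof -
  have aux: "A \<union> X' \<subseteq> (I \<union> J') - (B \<union> Y')"
    if "X' \<subseteq> J' - Y'" "Y' \<subseteq> J'" "I \<inter> J' = {}" for X' J' Y' :: "'a set"
    using that assms(1,2) by blast
  have "f ` X \<subseteq> f ` J - f ` Y"
    using image_mono[OF assms(3), of f] by (simp only: image_set_diff[OF assms(5)])
  then show ?thesis using image_mono[OF assms(4), of f] assms(6) by (rule aux)
qed

text \<open>Two instances are needed: both lists empty, which is juxtaposition, and \<open>H\<close>
  elementary, which adds one vertex at the end.\<close>

locale composition =
  fixes G H :: bdiagram and as bs :: "nat list"
  assumes wf_G: "wf_bdiagram G" and wf_H: "wf_bdiagram H"
    and len: "length as = length bs" and dist: "distinct as" "distinct bs"
    and as: "set as \<subseteq> Fup G" and bs: "set bs \<subseteq> Fdown H"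
begin

abbreviation "C \<equiv> compose_along G H as bs"

lemma lam_C: "lam C = lam G @ lam H" by (simp add: compose_along_def)

lemma weight_C: "weight C = weight G + weight H" by (simp add: weight_def lam_C)

lemma nverts_C: "nverts C = nverts G + nverts H" by (simp add: nverts_def lam_C)

lemma bounds_G: "phi G a = Some b \<Longrightarrow> a \<in> {1..weight G} \<and> b \<in> {1..weight G}"
  and bounds_H: "phi H a = Some b \<Longrightarrow> a \<in> {1..weight H} \<and> b \<in> {1..weight H}"
  using wf_G wf_H by (auto simp: wf_bdiagram_def dom_def ran_def)

lemma zip_bounds:
  assumes "(a, b) \<in> set (zip as bs)"
  shows "a \<in> Fup G" "a \<in> {1..weight G}" "a \<notin> dom (phi G)"
    "b \<in> Fdown H" "b \<in> {1..weight H}" "b \<notin> ran (phi H)"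
proof -
  have "a \<in> Fup G" "b \<in> Fdown H" using as bs set_zip_leftD[OF assms] set_zip_rightD[OF assms] by auto
  then show "a \<in> Fup G" "a \<in> {1..weight G}" "a \<notin> dom (phi G)"
    "b \<in> Fdown H" "b \<in> {1..weight H}" "b \<notin> ran (phi H)"
    using wf_G wf_H unfolding wf_bdiagram_def by blast+
qed

lemma map_of_edges:
  "map_of (zip as (map (\<lambda>b. b + weight G) bs)) x = Some y \<longleftrightarrow>
     (\<exists>b. (x, b) \<in> set (zip as bs) \<and> y = b + weight G)"
proof -
  have zip: "zip as (map (\<lambda>b. b + weight G) bs) = map (\<lambda>(a, b). (a, b + weight G)) (zip as bs)"
    by (rule zip_map2)
  have "map fst (zip as (map (\<lambda>b. b + weight G) bs)) = as" using len by simp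
  then have "map_of (zip as (map (\<lambda>b. b + weight G) bs)) x = Some y \<longleftrightarrow>
      (x, y) \<in> set (zip as (map (\<lambda>b. b + weight G) bs))"
    using dist by (intro map_of_eq_Some_iff) (simp only:)
  then show ?thesis unfolding zip by auto
qed

lemma shift_map_Some:
  "shift_map (weight G) (phi H) x = Some y \<longleftrightarrow>
     (\<exists>a b. phi H a = Some b \<and> x = a + weight G \<and> y = b + weight G)"
proof
  assume "shift_map (weight G) (phi H) x = Some y"
  then have "weight G < x" "phi H (x - weight G) = Some (y - weight G)" "weight G \<le> y"
    by (auto simp: shift_map_def split: if_splits)
  then show "\<exists>a b. phi H a = Some b \<and> x = a + weight G \<and> y = b + weight G"
    by (intro exI[of _ "x - weight G"] exI[of _ "y - weight G"]) simp
next
  assume "\<exists>a b. phi H a = Some b \<and> x = a + weight G \<and> y = b + weight G"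
  then show "shift_map (weight G) (phi H) x = Some y"
    using bounds_H by (fastforce simp: shift_map_def)
qed

text \<open>The three kinds of edges start at used half-edges of \<open>G\<close>, at indices above
  \<open>weight G\<close> and at free half-edges of \<open>G\<close>. These domains are disjoint, so
  the precedence in \<open>++\<close> has no effect and the sum of maps is a plain union.\<close>

lemma phi_C:
  "phi C x = Some y \<longleftrightarrow> phi G x = Some y \<or>
     (\<exists>a b. phi H a = Some b \<and> x = a + weight G \<and> y = b + weight G) \<or>
     (\<exists>b. (x, b) \<in> set (zip as bs) \<and> y = b + weight G)"
proof -
  let ?m = "map_of (zip as (map (\<lambda>b. b + weight G) bs))"
  let ?s = "shift_map (weight G) (phi H)"
  have 1: "x \<in> {1..weight G} \<and> phi G x = None" if "?m x = Some z" for z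
    using that zip_bounds(2,3) unfolding map_of_edges by (auto simp: dom_def)
  have 2: "x > weight G" if "?s x = Some z" for z
    using that bounds_H unfolding shift_map_Some by fastforce
  have 3: "x \<le> weight G" if "phi G x = Some z" for z using bounds_G[OF that] by simp
  have "phi C x = Some y \<longleftrightarrow> ?m x = Some y \<or> (?m x = None \<and> (?s x = Some y \<or> (?s x = None \<and> phi G x = Some y)))"
    by (simp add: compose_along_def map_add_Some_iff)
  also have "\<dots> \<longleftrightarrow> phi G x = Some y \<or> ?s x = Some y \<or> ?m x = Some y"
    using 1 2 3 by (cases "?m x"; cases "?s x"; cases "phi G x") fastforce+
  finally show ?thesis unfolding map_of_edges shift_map_Some .
qed

lemma zip_ex:
  "a \<in> set as \<Longrightarrow> \<exists>b. (a, b) \<in> set (zip as bs)"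
  "b \<in> set bs \<Longrightarrow> \<exists>a. (a, b) \<in> set (zip as bs)"
  using len by (fastforce simp: in_set_conv_nth set_zip)+

lemma dom_C: "dom (phi C) = dom (phi G) \<union> (\<lambda>a. a + weight G) ` dom (phi H) \<union> set as"
proof (intro equalityI subsetI)
  fix x assume "x \<in> dom (phi C)"
  then obtain y where "phi C x = Some y" by blast
  then show "x \<in> dom (phi G) \<union> (\<lambda>a. a + weight G) ` dom (phi H) \<union> set as"
    unfolding phi_C by (auto dest: set_zip_leftD)
next
  fix x assume "x \<in> dom (phi G) \<union> (\<lambda>a. a + weight G) ` dom (phi H) \<union> set as"
  then have "\<exists>y. phi C x = Some y" unfolding phi_C using zip_ex(1)[of x] by blast
  then show "x \<in> dom (phi C)" by blast
qed

lemma ran_C: "ran (phi C) = ran (phi G) \<union> (\<lambda>a. a + weight G) ` ran (phi H) \<union> (\<lambda>a. a + weight G) ` set bs"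
proof (intro equalityI subsetI)
  fix y assume "y \<in> ran (phi C)"
  then obtain x where "phi C x = Some y" by (auto simp: ran_def)
  then show "y \<in> ran (phi G) \<union> (\<lambda>a. a + weight G) ` ran (phi H) \<union> (\<lambda>a. a + weight G) ` set bs"
    unfolding phi_C by (auto simp: ran_def dest: set_zip_rightD)
next
  fix y assume "y \<in> ran (phi G) \<union> (\<lambda>a. a + weight G) ` ran (phi H) \<union> (\<lambda>a. a + weight G) ` set bs"
  then have "\<exists>x. phi C x = Some y" unfolding phi_C ran_def using zip_ex(2)[of "y - weight G"] by force
  then show "y \<in> ran (phi C)" by (auto simp: ran_def)
qed

lemma Fup_C: "Fup C = (Fup G - set as) \<union> (\<lambda>i. i + weight G) ` Fup H"
  and Fdown_C: "Fdown C = Fdown G \<union> (\<lambda>i. i + weight G) ` (Fdown H - set bs)"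
  by (simp_all add: compose_along_def)

lemma wf_C: "wf_bdiagram C"
proof -
  have G: "dom (phi G) \<subseteq> {1..weight G}" "ran (phi G) \<subseteq> {1..weight G}"
    "Fup G \<subseteq> {1..weight G} - dom (phi G)" "Fdown G \<subseteq> {1..weight G} - ran (phi G)"
    and H: "dom (phi H) \<subseteq> {1..weight H}" "ran (phi H) \<subseteq> {1..weight H}"
    "Fup H \<subseteq> {1..weight H} - dom (phi H)" "Fdown H \<subseteq> {1..weight H} - ran (phi H)"
    using wf_G wf_H by (simp_all add: wf_bdiagram_def)
  let ?f = "\<lambda>a. a + weight G"
  have weight: "{1..weight C} = {1..weight G} \<union> ?f ` {1..weight H}"
    unfolding weight_C
  proof (intro equalityI subsetI)
    fix k assume "k \<in> {1..weight G + weight H}"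
    then have "k \<in> {1..weight G} \<or> k = ?f (k - weight G) \<and> k - weight G \<in> {1..weight H}" by auto
    then show "k \<in> {1..weight G} \<union> ?f ` {1..weight H}" by blast
  qed auto
  have disj: "{1..weight G} \<inter> ?f ` {1..weight H} = {}" and inj: "inj ?f" by auto
  have "Fup G - set as \<union> ?f ` Fup H \<subseteq>
      ({1..weight G} \<union> ?f ` {1..weight H}) - ((dom (phi G) \<union> set as) \<union> ?f ` dom (phi H))"
    by (rule shifted_Un_subset[OF _ _ H(3,1) inj disj]) (use G as in blast)+
  moreover have "Fdown G \<union> ?f ` (Fdown H - set bs) \<subseteq>
      ({1..weight G} \<union> ?f ` {1..weight H}) - (ran (phi G) \<union> ?f ` (ran (phi H) \<union> set bs))"
    by (rule shifted_Un_subset[OF G(4,2) _ _ inj disj]) (use H bs in blast)+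
  moreover have "set as \<subseteq> {1..weight G}" "set bs \<subseteq> {1..weight H}" using G(3) H(4) as bs by blast+
  moreover have "dom (phi C) \<subseteq> {1..weight C}" "ran (phi C) \<subseteq> {1..weight C}"
    unfolding dom_C ran_C weight using G(1,2) image_mono[OF H(1), of ?f] image_mono[OF H(2), of ?f]
      calculation(3) image_mono[OF calculation(4), of ?f] by (simp_all only: Un_least le_supI1 le_supI2)
  moreover have "(dom (phi G) \<union> set as) \<union> ?f ` dom (phi H) = dom (phi C)"
    "ran (phi G) \<union> ?f ` (ran (phi H) \<union> set bs) = ran (phi C)"
    by (simp_all only: dom_C ran_C image_Un Un_ac)
  ultimately show ?thesis unfolding wf_bdiagram_def Fup_C Fdown_C weight by (simp only: simp_thms)
qed

text \<open>The half-edges in \<open>as\<close> leave \<open>Fup\<close> and enter the domain of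
  \<open>phi\<close>. As a local diagram records the union of the two, composition does not change
  it.\<close>

lemma local_diagram_left:
  assumes "i \<in> {1..nverts G}"
  shows "local_diagram C i = local_diagram G i"
proof -
  have i: "i \<le> length (lam G)" "i - 1 < length (lam G)" using assms by (auto simp: nverts_def)
  have lam: "lam C ! (i - 1) = lam G ! (i - 1)" using i(2) by (simp add: lam_C nth_append)
  have pos: "pos (lam C) i p = pos (lam G) i p" for p unfolding lam_C using i(1) by (rule pos_append_left)
  have *: "pos (lam G) i p \<noteq> a + weight G" if "p \<in> {1..lam G ! (i - 1)}" "a \<in> {1..weight H}" for p a
    using pos_range[of i p "lam G"] that assms by (auto simp: slots_def nverts_def weight_def)
  have H: "Fup H \<subseteq> {1..weight H}" "dom (phi H) \<subseteq> {1..weight H}" "set bs \<subseteq> {1..weight H}"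
    "Fdown H \<subseteq> {1..weight H}" "ran (phi H) \<subseteq> {1..weight H}"
    using wf_H bs by (auto simp: wf_bdiagram_def)
  have up: "pos (lam G) i p \<in> Fup C \<union> dom (phi C) \<longleftrightarrow> pos (lam G) i p \<in> Fup G \<union> dom (phi G)"
    and down: "pos (lam G) i p \<in> Fdown C \<union> ran (phi C) \<longleftrightarrow> pos (lam G) i p \<in> Fdown G \<union> ran (phi G)"
    if "p \<in> {1..lam G ! (i - 1)}" for p
    unfolding Fup_C Fdown_C dom_C ran_C using *[OF that] H as by blast+
  show ?thesis
    unfolding local_diagram_def lam pos using up down by auto
qed

text \<open>The same exchange for \<open>bs\<close>, which pass from the free lower half-edges to
  the range of \<open>phi\<close>, now seen through the shift by \<open>weight G\<close>.\<close>

lemma local_diagram_right: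
  assumes "i \<in> {1..nverts H}"
  shows "local_diagram C (i + nverts G) = local_diagram H i"
proof -
  have i: "1 \<le> i" using assms by simp
  have lam: "lam C ! (i + nverts G - 1) = lam H ! (i - 1)"
    using assms by (auto simp: lam_C nverts_def nth_append)
  have pos: "pos (lam C) (i + nverts G) p = pos (lam H) i p + weight G" for p
    unfolding lam_C nverts_def weight_def using i by (rule pos_append_right)
  have *: "pos (lam H) i p + weight G \<notin> {1..weight G}" if "p \<in> {1..lam H ! (i - 1)}" for p
    using pos_range[of i p "lam H"] that assms by (auto simp: slots_def nverts_def weight_def)
  have G: "Fup G \<subseteq> {1..weight G}" "dom (phi G) \<subseteq> {1..weight G}"
    "Fdown G \<subseteq> {1..weight G}" "ran (phi G) \<subseteq> {1..weight G}"
    using wf_G by (auto simp: wf_bdiagram_def)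
  have shift: "a + weight G \<in> (\<lambda>a. a + weight G) ` X \<longleftrightarrow> a \<in> X" for a X by auto
  have up: "pos (lam H) i p + weight G \<in> Fup C \<union> dom (phi C) \<longleftrightarrow> pos (lam H) i p \<in> Fup H \<union> dom (phi H)"
    and down: "pos (lam H) i p + weight G \<in> Fdown C \<union> ran (phi C) \<longleftrightarrow> pos (lam H) i p \<in> Fdown H \<union> ran (phi H)"
    if "p \<in> {1..lam H ! (i - 1)}" for p
    unfolding Fup_C Fdown_C dom_C ran_C Un_iff Diff_iff shift using *[OF that] G as bs by blast+
  show ?thesis
    unfolding local_diagram_def lam pos using up down by auto
qed

lemma atoms_C:
  "atoms C = atoms G \<union> relabel (\<lambda>k. k + nverts G) (atoms H) \<union>
     {Edge i p (j + nverts G) q | i p j q. (i, p) \<in> slots (lam G) \<and> (j, q) \<in> slots (lam H) \<and>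
        (pos (lam G) i p, pos (lam H) j q) \<in> set (zip as bs)}" (is "_ = ?R")
proof -
  have "Vertex i V \<in> atoms C \<longleftrightarrow> Vertex i V \<in> ?R" for i V
  proof -
    have "Vertex i V \<in> atoms C \<longleftrightarrow> (i \<in> {1..nverts G} \<and> V = local_diagram C i) \<or>
        (\<exists>k\<in>{1..nverts H}. i = k + nverts G \<and> V = local_diagram C i)"
    proof -
      have "i \<in> {1..nverts C} \<longleftrightarrow> i \<in> {1..nverts G} \<or> (\<exists>k\<in>{1..nverts H}. i = k + nverts G)"
        unfolding nverts_C Bex_def atLeastAtMost_iff by presburger
      then show ?thesis unfolding Vertex_atoms by blast
    qed
    also have "\<dots> \<longleftrightarrow> (i \<in> {1..nverts G} \<and> V = local_diagram G i) \<or>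
        (\<exists>k\<in>{1..nverts H}. i = k + nverts G \<and> V = local_diagram H k)"
      using local_diagram_left local_diagram_right by metis
    also have "\<dots> \<longleftrightarrow> Vertex i V \<in> ?R"
      by (auto simp: Vertex_atoms Vertex_relabel)
    finally show ?thesis .
  qed
  moreover have "Edge i p j q \<in> atoms C \<longleftrightarrow> Edge i p j q \<in> ?R" for i p j q
  proof
    assume "Edge i p j q \<in> atoms C"
    then have s: "(i, p) \<in> slots (lam G @ lam H)" "(j, q) \<in> slots (lam G @ lam H)"
      and e: "phi C (pos (lam G @ lam H) i p) = Some (pos (lam G @ lam H) j q)"
      by (simp_all add: Edge_atoms lam_C)
    have left: "pos (lam G @ lam H) k r = pos (lam G) k r" "pos (lam G) k r \<in> {1..weight G}"
      if "(k, r) \<in> slots (lam G)" for k r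
      using that pos_range[OF that] pos_append_left[of k "lam G" "lam H" r] by (auto simp: slots_def weight_def)
    have right: "pos (lam G @ lam H) (k + nverts G) r = pos (lam H) k r + weight G"
      "pos (lam H) k r \<in> {1..weight H}"
      if "(k, r) \<in> slots (lam H)" for k r
      using that pos_range[OF that] pos_append_right[of k "lam G" "lam H" r]
      by (auto simp: slots_def weight_def nverts_def)
    consider (ll) "(i, p) \<in> slots (lam G)" "(j, q) \<in> slots (lam G)"
      | (lr) k where "(i, p) \<in> slots (lam G)" "(k, q) \<in> slots (lam H)" "j = k + nverts G"
      | (rl) k where "(k, p) \<in> slots (lam H)" "i = k + nverts G" "(j, q) \<in> slots (lam G)"
      | (rr) k l where "(k, p) \<in> slots (lam H)" "i = k + nverts G" "(l, q) \<in> slots (lam H)" "j = l + nverts G"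
      using s unfolding slots_append nverts_def by auto
    then show "Edge i p j q \<in> ?R"
    proof cases
      case ll
      with e have "phi G (pos (lam G) i p) = Some (pos (lam G) j q)"
        unfolding phi_C left(1)[OF ll(1)] left(1)[OF ll(2)]
        using left(2)[OF ll(1)] left(2)[OF ll(2)] bounds_H zip_bounds(5) by fastforce
      with ll show ?thesis by (simp add: Edge_atoms)
    next
      case lr
      with e have "(pos (lam G) i p, pos (lam H) k q) \<in> set (zip as bs)"
        unfolding phi_C left(1)[OF lr(1)] lr(3) right(1)[OF lr(2)]
        using left(2)[OF lr(1)] right(2)[OF lr(2)] bounds_H bounds_G by fastforce
      with lr show ?thesis by blast
    next
      case rl
      \<comment> \<open>Such an edge would start above \<open>weight G\<close> and end at or below
        it; none of the three kinds in \<open>phi_C\<close> does this.\<close>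
      with e have False
        unfolding phi_C left(1)[OF rl(3)] rl(2) right(1)[OF rl(1)]
        using left(2)[OF rl(3)] right(2)[OF rl(1)] bounds_H bounds_G zip_bounds(2) by fastforce
      then show ?thesis ..
    next
      case rr
      with e have "phi H (pos (lam H) k p) = Some (pos (lam H) l q)"
        unfolding phi_C rr(2,4) right(1)[OF rr(1)] right(1)[OF rr(3)]
        using right(2)[OF rr(1)] right(2)[OF rr(3)] bounds_G zip_bounds(2) by fastforce
      with rr have "Edge k p l q \<in> atoms H" by (simp add: Edge_atoms)
      with rr show ?thesis by (auto simp: Edge_relabel)
    qed
  next
    have shift: "(k + nverts G, r) \<in> slots (lam C)" "pos (lam C) (k + nverts G) r = pos (lam H) k r + weight G"
      if "(k, r) \<in> slots (lam H)" for k r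
    proof -
      show "(k + nverts G, r) \<in> slots (lam C)" unfolding lam_C slots_append nverts_def using that by force
      show "pos (lam C) (k + nverts G) r = pos (lam H) k r + weight G"
        unfolding lam_C nverts_def weight_def using that by (intro pos_append_right) (simp add: slots_def)
    qed
    have keep: "(k, r) \<in> slots (lam C)" "pos (lam C) k r = pos (lam G) k r" if "(k, r) \<in> slots (lam G)" for k r
    proof -
      show "(k, r) \<in> slots (lam C)" unfolding lam_C slots_append using that by blast
      show "pos (lam C) k r = pos (lam G) k r"
        unfolding lam_C using that by (intro pos_append_left) (simp add: slots_def)
    qed
    assume "Edge i p j q \<in> ?R"
    then consider "Edge i p j q \<in> atoms G" | "Edge i p j q \<in> relabel (\<lambda>k. k + nverts G) (atoms H)"
      | k where "(i, p) \<in> slots (lam G)" "j = k + nverts G" "(k, q) \<in> slots (lam H)"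
        "(pos (lam G) i p, pos (lam H) k q) \<in> set (zip as bs)" by auto
    then show "Edge i p j q \<in> atoms C"
    proof cases
      case 1
      then show ?thesis by (simp add: Edge_atoms keep phi_C)
    next
      case 2
      then obtain k l where "i = k + nverts G" "j = l + nverts G" "Edge k p l q \<in> atoms H"
        unfolding Edge_relabel by blast
      then show ?thesis by (auto simp: Edge_atoms shift phi_C)
    next
      case 3
      then show ?thesis by (simp add: Edge_atoms shift keep phi_C)
    qed
  qed
  ultimately have "x \<in> atoms C \<longleftrightarrow> x \<in> ?R" for x by (cases x) simp_all
  then show ?thesis by blast
qed

end

section \<open>Permutations of the vertices\<close>

lemma concat_nth_block:
  "i < length xss \<Longrightarrow> p < length (xss ! i) \<Longrightarrow>
    concat xss ! (sum_list (map length (take i xss)) + p) = xss ! i ! p"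
proof (induction xss arbitrary: i)
  case (Cons xs xss)
  then show ?case by (cases i) (simp_all add: nth_append)
qed simp

text \<open>A sorted list without repetitions is determined by its set, so only the members have to
  be compared.\<close>

lemma filter_block:
  assumes "j \<in> {1..length ls}"
  shows "filter (\<lambda>k. block ls k = j) [1..<sum_list ls + 1] = map (pos ls j) [1..<ls ! (j - 1) + 1]"
proof (rule sorted_distinct_set_unique)
  show "sorted (map (pos ls j) [1..<ls ! (j - 1) + 1])"
    unfolding sorted_map by (rule sorted_wrt_mono_rel[OF _ sorted_upt]) (simp add: pos_def)
  show "distinct (map (pos ls j) [1..<ls ! (j - 1) + 1])"
    by (simp add: distinct_map inj_on_def pos_def)
  show "set (filter (\<lambda>k. block ls k = j) [1..<sum_list ls + 1]) = set (map (pos ls j) [1..<ls ! (j - 1) + 1])"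
  proof (intro equalityI subsetI)
    fix k assume "k \<in> set (filter (\<lambda>k. block ls k = j) [1..<sum_list ls + 1])"
    then have k: "k \<in> {1..sum_list ls}" "block ls k = j" by auto
    obtain i p where ip: "(i, p) \<in> slots ls" "k = pos ls i p" by (rule pos_surj[OF k(1)])
    then have "i = j" using block_pos k(2) by simp
    with ip show "k \<in> set (map (pos ls j) [1..<ls ! (j - 1) + 1])"
      by (auto simp: slots_def simp del: upt_Suc)
  next
    fix k assume "k \<in> set (map (pos ls j) [1..<ls ! (j - 1) + 1])"
    then obtain p where "k = pos ls j p" "(j, p) \<in> slots ls" using assms by (auto simp: slots_def)
    then show "k \<in> set (filter (\<lambda>k. block ls k = j) [1..<sum_list ls + 1])"
      using pos_range[of j p ls] block_pos[of j p ls] by (simp del: upt_Suc)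
  qed
qed (simp_all add: sorted_wrt_filter del: upt_Suc)

locale vertex_permutation =
  fixes G :: bdiagram and \<sigma> :: "nat \<Rightarrow> nat"
  assumes wf: "wf_bdiagram G" and perm: "\<sigma> permutes {1..nverts G}"
begin

abbreviation "H \<equiv> permute_vertices G \<sigma>"
abbreviation "\<tau> \<equiv> block_perm \<sigma> (lam G)"
abbreviation "\<sigma>' \<equiv> inv_into UNIV \<sigma>"
abbreviation "\<tau>' \<equiv> inv_into UNIV \<tau>"

lemma lam_H: "lam H = map (\<lambda>i. lam G ! (\<sigma> i - 1)) [1..<nverts G + 1]"
  by (simp add: permute_vertices_def Let_def)

lemma nverts_H: "nverts H = nverts G"
  unfolding nverts_def[of H] lam_H by simp

lemma sigma_range: "i \<in> {1..nverts G} \<Longrightarrow> \<sigma> i \<in> {1..nverts G}"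
  "i \<in> {1..nverts G} \<Longrightarrow> \<sigma>' i \<in> {1..nverts G}"
  using permutes_in_image[OF perm] permutes_in_image[OF permutes_inv[OF perm]] by simp_all

lemma lam_H_nth: "i \<in> {1..nverts G} \<Longrightarrow> lam H ! (i - 1) = lam G ! (\<sigma> i - 1)"
  unfolding lam_H by (auto simp del: upt_Suc)

lemma slots_H: "(i, p) \<in> slots (lam H) \<longleftrightarrow> (\<sigma> i, p) \<in> slots (lam G)"
proof -
  have "i \<in> {1..nverts G} \<longleftrightarrow> \<sigma> i \<in> {1..nverts G}" using permutes_in_image[OF perm] by simp
  then show ?thesis
    using lam_H_nth[of i] nverts_H unfolding slots_def nverts_def by auto
qed

lemma slots_H': "(j, q) \<in> slots (lam G) \<longleftrightarrow> (\<sigma>' j, q) \<in> slots (lam H)"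
  unfolding slots_H by (simp add: permutes_inverses[OF perm])

lemma sum_lam_H: "sum_list (lam H) = sum_list (lam G)"
proof -
  have "bij_betw (\<lambda>(i, p). (\<sigma> i, p)) (slots (lam H)) (slots (lam G))"
    by (rule bij_betw_byWitness[where f' = "\<lambda>(i, p). (\<sigma>' i, p)"])
      (auto simp: slots_H[symmetric] slots_H'[symmetric] permutes_inverses[OF perm])
  then have "card (slots (lam H)) = card (slots (lam G))" by (rule bij_betw_same_card)
  then show ?thesis
    using bij_betw_same_card[OF bij_betw_pos[of "lam H"]] bij_betw_same_card[OF bij_betw_pos[of "lam G"]]
    by simp
qed

text \<open>The word of \<open>\<sigma>[\<lambda>]\<close> is a concatenation whose
  \<open>i\<close>th factor lists the half-edges of the old vertex \<open>\<sigma> i\<close>. The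
  lengths of the factors are the entries of \<open>lam H\<close>, so an address in \<open>H\<close>
  also locates an entry of the word, and the global renumbering disappears.\<close>

lemma tau_pos:
  assumes "(i, p) \<in> slots (lam H)"
  shows "\<tau> (pos (lam H) i p) = pos (lam G) (\<sigma> i) p"
proof -
  let ?blocks = "map (\<lambda>i. map (pos (lam G) (\<sigma> i)) [1..<lam G ! (\<sigma> i - 1) + 1]) [1..<nverts G + 1]"
  have "filter (\<lambda>k. block (lam G) k = \<sigma> i) [1..<sum_list (lam G) + 1] =
      map (pos (lam G) (\<sigma> i)) [1..<lam G ! (\<sigma> i - 1) + 1]" if "i \<in> {1..nverts G}" for i
    using sigma_range(1)[OF that] unfolding nverts_def by (rule filter_block)
  then have word: "block_perm_word \<sigma> (lam G) = concat ?blocks"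
    unfolding block_perm_word_def nverts_def[symmetric]
    by (intro arg_cong[of _ _ concat] map_cong refl) (auto simp del: upt_Suc)
  have i: "i \<in> {1..nverts G}" and p: "p \<in> {1..lam H ! (i - 1)}"
    using assms nverts_H by (simp_all add: slots_def nverts_def)
  have lengths: "map length ?blocks = lam H" unfolding lam_H by (simp del: upt_Suc)
  have nth: "?blocks ! (i - 1) = map (pos (lam G) (\<sigma> i)) [1..<lam H ! (i - 1) + 1]"
    using i unfolding lam_H_nth[OF i] by (auto simp del: upt_Suc)
  \<comment> \<open>Lists are indexed from 0, while vertices, half-edges and global indices start at
    1; hence the decrements.\<close>
  have "sum_list (map length (take (i - 1) ?blocks)) + (p - 1) = pos (lam H) i p - 1"
    using p lengths by (simp add: pos_def take_map[symmetric] del: upt_Suc)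
  moreover have "concat ?blocks ! (sum_list (map length (take (i - 1) ?blocks)) + (p - 1)) =
      ?blocks ! (i - 1) ! (p - 1)"
  proof (rule concat_nth_block)
    show "i - 1 < length ?blocks" using i by auto
    show "p - 1 < length (?blocks ! (i - 1))" using p unfolding nth by (auto simp del: upt_Suc)
  qed
  moreover have "?blocks ! (i - 1) ! (p - 1) = pos (lam G) (\<sigma> i) p"
    using p unfolding nth by (auto simp del: upt_Suc)
  ultimately have "block_perm_word \<sigma> (lam G) ! (pos (lam H) i p - 1) = pos (lam G) (\<sigma> i) p"
    unfolding word by simp
  then show ?thesis using pos_range[OF assms] sum_lam_H by (simp add: block_perm_def)
qed

lemma tau_permutes: "\<tau> permutes {1..weight G}"
proof (rule bij_imp_permutes)
  have image: "\<tau> ` {1..weight G} = {1..weight G}"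
  proof (intro equalityI subsetI)
    fix k assume "k \<in> \<tau> ` {1..weight G}"
    then obtain l where l: "l \<in> {1..sum_list (lam H)}" "k = \<tau> l" by (auto simp: weight_def sum_lam_H)
    obtain i p where ip: "(i, p) \<in> slots (lam H)" "l = pos (lam H) i p" by (rule pos_surj[OF l(1)])
    then show "k \<in> {1..weight G}"
      using tau_pos[OF ip(1)] pos_range[of "\<sigma> i" p "lam G"] slots_H[of i p] l(2) by (simp add: weight_def)
  next
    fix k assume "k \<in> {1..weight G}"
    then have k: "k \<in> {1..sum_list (lam G)}" by (simp add: weight_def)
    obtain j q where jq: "(j, q) \<in> slots (lam G)" "k = pos (lam G) j q" by (rule pos_surj[OF k])
    then have "k = \<tau> (pos (lam H) (\<sigma>' j) q)"
      using tau_pos[of "\<sigma>' j" q] slots_H'[of j q] by (simp add: permutes_inverses[OF perm])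
    moreover have "pos (lam H) (\<sigma>' j) q \<in> {1..weight G}"
      using pos_range[of "\<sigma>' j" q "lam H"] slots_H'[of j q] jq(1) by (simp add: weight_def sum_lam_H)
    ultimately show "k \<in> \<tau> ` {1..weight G}" by (rule image_eqI)
  qed
  \<comment> \<open>A map of a finite set onto itself is injective.\<close>
  then show "bij_betw \<tau> {1..weight G} {1..weight G}"
    by (simp add: bij_betw_def eq_card_imp_inj_on)
  show "\<tau> x = x" if "x \<notin> {1..weight G}" for x
    using that by (auto simp: block_perm_def weight_def)
qed

lemma phi_H: "phi H x = Some y \<longleftrightarrow> phi G (\<tau> x) = Some (\<tau> y)"
proof -
  have "\<tau>' z = y \<longleftrightarrow> z = \<tau> y" for z using permutes_inverses[OF tau_permutes] by metis
  then show ?thesis by (auto simp: permute_vertices_def Let_def)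
qed

lemma dom_H: "x \<in> dom (phi H) \<longleftrightarrow> \<tau> x \<in> dom (phi G)"
  by (auto simp: permute_vertices_def Let_def)

lemma ran_H: "y \<in> ran (phi H) \<longleftrightarrow> \<tau> y \<in> ran (phi G)"
proof
  assume "y \<in> ran (phi H)"
  then show "\<tau> y \<in> ran (phi G)" by (auto simp: ran_def phi_H)
next
  assume "\<tau> y \<in> ran (phi G)"
  then obtain z where "phi G z = Some (\<tau> y)" by (auto simp: ran_def)
  then have "phi H (\<tau>' z) = Some y" unfolding phi_H by (simp add: permutes_inverses[OF tau_permutes])
  then show "y \<in> ran (phi H)" by (auto simp: ran_def)
qed

lemma Fup_H: "x \<in> Fup H \<longleftrightarrow> \<tau> x \<in> Fup G" and Fdown_H: "x \<in> Fdown H \<longleftrightarrow> \<tau> x \<in> Fdown G"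
  by (simp_all add: permute_vertices_def Let_def)

lemma wf_H: "wf_bdiagram H"
proof -
  have "weight H = weight G" by (simp add: weight_def sum_lam_H)
  moreover have "x \<in> {1..weight G} \<longleftrightarrow> \<tau> x \<in> {1..weight G}" for x
    using permutes_in_image[OF tau_permutes] by simp
  ultimately show ?thesis
    using wf unfolding wf_bdiagram_def subset_iff Diff_iff dom_H ran_H Fup_H Fdown_H by metis
qed

lemma local_diagram_H:
  assumes "i \<in> {1..nverts G}"
  shows "local_diagram H i = local_diagram G (\<sigma> i)"
proof -
  have \<tau>: "\<tau> (pos (lam H) i p) = pos (lam G) (\<sigma> i) p" if "p \<in> {1..lam G ! (\<sigma> i - 1)}" for p
    using that assms nverts_H lam_H_nth[OF assms] by (intro tau_pos) (simp add: slots_def nverts_def)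
  show ?thesis
    unfolding local_diagram_def lam_H_nth[OF assms] Un_iff dom_H ran_H Fup_H Fdown_H
    using \<tau> by (simp cong: conj_cong)
qed

text \<open>Vertex \<open>i\<close> of \<open>H\<close> is vertex \<open>\<sigma> i\<close> of
  \<open>G\<close>, so the old label \<open>k\<close> becomes the new label
  \<open>\<sigma>' k\<close>; this is why the inverse appears.\<close>

lemma atoms_H: "atoms H = relabel \<sigma>' (atoms G)"
proof -
  have inv: "i = \<sigma>' k \<longleftrightarrow> k = \<sigma> i" for i k using permutes_inverses[OF perm] by metis
  have "Vertex i V \<in> atoms H \<longleftrightarrow> Vertex i V \<in> relabel \<sigma>' (atoms G)" for i V
  proof -
    have "i \<in> {1..nverts G} \<longleftrightarrow> \<sigma> i \<in> {1..nverts G}" using permutes_in_image[OF perm] by simp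
    then show ?thesis
      unfolding Vertex_relabel Vertex_atoms nverts_H inv using local_diagram_H[of i] by auto
  qed
  moreover have "Edge i p j q \<in> atoms H \<longleftrightarrow> Edge i p j q \<in> relabel \<sigma>' (atoms G)" for i p j q
  proof -
    have "Edge i p j q \<in> atoms H \<longleftrightarrow> Edge (\<sigma> i) p (\<sigma> j) q \<in> atoms G"
      unfolding Edge_atoms phi_H slots_H[symmetric] by (auto simp: tau_pos)
    then show ?thesis unfolding Edge_relabel inv by blast
  qed
  ultimately have "x \<in> atoms H \<longleftrightarrow> x \<in> relabel \<sigma>' (atoms G)" for x by (cases x) simp_all
  then show ?thesis by blast
qed

end

section \<open>Generated diagrams and the isomorphism\<close>

lemma set_zip_unique:
  assumes "length xs = length ys"
  shows "distinct xs \<Longrightarrow> (x, y) \<in> set (zip xs ys) \<Longrightarrow> (x, y') \<in> set (zip xs ys) \<Longrightarrow> y = y'"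
    and "distinct ys \<Longrightarrow> (x, y) \<in> set (zip xs ys) \<Longrightarrow> (x', y) \<in> set (zip xs ys) \<Longrightarrow> x = x'"
  using assms by (auto simp: set_zip nth_eq_iff_index_eq)

text \<open>An edge has to join two different blocks and there is only one. Hence no half-edge is
  used, and the local diagram at the single vertex is \<open>V\<close> itself.\<close>

lemma elementaryD:
  assumes "elementary V"
  shows "wf_bdiagram V" "nverts V = 1" "phi V = Map.empty" "atoms V = {Vertex 1 V}"
    "slots (lam V) = {1} \<times> {1..weight V}"
proof -
  have bd: "is_bdiagram V" and n: "nverts V = 1" using assms by (simp_all add: elementary_def)
  show wf: "wf_bdiagram V" using bd by (rule is_bdiagram_wf)
  show "nverts V = 1" by (rule n)
  obtain l where l: "lam V = [l]" using n by (auto simp: nverts_def length_Suc_conv)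
  have weight: "weight V = l" by (simp add: weight_def l)
  show slots: "slots (lam V) = {1} \<times> {1..weight V}" by (auto simp: slots_def l weight)
  show phi: "phi V = Map.empty"
  proof (rule ccontr)
    assume "phi V \<noteq> Map.empty"
    then obtain a b where ab: "phi V a = Some b" by (auto simp: fun_eq_iff)
    obtain i p j q where s: "(i, p) \<in> slots (lam V)" "(j, q) \<in> slots (lam V)"
      "a = pos (lam V) i p" "b = pos (lam V) j q" "Edge i p j q \<in> atoms V"
      by (rule Edge_of_phi[OF wf ab])
    have "block (lam V) a < block (lam V) b" using bd ab by (simp add: is_bdiagram_def)
    moreover have "block (lam V) a = 1" "block (lam V) b = 1"
      using s slots by (auto simp: block_pos)
    ultimately show False by simp
  qed
  have "local_diagram V 1 = V"
  proof (rule bdiagram.equality)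
    have sub: "Fup V \<subseteq> {1..l}" "Fdown V \<subseteq> {1..l}" using wf by (auto simp: wf_bdiagram_def weight)
    then show "Fup (local_diagram V 1) = Fup V" "Fdown (local_diagram V 1) = Fdown V"
      by (auto simp: local_diagram_def phi l pos_def)
  qed (simp_all add: local_diagram_def phi l)
  then show "atoms V = {Vertex 1 V}"
    by (auto simp: atoms_def n phi)
qed

text \<open>In a single block the global index of a half-edge is its position, so the entries of
  \<open>bs\<close> serve directly as positions at the new vertex.\<close>

lemma atoms_compose_elementary:
  assumes "composition G V as bs" "elementary V"
  shows "atoms (compose_along G V as bs) = atoms G \<union> {Vertex (Suc (nverts G)) V} \<union>
     {Edge i p (Suc (nverts G)) q | i p q. (i, p) \<in> slots (lam G) \<and> (pos (lam G) i p, q) \<in> set (zip as bs)}"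
proof -
  interpret composition G V as bs by fact
  note V = elementaryD[OF assms(2)]
  have "(j, q) \<in> slots (lam V) \<and> (pos (lam G) i p, pos (lam V) j q) \<in> set (zip as bs) \<longleftrightarrow>
      j = 1 \<and> (pos (lam G) i p, q) \<in> set (zip as bs)" for i p j q
    using zip_bounds(5)[of "pos (lam G) i p" q] by (auto simp: V(5) pos_def)
  then show ?thesis
    unfolding atoms_C by (auto simp: V(4) relabel_def)
qed

text \<open>All new edges end at the new, largest vertex, which settles their direction and
  separates their ends from old ones. Their starts are free in \<open>G\<close>, so no old edge
  begins there; distinctness of \<open>as\<close> and \<open>bs\<close> excludes clashes among the
  new edges.\<close>

lemma diagram_on_compose_elementary:
  assumes comp: "composition G V as bs" and el: "elementary V" and V: "V \<in> D"
    and d: "diagram_on D {1..nverts G} (atoms G)"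
  shows "diagram_on D {1..Suc (nverts G)} (atoms (compose_along G V as bs))"
proof -
  interpret composition G V as bs by fact
  let ?n = "nverts G" and ?A = "atoms C"
  have vertex: "Vertex i W \<in> ?A \<longleftrightarrow> Vertex i W \<in> atoms G \<or> i = Suc ?n \<and> W = V" for i W
    unfolding atoms_compose_elementary[OF comp el] by auto
  have edge: "Edge i p j q \<in> ?A \<longleftrightarrow> Edge i p j q \<in> atoms G \<or>
      j = Suc ?n \<and> (i, p) \<in> slots (lam G) \<and> (pos (lam G) i p, q) \<in> set (zip as bs)" for i p j q
    unfolding atoms_compose_elementary[OF comp el] by auto
  have old: "i \<le> ?n" if "Vertex i W \<in> atoms G" for i W using diagram_onD(1)[OF d that] by simp
  have old_edge: "i \<le> ?n" "j \<le> ?n" if "Edge i p j q \<in> atoms G" for i p j q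
    using diagram_on_support[OF d that] by auto
  have slot: "i \<in> {1..?n}" if "(i, p) \<in> slots (lam G)" for i p
    using that by (simp add: slots_def nverts_def)
  have new: "Edge i p j' q' \<notin> atoms G" if "(pos (lam G) i p, q) \<in> set (zip as bs)" for i p q j' q'
    using zip_bounds(3)[OF that] by (auto simp: Edge_atoms dom_def)
  show ?thesis
  proof (rule diagram_onI)
    show "i \<in> {1..Suc ?n} \<and> W \<in> D" if "Vertex i W \<in> ?A" for i W
      using that V diagram_onD(1,2)[OF d, of i W] unfolding vertex by auto
    show "\<exists>W. Vertex i W \<in> ?A" if "i \<in> {1..Suc ?n}" for i
      using that diagram_onD(3)[OF d, of i] unfolding vertex by (cases "i = Suc ?n") auto
    show "W = W'" if "Vertex i W \<in> ?A" "Vertex i W' \<in> ?A" for i W W'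
      using that diagram_onD(4)[OF d, of i W W'] old[of i W] old[of i W'] unfolding vertex by auto
    show "i < j" if "Edge i p j q \<in> ?A" for i p j q
      using that diagram_onD(5)[OF d, of i p j q] slot[of i p] unfolding edge by auto
    show "\<exists>W. Vertex i W \<in> ?A \<and> p \<in> Fup W" if "Edge i p j q \<in> ?A" for i p j q
    proof (cases "Edge i p j q \<in> atoms G")
      case True
      then show ?thesis using diagram_onD(6)[OF d True] unfolding vertex by blast
    next
      case False
      then have s: "(i, p) \<in> slots (lam G)" "(pos (lam G) i p, q) \<in> set (zip as bs)"
        using that unfolding edge by auto
      have "p \<in> Fup (local_diagram G i)"
        using zip_bounds(1)[OF s(2)] s(1) by (simp add: local_diagram_def slots_def)
      moreover have "Vertex i (local_diagram G i) \<in> atoms G" using slot[OF s(1)] by (simp add: Vertex_atoms)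
      ultimately show ?thesis unfolding vertex by blast
    qed
    show "\<exists>W. Vertex j W \<in> ?A \<and> q \<in> Fdown W" if "Edge i p j q \<in> ?A" for i p j q
    proof (cases "Edge i p j q \<in> atoms G")
      case True
      then show ?thesis using diagram_onD(7)[OF d True] unfolding vertex by blast
    next
      case False
      then have "j = Suc ?n" "(pos (lam G) i p, q) \<in> set (zip as bs)" using that unfolding edge by auto
      then show ?thesis using zip_bounds(4) unfolding vertex by blast
    qed
    show "j = j' \<and> q = q'" if "Edge i p j q \<in> ?A" "Edge i p j' q' \<in> ?A" for i p j q j' q'
      using that diagram_onD(8)[OF d, of i p j q j' q'] new[of i p q j' q'] new[of i p q' j q]
        set_zip_unique(1)[OF len dist(1), of "pos (lam G) i p" q q'] unfolding edge by blast
    show "i = i' \<and> p = p'" if "Edge i p j q \<in> ?A" "Edge i' p' j q \<in> ?A" for i p j q i' p'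
    proof (cases "j = Suc ?n")
      case True
      then have "Edge i p j q \<notin> atoms G" "Edge i' p' j q \<notin> atoms G"
        using old_edge(2)[of i p j q] old_edge(2)[of i' p' j q] by auto
      then have s: "(i, p) \<in> slots (lam G)" "(pos (lam G) i p, q) \<in> set (zip as bs)"
        "(i', p') \<in> slots (lam G)" "(pos (lam G) i' p', q) \<in> set (zip as bs)"
        using that unfolding edge by auto
      have "pos (lam G) i p = pos (lam G) i' p'" using set_zip_unique(2)[OF len dist(2) s(2,4)] .
      then show ?thesis using pos_inj[OF s(1,3)] by simp
    next
      case False
      then show ?thesis using that diagram_onD(9)[OF d, of i p j q i' p'] unfolding edge by auto
    qed
  qed
qed

lemma wf_empty_bdiagram: "wf_bdiagram empty_bdiagram"
  by (simp add: wf_bdiagram_def empty_bdiagram_def)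

lemma atoms_empty_bdiagram: "atoms empty_bdiagram = {}"
  by (simp add: atoms_def nverts_def empty_bdiagram_def)

lemma compositionI:
  assumes "wf_bdiagram G" "elementary V" "length as = length bs" "distinct as" "distinct bs"
    "set as \<subseteq> Fup G" "set bs \<subseteq> Fdown V"
  shows "composition G V as bs"
  using assms elementaryD(1)[OF assms(2)] by unfold_locales

section \<open>Generated diagrams and sets of atoms on initial intervals\<close>

context
  fixes D :: "bdiagram set"
  assumes elementary: "\<forall>V \<in> D. elementary V"
begin

lemma generated_wf_diagram:
  assumes "G \<in> generated D"
  shows "wf_bdiagram G \<and> diagram_on D {1..nverts G} (atoms G)"
proof -
  let ?P = "\<lambda>G. wf_bdiagram G \<and> diagram_on D {1..nverts G} (atoms G)"
  have "\<forall>G \<in> foldl (\<lambda>\<G> W. compositions_set \<G> {W}) {V} Vs. ?P G" if "set (V # Vs) \<subseteq> D" for V Vs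
    using that
  \<comment> \<open>\<open>foldl\<close> brackets to the left, so dropping the last list entry
    removes the vertex that was composed last.\<close>
  proof (induction Vs rule: rev_induct)
    case Nil
    then have "V \<in> D" "elementary V" using elementary by auto
    moreover from this have "diagram_on D {1..1} {Vertex 1 V}" by (intro diagram_onI) auto
    ultimately show ?case using elementaryD[of V] by simp
  next
    case (snoc W Vs)
    then have W: "W \<in> D" "elementary W" using elementary by auto
    show ?case
    proof
      fix C assume "C \<in> foldl (\<lambda>\<G> W. compositions_set \<G> {W}) {V} (Vs @ [W])"
      then obtain G where G: "G \<in> foldl (\<lambda>\<G> W. compositions_set \<G> {W}) {V} Vs" "C \<in> compositions G W"
        by (auto simp: compositions_set_def)
      then have PG: "?P G" using snoc by simp
      from G(2) obtain as bs where c: "C = compose_along G W as bs" "length as = length bs"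
        "sorted_wrt (<) as" "set as \<subseteq> Fup G" "distinct bs" "set bs \<subseteq> Fdown W"
        by (auto simp: compositions_def)
      then have comp: "composition G W as bs"
        using PG W(2) strict_sorted_iff[of as] by (intro compositionI) auto
      have "nverts C = Suc (nverts G)"
        using composition.nverts_C[OF comp] elementaryD(2)[OF W(2)] c(1) by simp
      then show "?P C"
        using composition.wf_C[OF comp] diagram_on_compose_elementary[OF comp W(2,1)] PG c(1) by simp
    qed
  qed
  moreover have "?P empty_bdiagram"
  proof -
    have "nverts empty_bdiagram = 0" by (simp add: nverts_def empty_bdiagram_def)
    moreover have "diagram_on D {} {}" by (intro diagram_onI) simp_all
    ultimately show ?thesis using wf_empty_bdiagram by (simp add: atoms_empty_bdiagram)
  qed
  ultimately show ?thesis using assms unfolding generated_def by blast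
qed

text \<open>\<open>generated\<close> adjoins the empty diagram separately from the products of one
  or more factors. Composing the empty diagram with \<open>V\<close> must therefore be recognised as
  \<open>V\<close>, a product with one factor.\<close>

lemma generated_compositions:
  assumes "G \<in> generated D" "V \<in> D" "C \<in> compositions G V"
  shows "C \<in> generated D"
proof (cases "G = empty_bdiagram")
  case True
  have "phi V = Map.empty" using elementaryD(3) elementary assms(2) by blast
  moreover have "C = compose_along empty_bdiagram V [] []"
    using assms(3) True by (auto simp: compositions_def empty_bdiagram_def)
  ultimately have "C = V"
    by (intro bdiagram.equality)
      (simp_all add: compose_along_def empty_bdiagram_def weight_def shift_map_def fun_eq_iff)
  then have "C \<in> foldl (\<lambda>\<G> W. compositions_set \<G> {W}) {V} []" "set [V] \<subseteq> D" using assms(2) by simp_all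
  then show ?thesis unfolding generated_def by blast
next
  case False
  then obtain W Vs where W: "set (W # Vs) \<subseteq> D" "G \<in> foldl (\<lambda>\<G> W. compositions_set \<G> {W}) {W} Vs"
    using assms(1) unfolding generated_def by auto
  then have "C \<in> foldl (\<lambda>\<G> W. compositions_set \<G> {W}) {W} (Vs @ [V])"
    using assms(3) by (auto simp: compositions_set_def)
  moreover have "set (W # (Vs @ [V])) \<subseteq> D" using W(1) assms(2) by simp
  ultimately show ?thesis unfolding generated_def by blast
qed

text \<open>Since edges go upwards, the last vertex has only incoming edges. Removing it leaves a
  set of atoms on \<open>{1..n}\<close>, and the removed edges are exactly the data of one
  composition with the diagram at that vertex.\<close>

lemma generated_surj:
  "diagram_on D {1..n} A \<Longrightarrow> \<exists>G \<in> generated D. atoms G = A"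
proof (induction n arbitrary: A)
  case 0
  have "A = {}" using diagram_on_support[OF 0] set_atom_nonempty by fastforce
  then show ?case using atoms_empty_bdiagram by (auto simp: generated_def)
next
  case (Suc n)
  note d = Suc.prems
  let ?A = "restrict_atoms {1..n} A"
  have dA: "diagram_on D {1..n} ?A" using d by (rule diagram_on_restrict_atoms) auto
  then obtain G where G: "G \<in> generated D" "atoms G = ?A" using Suc.IH by blast
  have wf: "wf_bdiagram G" using generated_wf_diagram[OF G(1)] by simp
  have n: "nverts G = n" using diagram_on_nverts[of D n G] dA G(2) by simp
  obtain V where V: "Vertex (Suc n) V \<in> A" using diagram_onD(3)[OF d, of "Suc n"] by auto
  then have VD: "V \<in> D" "elementary V" using diagram_onD(2)[OF d] elementary by blast+
  \<comment> \<open>The global indices in \<open>G\<close> of the half-edges joined to the last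
    vertex; listed increasingly they become \<open>as\<close>.\<close>
  define X where "X = {pos (lam G) i p | i p. \<exists>q. (i, p) \<in> slots (lam G) \<and> Edge i p (Suc n) q \<in> A}"
  have edge: "(i, p) \<in> slots (lam G)" "pos (lam G) i p \<in> Fup G" "q \<in> Fdown V"
    if e: "Edge i p (Suc n) q \<in> A" for i p q
  proof -
    obtain W where W: "Vertex i W \<in> A" "p \<in> Fup W" using diagram_onD(6)[OF d e] by blast
    have "i < Suc n" using diagram_onD(5)[OF d e] .
    then have "Vertex i W \<in> atoms G"
      using W(1) diagram_onD(1)[OF d W(1)] by (simp add: G(2) restrict_atoms_def)
    then have i: "i \<in> {1..n}" "W = local_diagram G i" by (simp_all add: Vertex_atoms n)
    then have p: "p \<in> {1..lam G ! (i - 1)}" "pos (lam G) i p \<in> Fup G \<union> dom (phi G)"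
      using W(2) by (simp_all add: local_diagram_def)
    then show "(i, p) \<in> slots (lam G)" using i(1) n by (simp add: slots_def nverts_def)
    \<comment> \<open>If the half-edge were used in \<open>G\<close>, two edges of \<open>A\<close>
      would start there, one ending in \<open>{1..n}\<close> and one at the last vertex.\<close>
    have False if "pos (lam G) i p \<in> dom (phi G)"
    proof -
      from that obtain b where b: "phi G (pos (lam G) i p) = Some b" by blast
      obtain k r j q' where s: "(k, r) \<in> slots (lam G)" "(j, q') \<in> slots (lam G)"
        "pos (lam G) i p = pos (lam G) k r" "b = pos (lam G) j q'" "Edge k r j q' \<in> atoms G"
        by (rule Edge_of_phi[OF wf b])
      have "k = i" "r = p" using pos_inj[OF s(1) \<open>(i, p) \<in> slots (lam G)\<close>] s(3) by simp_all
      then have "Edge i p j q' \<in> A" "j \<in> {1..n}" using s(5) by (auto simp: G(2) restrict_atoms_def)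
      then show False using diagram_onD(8)[OF d e, of j q'] by auto
    qed
    then show "pos (lam G) i p \<in> Fup G" using p(2) by blast
    obtain W' where "Vertex (Suc n) W' \<in> A" "q \<in> Fdown W'" using diagram_onD(7)[OF d e] by blast
    then show "q \<in> Fdown V" using diagram_onD(4)[OF d V] by blast
  qed
  have X: "X \<subseteq> Fup G" unfolding X_def using edge(2) by blast
  have "Fup G \<subseteq> {1..weight G}" using wf by (auto simp: wf_bdiagram_def)
  then have finX: "finite X" using X by (meson finite_atLeastAtMost finite_subset)
  have "\<forall>a \<in> X. \<exists>q. \<exists>i p. (i, p) \<in> slots (lam G) \<and> a = pos (lam G) i p \<and> Edge i p (Suc n) q \<in> A"
    unfolding X_def by blast
  \<comment> \<open>\<open>h\<close> gives the position at the last vertex to which an upper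
    half-edge is joined. It is unique because a half-edge starts at most one edge, and
    \<open>h\<close> is injective because a half-edge ends at most one.\<close>
  then obtain h where h: "\<And>a. a \<in> X \<Longrightarrow>
      \<exists>i p. (i, p) \<in> slots (lam G) \<and> a = pos (lam G) i p \<and> Edge i p (Suc n) (h a) \<in> A" by metis
  have h_iff: "pos (lam G) i p \<in> X \<and> q = h (pos (lam G) i p) \<longleftrightarrow> Edge i p (Suc n) q \<in> A"
    if ip: "(i, p) \<in> slots (lam G)" for i p q
  proof
    assume *: "pos (lam G) i p \<in> X \<and> q = h (pos (lam G) i p)"
    then obtain k r where "(k, r) \<in> slots (lam G)" "pos (lam G) i p = pos (lam G) k r"
      "Edge k r (Suc n) q \<in> A" using h by blast
    then show "Edge i p (Suc n) q \<in> A" using pos_inj[OF ip, of k r] by simp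
  next
    assume e: "Edge i p (Suc n) q \<in> A"
    then have X: "pos (lam G) i p \<in> X" unfolding X_def using ip by blast
    then obtain k r where "(k, r) \<in> slots (lam G)" "pos (lam G) i p = pos (lam G) k r"
      "Edge k r (Suc n) (h (pos (lam G) i p)) \<in> A" using h by blast
    then have "Edge i p (Suc n) (h (pos (lam G) i p)) \<in> A" using pos_inj[OF ip, of k r] by simp
    then show "pos (lam G) i p \<in> X \<and> q = h (pos (lam G) i p)"
      using X diagram_onD(8)[OF d e, of "Suc n" "h (pos (lam G) i p)"] by simp
  qed
  define as where "as = sorted_list_of_set X"
  define bs where "bs = map h as"
  have as: "set as = X" "distinct as" "sorted_wrt (<) as" using finX by (simp_all add: as_def)
  have len: "length as = length bs" by (simp add: bs_def)
  have inj: "inj_on h X"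
  proof (rule inj_onI)
    fix a b assume ab: "a \<in> X" "b \<in> X" "h a = h b"
    obtain i p where ip: "a = pos (lam G) i p" "Edge i p (Suc n) (h a) \<in> A" using h[OF ab(1)] by blast
    obtain j q where jq: "b = pos (lam G) j q" "Edge j q (Suc n) (h b) \<in> A" using h[OF ab(2)] by blast
    have "i = j \<and> p = q" using diagram_onD(9)[OF d ip(2)] jq(2) ab(3) by simp
    with ip jq show "a = b" by simp
  qed
  have bs: "distinct bs" "set bs \<subseteq> Fdown V"
  proof -
    show "distinct bs" using as inj by (simp add: bs_def distinct_map)
    show "set bs \<subseteq> Fdown V"
    proof
      fix b assume "b \<in> set bs"
      then obtain a where a: "a \<in> X" "b = h a" using as by (auto simp: bs_def)
      obtain i p where "Edge i p (Suc n) (h a) \<in> A" using h[OF a(1)] by blast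
      then show "b \<in> Fdown V" unfolding a(2) by (rule edge(3))
    qed
  qed
  have asF: "set as \<subseteq> Fup G" using as(1) X by simp
  have comp: "composition G V as bs" using wf VD(2) len as(2) bs(1) asF bs(2) by (rule compositionI)
  have zip: "(a, b) \<in> set (zip as bs) \<longleftrightarrow> a \<in> X \<and> b = h a" for a b
    unfolding bs_def zip_map2 zip_same_conv_map using as(1) by auto
  let ?C = "compose_along G V as bs"
  have mem: "x \<in> atoms ?C \<longleftrightarrow> x \<in> atoms G \<or> x = Vertex (Suc n) V \<or>
      (\<exists>i p q. x = Edge i p (Suc n) q \<and> (i, p) \<in> slots (lam G) \<and> (pos (lam G) i p, q) \<in> set (zip as bs))" for x
    unfolding atoms_compose_elementary[OF comp VD(2)] n by blast
  have "x \<in> atoms ?C \<longleftrightarrow> x \<in> A" for x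
  proof (cases x)
    case (Vertex i W)
    have "i = Suc n \<and> W = V \<longleftrightarrow> i = Suc n \<and> Vertex i W \<in> A"
      using V diagram_onD(4)[OF d V, of W] by blast
    moreover have "Vertex i W \<in> atoms G \<longleftrightarrow> i \<noteq> Suc n \<and> Vertex i W \<in> A"
      using diagram_onD(1)[OF d, of i W] by (auto simp: G(2) restrict_atoms_def)
    ultimately show ?thesis unfolding mem Vertex by blast
  next
    case (Edge i p j q)
    have "j = Suc n \<and> (i, p) \<in> slots (lam G) \<and> (pos (lam G) i p, q) \<in> set (zip as bs) \<longleftrightarrow>
        j = Suc n \<and> Edge i p j q \<in> A"
      unfolding zip using h_iff[of i p q] edge(1)[of i p q] by blast
    moreover have "Edge i p j q \<in> atoms G \<longleftrightarrow> j \<noteq> Suc n \<and> Edge i p j q \<in> A"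
    proof
      assume "Edge i p j q \<in> atoms G"
      then show "j \<noteq> Suc n \<and> Edge i p j q \<in> A" by (auto simp: G(2) restrict_atoms_def)
    next
      assume e: "j \<noteq> Suc n \<and> Edge i p j q \<in> A"
      then have "i < j" "{i, j} \<subseteq> {1..Suc n}"
        using diagram_onD(5)[OF d, of i p j q] diagram_on_support[OF d, of "Edge i p j q"] by simp_all
      with e show "Edge i p j q \<in> atoms G" by (simp add: G(2) restrict_atoms_def)
    qed
    ultimately show ?thesis unfolding mem Edge by blast
  qed
  then have "atoms ?C = A" by blast
  moreover have "?C \<in> compositions G V"
    unfolding compositions_def using len as(3) asF bs by blast
  ultimately show ?case using generated_compositions[OF G(1) VD(1)] by blast
qed

lemma bij_betw_atoms: "bij_betw atoms (generated D) {A. \<exists>n. diagram_on D {1..n} A}"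
  unfolding bij_betw_def
proof
  show "inj_on atoms (generated D)"
    using generated_wf_diagram by (intro inj_onI atoms_inj) blast+
  show "atoms ` generated D = {A. \<exists>n. diagram_on D {1..n} A}"
    using generated_wf_diagram generated_surj by blast
qed

text \<open>This identifies \<open>num_connected\<close> with the number of connected sets of atoms,
  which is what the numbering \<open>con\<close> requires.\<close>

lemma bij_betw_atoms_connected:
  "bij_betw atoms {G \<in> generated D. connected_bdiagram G \<and> nverts G = m}
     {A. diagram_on D {1..m} A \<and> connected_on {1..m} A}"
  unfolding bij_betw_def
proof
  show "inj_on atoms {G \<in> generated D. connected_bdiagram G \<and> nverts G = m}"
    using bij_betw_atoms by (auto simp: bij_betw_def intro: inj_on_subset)
  show "atoms ` {G \<in> generated D. connected_bdiagram G \<and> nverts G = m} =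
      {A. diagram_on D {1..m} A \<and> connected_on {1..m} A}"
  proof (intro equalityI subsetI)
    fix A assume "A \<in> atoms ` {G \<in> generated D. connected_bdiagram G \<and> nverts G = m}"
    then obtain G where "G \<in> generated D" "connected_bdiagram G" "nverts G = m" "A = atoms G" by blast
    then show "A \<in> {A. diagram_on D {1..m} A \<and> connected_on {1..m} A}"
      using generated_wf_diagram[of G] connected_bdiagram_atoms[of G] by auto
  next
    fix A assume A: "A \<in> {A. diagram_on D {1..m} A \<and> connected_on {1..m} A}"
    then obtain G where G: "G \<in> generated D" "atoms G = A" using generated_surj by blast
    then have "nverts G = m" using A diagram_on_nverts[of D m G] by simp
    then show "A \<in> atoms ` {G \<in> generated D. connected_bdiagram G \<and> nverts G = m}"
      using G A generated_wf_diagram[OF G(1)] connected_bdiagram_atoms[of G] by blast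
  qed
qed

text \<open>Finitely many vertices, elementary diagrams and positions allow only finitely many
  atoms. Finiteness matters because \<open>card\<close> is 0 on infinite sets, where
  \<open>num_connected\<close> would cease to count.\<close>

lemma finite_diagrams:
  assumes "finite D"
  shows "finite {A. diagram_on D {1..m} A}"
proof -
  let ?F = "\<Union>V\<in>D. Fup V \<union> Fdown V"
  let ?X = "(\<lambda>(i, V). Vertex i V) ` ({1..m} \<times> D) \<union>
    (\<lambda>(i, p, j, q). Edge i p j q) ` ({1..m} \<times> ?F \<times> {1..m} \<times> ?F)"
  have fin: "finite (Fup V \<union> Fdown V)" if "V \<in> D" for V
  proof -
    have "Fup V \<union> Fdown V \<subseteq> {1..weight V}"
      using elementaryD(1)[of V] elementary that by (auto simp: wf_bdiagram_def)
    then show ?thesis by (rule finite_subset) simp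
  qed
  then have "finite ?X" using assms by (intro finite_UnI finite_imageI finite_cartesian_product finite_UN_I) auto
  moreover have "{A. diagram_on D {1..m} A} \<subseteq> Pow ?X"
  proof (intro subsetI PowI)
    fix A x assume "A \<in> {A. diagram_on D {1..m} A}" and x: "x \<in> A"
    then have d: "diagram_on D {1..m} A" by simp
    show "x \<in> ?X"
    proof (cases x)
      case (Vertex i V)
      then show ?thesis using diagram_onD(1,2)[OF d, of i V] x by auto
    next
      case (Edge i p j q)
      with x have e: "Edge i p j q \<in> A" by simp
      have "p \<in> ?F" using diagram_onD(6)[OF d e] diagram_onD(2)[OF d] by blast
      moreover have "q \<in> ?F" using diagram_onD(7)[OF d e] diagram_onD(2)[OF d] by blast
      moreover have "i \<in> {1..m}" "j \<in> {1..m}" using diagram_on_support[OF d x] Edge by auto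
      ultimately have "(i, p, j, q) \<in> {1..m} \<times> ?F \<times> {1..m} \<times> ?F" by blast
      then show ?thesis unfolding Edge by force
    qed
  qed
  ultimately show ?thesis by (meson finite_Pow_iff finite_subset)
qed

lemma connected_colouring_exists:
  assumes "finite D"
  shows "\<exists>con. connected_colouring D (num_connected D) con"
proof -
  have "\<exists>f. bij_betw f {1..num_connected D m} {A. diagram_on D {1..m} A \<and> connected_on {1..m} A}" for m
  proof -
    have "finite {A. diagram_on D {1..m} A \<and> connected_on {1..m} A}"
      using finite_diagrams[OF assms, of m] by (rule rev_finite_subset) blast
    then show ?thesis
      using ex_bij_betw_nat_finite_1 bij_betw_same_card[OF bij_betw_atoms_connected[of m]]
      unfolding num_connected_def by metis
  qed
  then obtain con where "\<And>m. bij_betw (con m) {1..num_connected D m}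
      {A. diagram_on D {1..m} A \<and> connected_on {1..m} A}" by metis
  then show ?thesis unfolding connected_colouring_def by blast
qed

end

text \<open>Permuting by the inverse of \<open>unshuffle\<close> relabels by
  \<open>unshuffle\<close> itself, as the two inverses cancel. On the first factor this is the
  enumeration of \<open>S\<close>; on the second, the shift made by juxtaposition cancels the
  subtraction inside \<open>unshuffle\<close> and leaves the enumeration of the complement.\<close>

lemma atoms_shuffle:
  assumes "wf_bdiagram G" "wf_bdiagram G'" "S \<in> splittings (nverts G) (nverts G')"
  defines "H \<equiv> permute_vertices (juxtapose G G') (inv_into UNIV (unshuffle (nverts G) (nverts G') S))"
  shows "wf_bdiagram H"
    "atoms H = relabel (nth_of S) (atoms G) \<union> relabel (nth_of ({1..nverts G + nverts G'} - S)) (atoms G')"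
proof -
  let ?u = "unshuffle (nverts G) (nverts G') S"
  have perm: "?u permutes {1..nverts G + nverts G'}" using assms(3) by (rule unshuffle_permutes)
  interpret c: composition G G' "[]" "[]" using assms(1,2) by unfold_locales simp_all
  have C: "juxtapose G G' = c.C" by (simp add: juxtapose_def)
  interpret p: vertex_permutation "juxtapose G G'" "inv_into UNIV ?u"
  proof
    show "wf_bdiagram (juxtapose G G')" unfolding C by (rule c.wf_C)
    show "inv_into UNIV ?u permutes {1..nverts (juxtapose G G')}"
      unfolding C c.nverts_C using perm by (rule permutes_inv)
  qed
  show "wf_bdiagram H" unfolding H_def by (rule p.wf_H)
  have "atoms H = relabel ?u (atoms (juxtapose G G'))"
    unfolding H_def p.atoms_H permutes_inv_inv[OF perm] ..
  also have "\<dots> = relabel ?u (atoms G) \<union> relabel (?u \<circ> (\<lambda>k. k + nverts G)) (atoms G')"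
    unfolding C c.atoms_C by (simp add: relabel_Un relabel_relabel)
  also have "relabel ?u (atoms G) = relabel (nth_of S) (atoms G)"
    by (rule relabel_cong, erule atoms_support) (simp add: unshuffle_def)
  also have "relabel (?u \<circ> (\<lambda>k. k + nverts G)) (atoms G') =
      relabel (nth_of ({1..nverts G + nverts G'} - S)) (atoms G')"
    by (rule relabel_cong, erule atoms_support) (simp add: unshuffle_def)
  finally show "atoms H = relabel (nth_of S) (atoms G) \<union>
      relabel (nth_of ({1..nverts G + nverts G'} - S)) (atoms G')" .
qed

theorem theorem43:
  fixes \<D> :: "bdiagram set"
  assumes "finite \<D>" and "\<forall>V \<in> \<D>. elementary V"
  shows "algebra_isomorphic (CPiQSym (num_connected \<D>)) (dual_diagram_algebra \<D>)"
proof -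
  obtain con where "connected_colouring \<D> (num_connected \<D>) con"
    using connected_colouring_exists[OF assms(2,1)] by blast
  then interpret connected_colouring \<D> "num_connected \<D>" con .
  let ?c = "num_connected \<D>" and ?gen = "generated \<D>"
  \<comment> \<open>Colours are filled in to give a set of atoms, which is then decoded into the
    unique generated diagram with these atoms.\<close>
  let ?f = "inv_into ?gen atoms \<circ> fill"
  note bij_atoms = bij_betw_atoms[OF assms(2)]
  have mem: "Q \<in> cpartitions ?c \<longleftrightarrow> (\<exists>n. coloured {1..n} Q)" for Q
    by (simp add: cpartitions_def cpartition_of_eq)
  have bij_fill: "bij_betw fill (cpartitions ?c) {A. \<exists>n. diagram_on \<D> {1..n} A}"
    unfolding bij_betw_def
  proof
    show "inj_on fill (cpartitions ?c)"
    proof (rule inj_onI)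
      fix P Q assume "P \<in> cpartitions ?c" "Q \<in> cpartitions ?c" and eq: "fill P = fill Q"
      then obtain m n where PQ: "coloured {1..m} P" "coloured {1..n} Q" unfolding mem by blast
      \<comment> \<open>\<open>cpartitions\<close> contains all sizes at once. The vertex atoms
        reveal the size, and only for a common size does \<open>unfill_fill\<close> apply to both
        partitions.\<close>
      have "{i. \<exists>V. Vertex i V \<in> fill P} = {1..m}" "{i. \<exists>V. Vertex i V \<in> fill Q} = {1..n}"
        using diagram_onD(1,3)[OF diagram_on_fill[OF _ PQ(1)]] diagram_onD(1,3)[OF diagram_on_fill[OF _ PQ(2)]]
        by blast+
      then have "{1..m} = {1..n}" by (simp only: eq)
      with PQ(1) have "coloured {1..n} P" by (simp only:)
      then show "P = Q" using unfill_fill[OF finite_atLeastAtMost] PQ(2) eq by metis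
    qed
    show "fill ` cpartitions ?c = {A. \<exists>n. diagram_on \<D> {1..n} A}"
    proof (intro equalityI subsetI)
      fix A assume "A \<in> fill ` cpartitions ?c"
      then show "A \<in> {A. \<exists>n. diagram_on \<D> {1..n} A}"
        unfolding image_iff Bex_def mem using diagram_on_fill[OF finite_atLeastAtMost] by blast
    next
      fix A assume "A \<in> {A. \<exists>n. diagram_on \<D> {1..n} A}"
      then obtain n where "diagram_on \<D> {1..n} A" by blast
      then have "coloured {1..n} (unfill {1..n} A)" "fill (unfill {1..n} A) = A"
        using fill_unfill[OF finite_atLeastAtMost] by blast+
      then show "A \<in> fill ` cpartitions ?c" unfolding image_iff Bex_def mem by metis
    qed
  qed
  have bij: "bij_betw ?f (cpartitions ?c) ?gen"
    using bij_fill bij_betw_inv_into[OF bij_atoms] by (rule bij_betw_trans)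
  have f: "?f Q \<in> ?gen" "atoms (?f Q) = fill Q" if "Q \<in> cpartitions ?c" for Q
  proof -
    show "?f Q \<in> ?gen" using bij that by (auto simp: bij_betw_def)
    have "fill Q \<in> {A. \<exists>n. diagram_on \<D> {1..n} A}" using bij_fill that by (auto simp: bij_betw_def)
    then show "atoms (?f Q) = fill Q" using bij_betw_inv_into_right[OF bij_atoms] by simp
  qed
  \<comment> \<open>A value of \<open>?f\<close> is identified by its atoms alone; this also
    accounts for permuted diagrams without a separate proof that they are generated.\<close>
  have f_eq: "?f Q = G" if "Q \<in> cpartitions ?c" "wf_bdiagram G" "atoms G = fill Q" for Q G
    using f[OF that(1)] generated_wf_diagram[OF assms(2), of "?f Q"] that(2,3)
    by (intro atoms_inj) simp_all
  show ?thesis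
    unfolding CPiQSym_def dual_diagram_algebra_def
  proof (rule based_algebra_isomorphicI[OF bij])
    have "{} \<in> cpartitions ?c" unfolding mem by (rule exI[of _ 0]) (simp add: coloured_def partition_on_empty)
    moreover have "fill {} = {}" by (simp add: fill_def)
    ultimately show "?f {} = empty_bdiagram"
      using wf_empty_bdiagram atoms_empty_bdiagram by (intro f_eq) simp_all
  next
    fix P Q assume "P \<in> cpartitions ?c" "Q \<in> cpartitions ?c"
    then obtain n n' where PQ: "coloured {1..n} P" "coloured {1..n'} Q" unfolding mem by blast
    have glue: "glue (n + n') P Q S \<in> cpartitions ?c" if "S \<in> splittings n n'" for S
      unfolding mem using coloured_glue(1)[OF PQ that] by blast
    note product = cpartition_product_eq[OF PQ]
    show "Poly_Mapping.keys (cpartition_product ?c P Q) \<subseteq> cpartitions ?c"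
      unfolding product by (rule order.trans[OF keys_sum]) (use glue in auto)
    have P: "P \<in> cpartitions ?c" and Q: "Q \<in> cpartitions ?c" unfolding mem using PQ by blast+
    have wf: "wf_bdiagram (?f P)" "wf_bdiagram (?f Q)"
      using generated_wf_diagram[OF assms(2)] f(1)[OF P] f(1)[OF Q] by blast+
    have n: "nverts (?f P) = n" "nverts (?f Q) = n'"
      using diagram_on_nverts[of \<D> n "?f P"] diagram_on_nverts[of \<D> n' "?f Q"]
        diagram_on_fill[OF _ PQ(1)] diagram_on_fill[OF _ PQ(2)] f(2)[OF P] f(2)[OF Q] by simp_all
    \<comment> \<open>Both sides have the same atoms, computed by \<open>atoms_shuffle\<close> on
      the left and by \<open>fill_glue\<close> on the right.\<close>
    have shuffle: "permute_vertices (juxtapose (?f P) (?f Q)) (inv_into UNIV (unshuffle n n' S)) =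
        ?f (glue (n + n') P Q S)" if S: "S \<in> splittings n n'" for S
    proof (rule f_eq[symmetric, OF glue[OF S]])
      note H = atoms_shuffle[OF wf, unfolded n, OF S]
      show "wf_bdiagram (permute_vertices (juxtapose (?f P) (?f Q)) (inv_into UNIV (unshuffle n n' S)))"
        by (rule H(1))
      show "atoms (permute_vertices (juxtapose (?f P) (?f Q)) (inv_into UNIV (unshuffle n n' S))) =
          fill (glue (n + n') P Q S)"
        unfolding H(2) f(2)[OF P] f(2)[OF Q] fill_glue[OF PQ S] ..
    qed
    have "diagram_product (?f P) (?f Q) = (\<Sum>S\<in>splittings n n'. Poly_Mapping.single
        (permute_vertices (juxtapose (?f P) (?f Q)) (inv_into UNIV (unshuffle n n' S))) 1)"
      unfolding diagram_product_def n
      \<comment> \<open>The sum over shuffles becomes a sum over the sets of positions, the index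
        set of \<open>cpartition_product_eq\<close>.\<close>
      by (rule sum.reindex_bij_betw[OF unshuffle_bij_shuffle_perms, symmetric])
    also have "\<dots> = (\<Sum>S\<in>splittings n n'. Poly_Mapping.single (?f (glue (n + n') P Q S)) 1)"
      by (rule sum.cong[OF refl]) (simp only: shuffle)
    also have "\<dots> = pushforward ?f (cpartition_product ?c P Q)"
      unfolding product pushforward_sum pushforward_single ..
    finally show "diagram_product (?f P) (?f Q) = pushforward ?f (cpartition_product ?c P Q)" .
  qed
qed

end
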